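(* Let $\widehat S\in\mathrm{Mp}_+(d,\mathbb{C})$ and let $S\in\mathrm{Sp}_+(d,\mathbb{C})$ be its projection. Then the identity $$\widehat S\rho(z;\tau)f=\rho(Sz;\tau)\widehat Sf,\qquad z\in\mathbb{R}^{2d},\ \tau\in\mathbb{R},$$ holds for all $f$ in a dense subset of $L^2(\mathbb{R}^d)$. Specifically, it holds for all $$f\in\mathrm{span}\big\{\rho(z';\tau')\varphi_M:\ z'\in\mathbb{R}^{2d},\ \tau'\in\mathbb{R},\ M\in\mathbb{R}^{d\times d},\ M=M^\top \text{ positive-definite}\big\},\qquad \varphi_M(x)=e^{-\pi Mx\cdot x}.$$
   Context: For $z,w\in\mathbb{C}^d$ and $\tau\in\mathbb{R}$, the complexified Schrödinger representation is defined, for functions $f$ for which the integral converges (e.g. finite linear combinations of Gaussian-type functions whose Fourier transform has Gaussian decay), by $$\rho(z,w;\tau)f(y)=e^{2\pi i\tau}e^{-i\pi z\cdot w}e^{2\pi iw\cdot y}\int_{\mathbb{R}^d}\widehat f(\eta)e^{2\pi i\eta\cdot(y-z)}d\eta,\qquad \widehat f(\eta)=\int_{\mathbb{R}^d} f(x)e^{-2\pi i\eta\cdot x}dx,$$ where $a\cdot b=\sum_ja_jb_j$ is bilinear also for complex vectors. For $(x,\xi)\in\mathbb{R}^{2d}$ this is the usual $\rho(x,\xi;\tau)f(y)=e^{2\pi i\tau}e^{-i\pi x\cdot\xi}e^{2\pi i\xi\cdot y}f(y-x)$ on $L^2(\mathbb{R}^d)$. Let $J=\begin{pmatrix}O_d&I_d\\-I_d&O_d\end{pmatrix}$,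 $V_Q=\begin{pmatrix}I_d&O_d\\Q&I_d\end{pmatrix}$, $\mathcal{D}_E=\begin{pmatrix}E^{-1}&O_d\\O_d&E^\top\end{pmatrix}$. $\mathrm{Sp}(d,\mathbb{C})=\{S:S^\top JS=J\}$, and $\mathrm{Sp}_+(d,\mathbb{C})$ is the semigroup of those $S$ with $i^{-1}(\sigma(Sz,\overline{Sz})-\sigma(z,\overline z))\ge0$ for all $z\in\mathbb{C}^{2d}$, $\sigma(z,w)=Jz\cdot w$. $\mathrm{Mp}(d,\mathbb{R})$ is the group of unitary operators on $L^2(\mathbb{R}^d)$ generated by $\mathcal{F}f=i^{-d/2}\widehat f$, $\mathfrak{p}_Qf(x)=e^{i\pi Qx\cdot x}f(x)$ ($Q$ real symmetric), $\mathfrak{T}_Ef(x)=i^m|\det E|^{1/2}f(Ex)$ ($E\in\mathrm{GL}(d,\mathbb{R})$, $m\in\mathbb{Z}$ with $m\pi$ an argument of $\det E$); the two-fold covering homomorphism $\pi^{Mp}$ onto $\mathrm{Sp}(d,\mathbb{R})$ sends these to $J,V_Q,\mathcal{D}_E$. For $\vartheta\ge0$, $\alpha>0$ set on $L^2(\mathbb{R})$: $\mathfrak{R}_\vartheta f(x)=(\cosh\vartheta)^{-1/2}\int_{\mathbb{R}}e^{i\pi(2x\eta+i(x^2+\eta^2)\sinh\vartheta)/\cosh\vartheta}\widehat f(\eta)d\eta$, $\mathfrak{p}_{i\alpha}f(x)=e^{-\pi\alpha x^2}f(x)$. An atomic metaplectic contraction is $\widehat\Xi=\widehat\Xi_1\otimes\cdots\otimes\widehat\Xi_d$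 with each $\widehat\Xi_j$ equal to some $\mathfrak{R}_{\vartheta_j}$ or $\mathfrak{p}_{i\alpha_j}$. $\mathrm{Mp}_+(d,\mathbb{C})$ is the semigroup generated by $\mathrm{Mp}(d,\mathbb{R})$ and atomic metaplectic contractions. The projection is the homomorphism $\pi^{Mp}_+:\mathrm{Mp}_+(d,\mathbb{C})\to\mathrm{Sp}_+(d,\mathbb{C})$ (a two-fold cover) equal to $\pi^{Mp}$ on $\mathrm{Mp}(d,\mathbb{R})$ and sending $\widehat\Xi$ to $\Xi=\begin{pmatrix}\mathrm{diag}(a_j)&\mathrm{diag}(b_j)\\ \mathrm{diag}(c_j)&\mathrm{diag}(d_j)\end{pmatrix}$, where $\begin{pmatrix}a_j&b_j\\c_j&d_j\end{pmatrix}$ is $\begin{pmatrix}\cosh\vartheta_j&-i\sinh\vartheta_j\\ i\sinh\vartheta_j&\cosh\vartheta_j\end{pmatrix}$ if $\widehat\Xi_j=\mathfrak{R}_{\vartheta_j}$ and $\begin{pmatrix}1&0\\ i\alpha_j&1\end{pmatrix}$ if $\widehat\Xi_j=\mathfrak{p}_{i\alpha_j}$. *)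

theory Defs
  imports "HOL-Analysis.Analysis"
begin

section \<open>The space of square-integrable functions modulo null sets\<close>

definition sqint :: "('a::euclidean_space \<Rightarrow> complex) \<Rightarrow> bool" where
  "sqint f \<longleftrightarrow> f \<in> borel_measurable lborel \<and> integrable lborel (\<lambda>x. (cmod (f x))\<^sup>2)"

lemma sqint_measurable: "sqint f \<Longrightarrow> f \<in> borel_measurable lborel"
  by (simp add: sqint_def)

lemma sqint_zero: "sqint (\<lambda>x. 0)"
  by (simp add: sqint_def)

lemma sqint_add:
  assumes "sqint f" "sqint g"
  shows "sqint (\<lambda>x. f x + g x)"
proof -
  have [measurable]: "f \<in> borel_measurable lborel" "g \<in> borel_measurable lborel"
    using assms by (auto simp: sqint_def)
  have i: "integrable lborel (\<lambda>x. 2 * (cmod (f x))\<^sup>2 + 2 * (cmod (g x))\<^sup>2)"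
    using assms by (auto simp: sqint_def)
  have "(cmod (f x + g x))\<^sup>2 \<le> 2 * (cmod (f x))\<^sup>2 + 2 * (cmod (g x))\<^sup>2" for x
  proof -
    have "(cmod (f x + g x))\<^sup>2 \<le> (cmod (f x) + cmod (g x))\<^sup>2"
      by (intro power_mono norm_triangle_ineq) auto
    also have "\<dots> \<le> 2 * (cmod (f x))\<^sup>2 + 2 * (cmod (g x))\<^sup>2"
      using sum_squares_bound[of "cmod (f x)" "cmod (g x)"] by (simp add: power2_sum)
    finally show ?thesis .
  qed
  then have "integrable lborel (\<lambda>x. (cmod (f x + g x))\<^sup>2)"
    by (intro Bochner_Integration.integrable_bound[OF i]) auto
  then show ?thesis by (simp add: sqint_def)
qed

lemma sqint_scale: "sqint f \<Longrightarrow> sqint (\<lambda>x. c * f x)"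
  by (auto simp: sqint_def norm_mult power_mult_distrib)

lemma sqint_scaleR: "sqint f \<Longrightarrow> sqint (\<lambda>x. r *\<^sub>R f x)"
  by (auto simp: sqint_def power_mult_distrib)

lemma sqint_uminus: "sqint f \<Longrightarrow> sqint (\<lambda>x. - f x)"
  by (auto simp: sqint_def)

lemma sqint_diff: "sqint f \<Longrightarrow> sqint g \<Longrightarrow> sqint (\<lambda>x. f x - g x)"
  using sqint_add[of f "\<lambda>x. - g x"] sqint_uminus[of g] by simp

lemma sqint_inner_integrable:
  assumes "sqint f" "sqint g"
  shows "integrable lborel (\<lambda>x. inner (f x) (g x))"
proof -
  have [measurable]: "f \<in> borel_measurable lborel" "g \<in> borel_measurable lborel"
    using assms by (auto simp: sqint_def)
  have i: "integrable lborel (\<lambda>x. (cmod (f x))\<^sup>2 + (cmod (g x))\<^sup>2)"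
    using assms by (auto simp: sqint_def)
  have "norm (inner (f x) (g x)) \<le> norm ((cmod (f x))\<^sup>2 + (cmod (g x))\<^sup>2)" for x
  proof -
    have "norm (inner (f x) (g x)) \<le> cmod (f x) * cmod (g x)"
      using Cauchy_Schwarz_ineq2 by auto
    also have "\<dots> \<le> (cmod (f x))\<^sup>2 + (cmod (g x))\<^sup>2"
      using sum_squares_bound[of "cmod (f x)" "cmod (g x)"]
        mult_nonneg_nonneg[OF norm_ge_zero[of "f x"] norm_ge_zero[of "g x"]] by linarith
    finally show ?thesis by simp
  qed
  then show ?thesis
    by (intro Bochner_Integration.integrable_bound[OF i]) auto
qed

quotient_type (overloaded) 'a L2 = "'a::euclidean_space \<Rightarrow> complex" / partial:
  "\<lambda>f g. sqint f \<and> sqint g \<and> (AE x in lborel. f x = g x)"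
proof (rule part_equivpI)
  show "\<exists>f::'a \<Rightarrow> complex. sqint f \<and> sqint f \<and> (AE x in lborel. f x = f x)"
    by (rule exI[of _ "\<lambda>x. 0"]) (simp add: sqint_zero)
  show "symp (\<lambda>f g :: 'a \<Rightarrow> complex. sqint f \<and> sqint g \<and> (AE x in lborel. f x = g x))"
    by (auto simp: symp_def elim: eventually_mono)
  show "transp (\<lambda>f g :: 'a \<Rightarrow> complex. sqint f \<and> sqint g \<and> (AE x in lborel. f x = g x))"
    unfolding transp_def by (auto elim: eventually_elim2)
qed

instantiation L2 :: (euclidean_space) real_inner
begin

lift_definition zero_L2 :: "'a L2" is "\<lambda>x. 0"
  by (simp add: sqint_zero)

lift_definition plus_L2 :: "'a L2 \<Rightarrow> 'a L2 \<Rightarrow> 'a L2" is "\<lambda>f g x. f x + g x"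
  by (auto simp: sqint_add elim: eventually_elim2)

lift_definition minus_L2 :: "'a L2 \<Rightarrow> 'a L2 \<Rightarrow> 'a L2" is "\<lambda>f g x. f x - g x"
  by (auto simp: sqint_diff elim: eventually_elim2)

lift_definition uminus_L2 :: "'a L2 \<Rightarrow> 'a L2" is "\<lambda>f x. - f x"
  by (auto simp: sqint_uminus elim: eventually_mono)

lift_definition scaleR_L2 :: "real \<Rightarrow> 'a L2 \<Rightarrow> 'a L2" is "\<lambda>r f x. r *\<^sub>R f x"
  by (auto simp: sqint_scaleR elim: eventually_mono)

text \<open>The real part of the usual inner product; it induces the usual \<open>L\<^sup>2\<close> norm.\<close>

lift_definition inner_L2 :: "'a L2 \<Rightarrow> 'a L2 \<Rightarrow> real" is "\<lambda>f g. LINT x|lborel. inner (f x) (g x)"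
proof -
  fix f f' g g' :: "'a \<Rightarrow> complex"
  assume a: "sqint f \<and> sqint f' \<and> (AE x in lborel. f x = f' x)"
    and b: "sqint g \<and> sqint g' \<and> (AE x in lborel. g x = g' x)"
  then have [measurable]: "f \<in> borel_measurable lborel" "g \<in> borel_measurable lborel"
    "f' \<in> borel_measurable lborel" "g' \<in> borel_measurable lborel"
    by (auto simp: sqint_def)
  have "AE x in lborel. inner (f x) (g x) = inner (f' x) (g' x)"
    using a b by (auto elim: eventually_elim2)
  then show "(LINT x|lborel. inner (f x) (g x)) = (LINT x|lborel. inner (f' x) (g' x))"
    by (intro integral_cong_AE) auto
qed

definition norm_L2 :: "'a L2 \<Rightarrow> real" where "norm_L2 f = sqrt (inner f f)"
definition sgn_L2 :: "'a L2 \<Rightarrow> 'a L2" where "sgn_L2 f = scaleR (inverse (norm f)) f"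
definition dist_L2 :: "'a L2 \<Rightarrow> 'a L2 \<Rightarrow> real" where "dist_L2 f g = norm (f - g)"
definition uniformity_L2 :: "('a L2 \<times> 'a L2) filter" where
  "uniformity_L2 = (INF e\<in>{0<..}. principal {(x, y). dist x y < e})"
definition open_L2 :: "'a L2 set \<Rightarrow> bool" where
  "open_L2 U \<longleftrightarrow> (\<forall>x\<in>U. eventually (\<lambda>(x', y). x' = x \<longrightarrow> y \<in> U) uniformity)"

instance
proof
  fix f g h :: "'a L2" and r s :: real
  show "f + g + h = f + (g + h)"
    by transfer (auto simp: sqint_add ac_simps)
  show "f + g = g + f"
    by transfer (auto simp: sqint_add ac_simps)
  show "0 + f = f"
    by transfer auto
  show "- f + f = 0"
    by transfer (auto simp: sqint_zero)
  show "f - g = f + - g"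
    by transfer (auto simp: sqint_diff)
  show "r *\<^sub>R (f + g) = r *\<^sub>R f + r *\<^sub>R g"
    by transfer (auto simp: sqint_scaleR sqint_add scaleR_add_right)
  show "(r + s) *\<^sub>R f = r *\<^sub>R f + s *\<^sub>R f"
    by transfer (auto simp: sqint_scaleR sqint_add scaleR_add_left
        simp flip: scaleR_add_left)
  show "r *\<^sub>R s *\<^sub>R f = (r * s) *\<^sub>R f"
    by transfer (use sqint_scaleR in force)
  show "1 *\<^sub>R f = f"
    by transfer auto
  show "dist f g = norm (f - g)" by (rule dist_L2_def)
  show "sgn f = scaleR (inverse (norm f)) f" by (rule sgn_L2_def)
  show "uniformity = (INF e\<in>{0<..}. principal {(x, y::'a L2). dist x y < e})"
    by (rule uniformity_L2_def)
  show "open U \<longleftrightarrow> (\<forall>x\<in>U. eventually (\<lambda>(x', y). x' = x \<longrightarrow> y \<in> U) uniformity)" for U :: "'a L2 set"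
    by (rule open_L2_def)
  show "inner f g = inner g f"
    by transfer (simp add: inner_commute)
  show "inner (f + g) h = inner f h + inner g h"
    by transfer (simp add: inner_add_left sqint_inner_integrable)
  show "inner (r *\<^sub>R f) g = r * inner f g"
    by transfer simp
  show "0 \<le> inner f f"
    by transfer simp
  show "inner f f = 0 \<longleftrightarrow> f = 0"
  proof (transfer, goal_cases)
    case (1 f)
    then have "sqint f" by simp
    then have "integrable lborel (\<lambda>x. inner (f x) (f x))" by (intro sqint_inner_integrable)
    then have "((LINT x|lborel. inner (f x) (f x)) = 0) = (AE x in lborel. inner (f x) (f x) = 0)"
      by (intro integral_nonneg_eq_0_iff_AE) auto
    then show ?case using \<open>sqint f\<close> by (simp add: sqint_zero)
  qed
  show "norm f = sqrt (inner f f)" by (rule norm_L2_def)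
qed

end

lift_definition scaleC_L2 :: "complex \<Rightarrow> 'a::euclidean_space L2 \<Rightarrow> 'a L2" is "\<lambda>c f x. c * f x"
  by (auto simp: sqint_scale elim: eventually_mono)

interpretation cL2: vector_space "scaleC_L2 :: complex \<Rightarrow> 'a::euclidean_space L2 \<Rightarrow> 'a L2"
proof
  fix a b :: complex and f g :: "'a L2"
  show "scaleC_L2 a (f + g) = scaleC_L2 a f + scaleC_L2 a g"
    by transfer (auto simp: sqint_add sqint_scale distrib_left)
  show "scaleC_L2 (a + b) f = scaleC_L2 a f + scaleC_L2 b f"
    by transfer (auto simp: sqint_add sqint_scale distrib_right simp flip: distrib_right)
  show "scaleC_L2 a (scaleC_L2 b f) = scaleC_L2 (a * b) f"
    by transfer (auto simp: sqint_scale mult.assoc simp flip: mult.assoc)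
  show "scaleC_L2 1 f = f"
    by transfer auto
qed

text \<open>\<open>toL2 f\<close> is the class of \<open>f\<close> and is meaningful only if \<open>sqint f\<close>;
  \<open>fromL2 u\<close> is some square-integrable representative of \<open>u\<close>.\<close>

abbreviation toL2 :: "('a::euclidean_space \<Rightarrow> complex) \<Rightarrow> 'a L2" where "toL2 \<equiv> abs_L2"
abbreviation fromL2 :: "'a::euclidean_space L2 \<Rightarrow> 'a \<Rightarrow> complex" where "fromL2 \<equiv> rep_L2"

section \<open>Fourier transform and the complexified Schroedinger representation\<close>

definition fourier :: "('a::euclidean_space \<Rightarrow> complex) \<Rightarrow> 'a \<Rightarrow> complex" where
  "fourier f \<eta> = (LINT x|lborel. f x * exp (- 2 * of_real pi * \<i> * of_real (\<eta> \<bullet> x)))"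

text \<open>The Fourier--Plancherel transform, as the \<open>L\<^sup>2\<close> limit of truncated Fourier integrals.\<close>

definition fourierL2 :: "'a::euclidean_space L2 \<Rightarrow> 'a L2" where
  "fourierL2 u = lim (\<lambda>n. toL2 (fourier (\<lambda>x. indicator (cball 0 (real n)) x * fromL2 u x)))"

definition cvec :: "real^'m \<Rightarrow> complex^'m" where
  "cvec x = (\<chi> i. of_real (x $ i))"

definition cmat :: "real^'m^'k \<Rightarrow> complex^'m^'k" where
  "cmat A = (\<chi> i j. of_real (A $ i $ j))"

text \<open>Bilinear, not sesquilinear.\<close>

definition cdot :: "complex^'m \<Rightarrow> complex^'m \<Rightarrow> complex" where
  "cdot a b = (\<Sum>j\<in>UNIV. a $ j * b $ j)"

text \<open>A vector of dimension \<open>2d\<close> has index type \<open>'n + 'n\<close>; its two halves are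
  the position and the frequency part.\<close>

definition pos_part :: "complex^('n+'n) \<Rightarrow> complex^'n" where
  "pos_part z = (\<chi> i. z $ Inl i)"

definition freq_part :: "complex^('n+'n) \<Rightarrow> complex^'n" where
  "freq_part z = (\<chi> i. z $ Inr i)"

definition rho_fun :: "complex^('n+'n) \<Rightarrow> real \<Rightarrow> (real^'n \<Rightarrow> complex) \<Rightarrow> real^'n \<Rightarrow> complex" where
  "rho_fun z \<tau> f y =
     exp (2 * of_real pi * \<i> * of_real \<tau>)
     * exp (- \<i> * of_real pi * cdot (pos_part z) (freq_part z))
     * exp (2 * of_real pi * \<i> * cdot (freq_part z) (cvec y))
     * (LINT \<eta>|lborel. fourier f \<eta>
          * exp (2 * of_real pi * \<i> * cdot (cvec \<eta>) (cvec y - pos_part z)))"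

text \<open>The classes for which all integrals in the definition converge and the result is again
  square-integrable.\<close>

definition rho_dom :: "complex^('n+'n) \<Rightarrow> real \<Rightarrow> (real^'n) L2 set" where
  "rho_dom z \<tau> = {u. integrable lborel (fromL2 u)
     \<and> (\<forall>y. integrable lborel (\<lambda>\<eta>. fourier (fromL2 u) \<eta>
          * exp (2 * of_real pi * \<i> * cdot (cvec \<eta>) (cvec y - pos_part z))))
     \<and> sqint (rho_fun z \<tau> (fromL2 u))}"

definition rho :: "complex^('n+'n) \<Rightarrow> real \<Rightarrow> (real^'n) L2 \<Rightarrow> (real^'n) L2" where
  "rho z \<tau> u = toL2 (rho_fun z \<tau> (fromL2 u))"

section \<open>Symplectic matrices\<close>

definition block_mat ::
  "'c^'n^'n \<Rightarrow> 'c^'n^'n \<Rightarrow> 'c^'n^'n \<Rightarrow> 'c^'n^'n \<Rightarrow> 'c^('n+'n)^('n+'n)" where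
  "block_mat A B C D = (\<chi> i j. case i of
       Inl k \<Rightarrow> (case j of Inl l \<Rightarrow> A $ k $ l | Inr l \<Rightarrow> B $ k $ l)
     | Inr k \<Rightarrow> (case j of Inl l \<Rightarrow> C $ k $ l | Inr l \<Rightarrow> D $ k $ l))"

definition diag_mat :: "('n \<Rightarrow> complex) \<Rightarrow> complex^'n^'n" where
  "diag_mat a = (\<chi> i j. if i = j then a i else 0)"

definition J_mat :: "complex^('n::finite+'n)^('n+'n)" where
  "J_mat = block_mat 0 (mat 1) (- mat 1) 0"

definition V_mat :: "real^'n^'n \<Rightarrow> complex^('n+'n)^('n+'n)" where
  "V_mat Q = block_mat (mat 1) 0 (cmat Q) (mat 1)"

definition D_mat :: "real^'n^'n \<Rightarrow> complex^('n+'n)^('n+'n)" where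
  "D_mat E = block_mat (cmat (matrix_inv E)) 0 0 (cmat (transpose E))"

definition Sp_C :: "(complex^('n::finite+'n)^('n+'n)) set" where
  "Sp_C = {S. transpose S ** J_mat ** S = J_mat}"

definition sigma :: "complex^('n::finite+'n) \<Rightarrow> complex^('n+'n) \<Rightarrow> complex" where
  "sigma z w = cdot (J_mat *v z) w"

definition cnj_vec :: "complex^'m \<Rightarrow> complex^'m" where
  "cnj_vec z = (\<chi> i. cnj (z $ i))"

definition Sp_plus :: "(complex^('n::finite+'n)^('n+'n)) set" where
  "Sp_plus = {S \<in> Sp_C. \<forall>z.
     (sigma (S *v z) (cnj_vec (S *v z)) - sigma z (cnj_vec z)) / \<i> \<in> \<real>\<^sub>\<ge>\<^sub>0}"

section \<open>Metaplectic operators\<close>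

definition met_F :: "(real^'n) L2 \<Rightarrow> (real^'n) L2" where
  "met_F u = scaleC_L2 (\<i> powr (- of_nat CARD('n) / 2)) (fourierL2 u)"

definition met_p :: "real^'n^'n \<Rightarrow> (real^'n) L2 \<Rightarrow> (real^'n) L2" where
  "met_p Q u = toL2 (\<lambda>x. exp (\<i> * of_real pi * of_real ((Q *v x) \<bullet> x)) * fromL2 u x)"

definition met_T :: "real^'n^'n \<Rightarrow> int \<Rightarrow> (real^'n) L2 \<Rightarrow> (real^'n) L2" where
  "met_T E m u = toL2 (\<lambda>x. \<i> powi m * of_real (sqrt \<bar>det E\<bar>) * fromL2 u (E *v x))"

inductive met_gen ::
  "((real^'n) L2 \<Rightarrow> (real^'n) L2) \<Rightarrow> complex^('n+'n)^('n+'n) \<Rightarrow> bool" where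
  F: "met_gen met_F J_mat"
| p: "transpose Q = Q \<Longrightarrow> met_gen (met_p Q) (V_mat Q)"
| T: "invertible E \<Longrightarrow> of_real (det E) = of_real \<bar>det E\<bar> * cis (of_int m * pi)
      \<Longrightarrow> met_gen (met_T E m) (D_mat E)"

inductive_set Mp :: "((real^'n) L2 \<Rightarrow> (real^'n) L2) set" where
  gen: "met_gen A S \<Longrightarrow> A \<in> Mp"
| comp: "A \<in> Mp \<Longrightarrow> B \<in> Mp \<Longrightarrow> A \<circ> B \<in> Mp"
| inv: "A \<in> Mp \<Longrightarrow> inv A \<in> Mp"

text \<open>The graph of the homomorphism \<open>Mp(d, R) \<rightarrow> Sp(d, R)\<close>: since \<open>Mp(d, R)\<close> is generated by
  the listed operators, it is the subgroup generated by the pairs (generator, image).\<close>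

inductive Mp_proj ::
  "((real^'n) L2 \<Rightarrow> (real^'n) L2) \<Rightarrow> complex^('n+'n)^('n+'n) \<Rightarrow> bool" where
  gen: "met_gen A S \<Longrightarrow> Mp_proj A S"
| comp: "Mp_proj A S \<Longrightarrow> Mp_proj B T \<Longrightarrow> Mp_proj (A \<circ> B) (S ** T)"
| inv: "Mp_proj A S \<Longrightarrow> Mp_proj (inv A) (matrix_inv S)"

section \<open>Metaplectic contractions\<close>

text \<open>The integral is understood as an \<open>L\<^sup>2\<close> limit of truncated integrals. For \<open>\<theta> > 0\<close> it converges
  absolutely; for \<open>\<theta> = 0\<close> it is the inverse Fourier transform of the Fourier transform of \<open>u\<close>.\<close>

definition contr_R :: "real \<Rightarrow> real L2 \<Rightarrow> real L2" where
  "contr_R \<theta> u = lim (\<lambda>n. toL2 (\<lambda>x. of_real (cosh \<theta> powr (- 1 / 2)) *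
     (LINT \<eta>|lborel. indicator (cball 0 (real n)) \<eta>
        * exp (\<i> * of_real pi * (2 * of_real x * of_real \<eta>
                 + \<i> * of_real ((x\<^sup>2 + \<eta>\<^sup>2) * sinh \<theta>)) / of_real (cosh \<theta>))
        * fromL2 (fourierL2 u) \<eta>)))"

definition contr_p :: "real \<Rightarrow> real L2 \<Rightarrow> real L2" where
  "contr_p \<alpha> u = toL2 (\<lambda>x. of_real (exp (- pi * \<alpha> * x\<^sup>2)) * fromL2 u x)"

text \<open>The one-dimensional factors together with the entries of the associated 2 by 2 matrix.\<close>

inductive atomic_factor ::
  "(real L2 \<Rightarrow> real L2) \<Rightarrow> complex \<Rightarrow> complex \<Rightarrow> complex \<Rightarrow> complex \<Rightarrow> bool" where
  R: "\<theta> \<ge> 0 \<Longrightarrow> atomic_factor (contr_R \<theta>)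
        (of_real (cosh \<theta>)) (- \<i> * of_real (sinh \<theta>))
        (\<i> * of_real (sinh \<theta>)) (of_real (cosh \<theta>))"
| p: "\<alpha> > 0 \<Longrightarrow> atomic_factor (contr_p \<alpha>) 1 0 (\<i> * of_real \<alpha>) 1"

definition tensor_L2 :: "('n \<Rightarrow> real L2) \<Rightarrow> (real^'n) L2" where
  "tensor_L2 u = toL2 (\<lambda>x. \<Prod>j\<in>UNIV. fromL2 (u j) (x $ j))"

text \<open>\<open>B\<close> is the tensor product of the operators \<open>A j\<close>, i.e. the bounded operator acting
  factorwise on elementary tensors (unique, as these span a dense subspace).\<close>

definition is_tensor_op ::
  "('n \<Rightarrow> real L2 \<Rightarrow> real L2) \<Rightarrow> ((real^'n) L2 \<Rightarrow> (real^'n) L2) \<Rightarrow> bool" where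
  "is_tensor_op A B \<longleftrightarrow> bounded_linear B
     \<and> (\<forall>c u. B (scaleC_L2 c u) = scaleC_L2 c (B u))
     \<and> (\<forall>u. B (tensor_L2 u) = tensor_L2 (\<lambda>j. A j (u j)))"

definition atomic_contr ::
  "((real^'n) L2 \<Rightarrow> (real^'n) L2) \<Rightarrow> complex^('n+'n)^('n+'n) \<Rightarrow> bool" where
  "atomic_contr B \<Xi> \<longleftrightarrow> (\<exists>A a b c d.
     (\<forall>j. atomic_factor (A j) (a j) (b j) (c j) (d j)) \<and> is_tensor_op A B
     \<and> \<Xi> = block_mat (diag_mat a) (diag_mat b) (diag_mat c) (diag_mat d))"

inductive_set Mp_plus :: "((real^'n) L2 \<Rightarrow> (real^'n) L2) set" where
  Mp: "A \<in> Mp \<Longrightarrow> A \<in> Mp_plus"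
| atomic: "atomic_contr A S \<Longrightarrow> A \<in> Mp_plus"
| comp: "A \<in> Mp_plus \<Longrightarrow> B \<in> Mp_plus \<Longrightarrow> A \<circ> B \<in> Mp_plus"

text \<open>The graph of the homomorphism \<open>Mp\<^sub>+(d, C) \<rightarrow> Sp\<^sub>+(d, C)\<close>.\<close>

inductive Mp_plus_proj ::
  "((real^'n) L2 \<Rightarrow> (real^'n) L2) \<Rightarrow> complex^('n+'n)^('n+'n) \<Rightarrow> bool" where
  Mp: "Mp_proj A S \<Longrightarrow> Mp_plus_proj A S"
| atomic: "atomic_contr A S \<Longrightarrow> Mp_plus_proj A S"
| comp: "Mp_plus_proj A S \<Longrightarrow> Mp_plus_proj B T \<Longrightarrow> Mp_plus_proj (A \<circ> B) (S ** T)"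

section \<open>The span of time-frequency shifted Gaussians\<close>

definition pos_def :: "real^'n^'n \<Rightarrow> bool" where
  "pos_def M \<longleftrightarrow> transpose M = M \<and> (\<forall>x. x \<noteq> 0 \<longrightarrow> (M *v x) \<bullet> x > 0)"

definition gaussian :: "real^'n^'n \<Rightarrow> real^'n \<Rightarrow> complex" where
  "gaussian M x = exp (- of_real (pi * ((M *v x) \<bullet> x)))"

definition gaussian_span :: "(real^'n) L2 set" where
  "gaussian_span = cL2.span {rho (cvec z) \<tau> (toL2 (gaussian M)) | z \<tau> M. pos_def M}"

end

theory Submission
  imports Defs "HOL-Complex_Analysis.Complex_Analysis" "HOL-Probability.Probability"
begin

text \<open>
  Everything happens on complex Gaussians \<open>exp (- \<pi> A x \<cdot> x + 2 \<pi> b \<cdot> x)\<close> with \<open>A\<close> complex symmetric,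
  \<open>Re A\<close> positive definite and \<open>b\<close> complex. They extend to entire functions and the Fourier
  inversion formula holds for them at complex points, so a phase space shift by a complex \<open>Z\<close> is
  defined on each of them and again gives a scalar multiple of one of them, with the same \<open>A\<close>, an
  explicit factor and an explicit new \<open>b\<close> (\<open>rho_cgauss\<close>).

  Call an operator \<open>X\<close> a cover of the matrix \<open>S\<close> if it is linear, maps multiples of Gaussians to
  multiples of Gaussians, and satisfies \<open>X \<rho>(Z; \<tau>) u = \<rho>(S Z; \<tau>) X u\<close> for these \<open>u\<close> and \<^emph>\<open>all\<close>
  complex \<open>Z\<close>. Because \<open>Z\<close> is not restricted to real vectors and the class of Gaussians is mapped
  into itself, every composition of covers is a cover, and so is the inverse of a bijective cover of
  an invertible matrix if this inverse preserves the class. So only generators have to be examined,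
  and for each of them the relation is an identity between exponents of Gaussians
  (\<open>coversI\<close>). A span argument then gives the theorem (\<open>covers_intertwines_span\<close>).

  Two generators need analysis. The Fourier--Plancherel operator, defined as a limit of truncated
  integrals, has to be shown to exist on all of \<open>L\<^sup>2\<close>, to be bijective (otherwise \<open>inv\<close> is
  meaningless), and to act on integrable functions as the Fourier integral. This is \<open>plancherel\<close>
  and \<open>fourierL2_twice\<close>; it rests on the completeness of \<open>L\<^sup>2\<close> and on the density of the
  modulations \<open>exp (2 \<pi> i w \<cdot> x) g(x)\<close> of a single nowhere vanishing \<open>g\<close> (\<open>modulations_dense\<close>), which
  also gives the density claim of the theorem. What enters about the constant in the Fourier
  transform of a Gaussian, a branch of \<open>det A\<close> to the power \<open>- 1 / 2\<close>, is that the constants of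
  \<open>A\<close> and of its inverse are reciprocal (\<open>gauss_const_inverse\<close>), and this follows from
  \<open>F\<^sup>2 f(x) = f(- x)\<close>.

  An atomic contraction is only known on elementary tensors, whereas a Gaussian with a
  non-diagonal \<open>A\<close> is not one. In both of its forms, each factor is obtained from operators of a
  simpler kind: a Fourier transform, a damping \<open>exp (- \<pi> s \<eta>\<^sup>2)\<close>, a Fourier transform, a dilation,
  another damping. The same composition can be written down in dimension \<open>d\<close>, where it agrees with
  the tensor product on modulated standard Gaussians, hence everywhere by density
  (\<open>atomic_contr_covers\<close>); and it is visibly a composition of covers.
\<close>

section \<open>Square-integrable classes\<close>

lemma toL2_fromL2 [simp]: "toL2 (fromL2 u) = u"
  by (rule Quotient3_abs_rep[OF Quotient3_L2])

lemma sqint_fromL2 [simp, intro]: "sqint (fromL2 u)"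
  using Quotient3_rep_reflp[OF Quotient3_L2, of u] by simp

lemma toL2_eq_iff: "sqint f \<Longrightarrow> sqint g \<Longrightarrow> toL2 f = toL2 g \<longleftrightarrow> (AE x in lborel. f x = g x)"
  using Quotient3_rel[OF Quotient3_L2, of f g] by auto

lemma AE_fromL2_toL2: "sqint f \<Longrightarrow> AE x in lborel. fromL2 (toL2 f) x = f x"
  by (subst toL2_eq_iff[symmetric]) auto

lemma toL2_cong_AE:
  assumes "sqint f" "g \<in> borel_measurable lborel" "AE x in lborel. f x = g x"
  shows "sqint g" "toL2 g = toL2 f"
proof -
  have [measurable]: "f \<in> borel_measurable lborel" "g \<in> borel_measurable lborel"
    using assms by (auto simp: sqint_def)
  have "integrable lborel (\<lambda>x. (cmod (g x))\<^sup>2)"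
    by (rule integrable_cong_AE_imp[where g="\<lambda>x. (cmod (f x))\<^sup>2"])
       (use assms in \<open>auto simp: sqint_def elim: eventually_mono\<close>)
  then show g: "sqint g" by (simp add: sqint_def)
  show "toL2 g = toL2 f"
    using assms by (subst toL2_eq_iff) (auto simp: g elim: eventually_mono)
qed

lemma toL2_add: "sqint f \<Longrightarrow> sqint g \<Longrightarrow> toL2 f + toL2 g = toL2 (\<lambda>x. f x + g x)"
  by (rule plus_L2.abs_eq) auto
lemma toL2_diff: "sqint f \<Longrightarrow> sqint g \<Longrightarrow> toL2 f - toL2 g = toL2 (\<lambda>x. f x - g x)"
  by (rule minus_L2.abs_eq) auto
lemma toL2_scaleC: "sqint f \<Longrightarrow> scaleC_L2 c (toL2 f) = toL2 (\<lambda>x. c * f x)"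
  by (rule scaleC_L2.abs_eq) auto
lemma toL2_scaleR: "sqint f \<Longrightarrow> scaleR c (toL2 f) = toL2 (\<lambda>x. c *\<^sub>R f x)"
  by (rule scaleR_L2.abs_eq) auto
lemma toL2_zero: "(0 :: 'a::euclidean_space L2) = toL2 (\<lambda>x. 0)"
  by (simp add: zero_L2_def)
lemma toL2_inner: "sqint f \<Longrightarrow> sqint g \<Longrightarrow> inner (toL2 f) (toL2 g) = (LINT x|lborel. inner (f x) (g x))"
  by (rule inner_L2.abs_eq) auto

lemma scaleR_eq_scaleC: "r *\<^sub>R u = scaleC_L2 (of_real r) u"
  by (subst (1 2) toL2_fromL2[symmetric, of u]) (simp add: toL2_scaleR toL2_scaleC scaleR_conv_of_real del: toL2_fromL2)

lemma norm_toL2: "sqint f \<Longrightarrow> (norm (toL2 f))\<^sup>2 = (LINT x|lborel. (cmod (f x))\<^sup>2)"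
  by (simp add: power2_norm_eq_inner toL2_inner)

lemma norm_fromL2: "(norm u)\<^sup>2 = (LINT x|lborel. (cmod (fromL2 u x))\<^sup>2)"
  using norm_toL2[of "fromL2 u"] by simp

lemma norm_scaleC [simp]: "norm (scaleC_L2 c u) = cmod c * norm u"
proof -
  have "(norm (scaleC_L2 c u))\<^sup>2 = (norm (toL2 (\<lambda>x. c * fromL2 u x)))\<^sup>2"
    by (simp flip: toL2_scaleC)
  also have "\<dots> = (cmod c * norm u)\<^sup>2"
    using norm_fromL2[of u] norm_toL2[OF sqint_scale[OF sqint_fromL2, of c u]]
    by (simp add: norm_mult power_mult_distrib)
  finally show ?thesis by simp
qed

lemma bounded_linear_scaleC: "bounded_linear (scaleC_L2 c)"
  by (rule bounded_linear_intro[where K="cmod c"])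
     (auto simp: cL2.scale_right_distrib scaleR_eq_scaleC cL2.scale_left_commute mult.commute)

lemma sqint_bound:
  assumes "sqint h" "f \<in> borel_measurable lborel" "AE x in lborel. cmod (f x) \<le> cmod (h x)"
  shows "sqint f"
proof -
  have [measurable]: "f \<in> borel_measurable lborel" "h \<in> borel_measurable lborel"
    using assms by (auto simp: sqint_def)
  have "integrable lborel (\<lambda>x. (cmod (f x))\<^sup>2)"
    by (rule Bochner_Integration.integrable_bound[where f="\<lambda>x. (cmod (h x))\<^sup>2"])
       (use assms in \<open>auto simp: sqint_def elim!: eventually_mono intro: power_mono\<close>)
  then show ?thesis using assms by (simp add: sqint_def)
qed

lemma sqint_norm: "sqint f \<Longrightarrow> sqint (\<lambda>x. of_real (cmod (f x)))"
  by (auto simp: sqint_def)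

lemma borel_measurable_cnj [measurable (raw)]:
  "f \<in> borel_measurable M \<Longrightarrow> (\<lambda>x. cnj (f x)) \<in> borel_measurable M"
  by (rule borel_measurable_continuous_on[OF continuous_on_cnj[OF continuous_on_id]])

lemma sqint_cnj: "sqint f \<Longrightarrow> sqint (\<lambda>x. cnj (f x))"
  by (auto simp: sqint_def borel_measurable_cnj)

lemma sqint_mult_bounded:
  assumes "sqint f" "m \<in> borel_measurable lborel" "\<And>x. cmod (m x) \<le> C"
  shows "sqint (\<lambda>x. m x * f x)"
proof -
  have [measurable]: "f \<in> borel_measurable lborel" "m \<in> borel_measurable lborel"
    using assms by (auto simp: sqint_def)
  have C: "C \<ge> 0" using assms(3)[of 0] norm_ge_zero[of "m 0"] by linarith
  show ?thesis
    by (rule sqint_bound[OF sqint_scale[OF assms(1), of "of_real C"]])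
       (use assms C in \<open>auto simp: norm_mult intro!: mult_right_mono\<close>)
qed

lemma sqint_mult_integrable:
  assumes "sqint f" "sqint g"
  shows "integrable lborel (\<lambda>x. f x * g x)"
proof -
  have [measurable]: "f \<in> borel_measurable lborel" "g \<in> borel_measurable lborel"
    using assms by (auto simp: sqint_def)
  show ?thesis
    by (rule Bochner_Integration.integrable_bound[OF sqint_inner_integrable[OF sqint_norm[OF assms(1)] sqint_norm[OF assms(2)]]])
       (auto simp: norm_mult inner_complex_def)
qed

lemma Cauchy_Schwarz_L2:
  assumes "sqint f" "sqint g"
  shows "cmod (LINT x|lborel. f x * g x) \<le> norm (toL2 f) * norm (toL2 g)"
proof -
  let ?f = "\<lambda>x. of_real (cmod (f x)) :: complex" and ?g = "\<lambda>x. of_real (cmod (g x)) :: complex"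
  have "cmod (LINT x|lborel. f x * g x) \<le> (LINT x|lborel. cmod (f x * g x))"
    by (rule integral_norm_bound)
  also have "\<dots> = inner (toL2 ?f) (toL2 ?g)"
    by (simp add: toL2_inner sqint_norm assms norm_mult inner_complex_def)
  also have "\<dots> \<le> norm (toL2 ?f) * norm (toL2 ?g)"
    by (rule Cauchy_Schwarz_ineq2[THEN order.trans[OF abs_ge_self]])
  also have "norm (toL2 ?f) = norm (toL2 f)"
    by (rule power2_eq_imp_eq) (simp_all add: norm_toL2 sqint_norm assms)
  also have "norm (toL2 ?g) = norm (toL2 g)"
    by (rule power2_eq_imp_eq) (simp_all add: norm_toL2 sqint_norm assms)
  finally show ?thesis .
qed

lemma toL2_tendsto_dominated:
  assumes "\<And>n. sqint (s n)" "f \<in> borel_measurable lborel" "sqint h"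
    and "AE x in lborel. (\<lambda>n. s n x) \<longlonglongrightarrow> f x"
    and "\<And>n. AE x in lborel. cmod (s n x) \<le> cmod (h x)"
  shows "sqint f" "(\<lambda>n. toL2 (s n)) \<longlonglongrightarrow> toL2 f"
proof -
  have [measurable]: "s n \<in> borel_measurable lborel" "f \<in> borel_measurable lborel" "h \<in> borel_measurable lborel" for n
    using assms by (auto simp: sqint_def)
  have all: "AE x in lborel. \<forall>n. cmod (s n x) \<le> cmod (h x)"
    using assms(5) by (simp add: AE_all_countable)
  have fh: "AE x in lborel. cmod (f x) \<le> cmod (h x)"
    using all assms(4)
  proof eventually_elim
    case (elim x)
    have "(\<lambda>n. cmod (s n x)) \<longlonglongrightarrow> cmod (f x)" using elim by (intro tendsto_norm) auto
    then show ?case using elim by (intro LIMSEQ_le_const2) auto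
  qed
  show f: "sqint f" by (rule sqint_bound[OF assms(3,2) fh])
  have "(\<lambda>n. LINT x|lborel. (cmod (s n x - f x))\<^sup>2) \<longlonglongrightarrow> (LINT x|(lborel::'a measure). 0)"
  proof (rule integral_dominated_convergence[where w="\<lambda>x. 4 * (cmod (h x))\<^sup>2"])
    show "integrable lborel (\<lambda>x. 4 * (cmod (h x))\<^sup>2)" using assms(3) by (simp add: sqint_def)
    show "AE x in lborel. (\<lambda>n. (cmod (s n x - f x))\<^sup>2) \<longlonglongrightarrow> 0"
      using assms(4) by eventually_elim (auto intro!: tendsto_eq_intros simp: LIM_zero_iff)
    show "AE x in lborel. norm ((cmod (s n x - f x))\<^sup>2) \<le> 4 * (cmod (h x))\<^sup>2" for n
      using all fh
    proof eventually_elim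
      case (elim x)
      have "cmod (s n x - f x) \<le> 2 * cmod (h x)"
        using norm_triangle_ineq4[of "s n x" "f x"] elim spec[OF elim(1), of n] by linarith
      then have "(cmod (s n x - f x))\<^sup>2 \<le> (2 * cmod (h x))\<^sup>2" by (intro power_mono) auto
      then show ?case by (simp add: power_mult_distrib)
    qed
  qed auto
  then have "(\<lambda>n. (norm (toL2 (s n) - toL2 f))\<^sup>2) \<longlonglongrightarrow> 0"
    by (simp add: toL2_diff assms f norm_toL2 sqint_diff)
  then have "(\<lambda>n. sqrt ((norm (toL2 (s n) - toL2 f))\<^sup>2)) \<longlonglongrightarrow> sqrt 0"
    by (intro tendsto_real_sqrt)
  then show "(\<lambda>n. toL2 (s n)) \<longlonglongrightarrow> toL2 f"
    by (simp add: tendsto_norm_zero_iff LIM_zero_iff)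
qed

text \<open>The heart of the Riesz--Fischer theorem. The series of moduli of the representatives has square
  integrals bounded by \<open>2\<^sup>2\<close>, so by monotone convergence it is finite almost everywhere and
  square-integrable; it then dominates the partial sums of the series itself.\<close>

lemma L2_summable_limit:
  fixes d :: "nat \<Rightarrow> 'a::euclidean_space L2"
  assumes "\<And>k. norm (d k) \<le> (1/2)^k"
  shows "\<exists>v. (\<lambda>n. \<Sum>k<n. d k) \<longlonglongrightarrow> v"
proof -
  define f where "f k = fromL2 (d k)" for k
  have [simp]: "sqint (f k)" for k by (simp add: f_def)
  have [measurable]: "f k \<in> borel_measurable borel" for k using sqint_measurable[of "f k"] by simp
  have sum: "sqint (\<lambda>x. \<Sum>k<n. f k x) \<and> toL2 (\<lambda>x. \<Sum>k<n. f k x) = (\<Sum>k<n. d k)" for n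
  proof (induction n)
    case (Suc n) then show ?case
      using toL2_add[of "\<lambda>x. \<Sum>k<n. f k x" "f n"] by (auto simp: sqint_add f_def)
  qed (simp add: sqint_zero toL2_zero)
  have nsum: "sqint (\<lambda>x. of_real (\<Sum>k<n. cmod (f k x))) \<and> norm (toL2 (\<lambda>x. of_real (\<Sum>k<n. cmod (f k x)))) \<le> (\<Sum>k<n. norm (d k))" for n
  proof (induction n)
    case (Suc n)
    have "norm (toL2 (\<lambda>x. of_real (cmod (f n x)))) = norm (d n)"
      using norm_toL2[OF sqint_norm[of "f n"]] norm_fromL2[of "d n"]
      by (rule_tac power2_eq_imp_eq) (simp_all add: f_def)
    moreover have "norm (toL2 (\<lambda>x. of_real (\<Sum>k<n. cmod (f k x))) + toL2 (\<lambda>x. of_real (cmod (f n x))))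
        \<le> (\<Sum>k<n. norm (d k)) + norm (toL2 (\<lambda>x. of_real (cmod (f n x))))"
      by (rule order.trans[OF norm_triangle_ineq]) (use Suc in simp)
    moreover have "toL2 (\<lambda>x. of_real (\<Sum>k<n. cmod (f k x))) + toL2 (\<lambda>x. of_real (cmod (f n x)))
        = toL2 (\<lambda>x. of_real (\<Sum>k<Suc n. cmod (f k x)))"
      using Suc by (subst toL2_add) (auto simp: sqint_norm)
    moreover have "sqint (\<lambda>x. of_real (\<Sum>k<Suc n. cmod (f k x)))"
      using Suc sqint_add[of "\<lambda>x. of_real (\<Sum>k<n. cmod (f k x))" "\<lambda>x. of_real (cmod (f n x))"]
      by (simp add: sqint_norm)
    ultimately show ?case by simp
  qed (simp add: sqint_zero flip: toL2_zero)
  have "(\<Sum>k<n. norm (d k)) \<le> 2" for n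
  proof -
    have "(\<Sum>k<n. norm (d k)) \<le> (\<Sum>k<n. (1/2)^k)" by (intro sum_mono assms)
    also have "\<dots> \<le> (\<Sum>k. (1/2)^k)" by (intro sum_le_suminf) auto
    also have "\<dots> = (2::real)" by (subst suminf_geometric) auto
    finally show ?thesis .
  qed
  with nsum have le2: "norm (toL2 (\<lambda>x. of_real (\<Sum>k<n. cmod (f k x)))) \<le> 2" for n
    by (meson order.trans)
  define S where "S x = (SUP n. ennreal ((\<Sum>k<n. cmod (f k x))\<^sup>2))" for x
  have [measurable]: "S \<in> borel_measurable borel" unfolding S_def by measurable
  have "(\<integral>\<^sup>+x. S x \<partial>lborel) = (SUP n. \<integral>\<^sup>+x. ennreal ((\<Sum>k<n. cmod (f k x))\<^sup>2) \<partial>lborel)"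
    unfolding S_def
  proof (rule nn_integral_monotone_convergence_SUP)
    show "incseq (\<lambda>n x. ennreal ((\<Sum>k<n. cmod (f k x))\<^sup>2))"
      by (intro incseq_SucI le_funI ennreal_leI power_mono) (auto simp: sum_nonneg)
  qed measurable
  also have "\<dots> \<le> 4"
  proof (rule SUP_least)
    fix n
    have "(\<integral>\<^sup>+x. ennreal ((\<Sum>k<n. cmod (f k x))\<^sup>2) \<partial>lborel) = ennreal (LINT x|lborel. (\<Sum>k<n. cmod (f k x))\<^sup>2)"
      using nsum[of n] by (intro nn_integral_eq_integral) (auto simp: sqint_def simp del: of_real_sum)
    also have "(LINT x|lborel. (\<Sum>k<n. cmod (f k x))\<^sup>2) = (norm (toL2 (\<lambda>x. of_real (\<Sum>k<n. cmod (f k x)))))\<^sup>2"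
      using nsum[of n] by (subst norm_toL2) (auto simp del: of_real_sum)
    also have "ennreal \<dots> \<le> ennreal (2\<^sup>2)" by (intro ennreal_leI power_mono le2) auto
    finally show "(\<integral>\<^sup>+x. ennreal ((\<Sum>k<n. cmod (f k x))\<^sup>2) \<partial>lborel) \<le> 4" by simp
  qed
  finally have S4: "(\<integral>\<^sup>+x. S x \<partial>lborel) \<le> 4" .
  then have fin: "AE x in lborel. S x \<noteq> \<infinity>"
    by (intro nn_integral_noteq_infinite) (auto simp: top_unique)
  define h where "h x = (of_real (sqrt (enn2real (S x))) :: complex)" for x
  have [measurable]: "h \<in> borel_measurable borel" unfolding h_def by measurable
  have h: "sqint h"
  proof -
    have "integrable lborel (\<lambda>x. (cmod (h x))\<^sup>2)"
    proof (rule integrableI_bounded)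
      have "(\<integral>\<^sup>+x. ennreal (norm ((cmod (h x))\<^sup>2)) \<partial>lborel) \<le> (\<integral>\<^sup>+x. S x \<partial>lborel)"
        by (intro nn_integral_mono) (auto simp: h_def ennreal_enn2real_if)
      also have "\<dots> < \<infinity>" using S4 by (auto simp: less_top top_unique intro: order.strict_trans1)
      finally show "(\<integral>\<^sup>+x. ennreal (norm ((cmod (h x))\<^sup>2)) \<partial>lborel) < \<infinity>" .
    qed measurable
    then show ?thesis by (simp add: sqint_def)
  qed
  have bd: "AE x in lborel. \<forall>n. (\<Sum>k<n. cmod (f k x)) \<le> cmod (h x)"
    using fin
  proof eventually_elim
    case (elim x)
    show ?case
    proof
      fix n
      have "ennreal ((\<Sum>k<n. cmod (f k x))\<^sup>2) \<le> S x" unfolding S_def by (rule SUP_upper) simp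
      with elim have "(\<Sum>k<n. cmod (f k x))\<^sup>2 \<le> enn2real (S x)"
        by (cases "S x") (auto simp: ennreal_le_iff)
      then have "(\<Sum>k<n. cmod (f k x)) \<le> sqrt (enn2real (S x))"
        by (rule real_le_rsqrt)
      then show "(\<Sum>k<n. cmod (f k x)) \<le> cmod (h x)" by (simp add: h_def)
    qed
  qed
  define F where "F x = (\<Sum>k. f k x)" for x
  have [measurable]: "F \<in> borel_measurable borel" unfolding F_def by measurable
  have "(\<lambda>n. toL2 (\<lambda>x. \<Sum>k<n. f k x)) \<longlonglongrightarrow> toL2 F"
  proof (rule toL2_tendsto_dominated(2)[OF _ _ h])
    show "AE x in lborel. (\<lambda>n. \<Sum>k<n. f k x) \<longlonglongrightarrow> F x"
      using bd
    proof eventually_elim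
      case (elim x)
      then have "summable (\<lambda>k. cmod (f k x))"
        by (intro summableI_nonneg_bounded[where x="cmod (h x)"]) auto
      then have "summable (\<lambda>k. f k x)" by (rule summable_norm_cancel)
      then show ?case unfolding F_def by (rule summable_LIMSEQ)
    qed
    show "AE x in lborel. cmod (\<Sum>k<n. f k x) \<le> cmod (h x)" for n
      using bd
    proof eventually_elim
      case (elim x)
      then show ?case using norm_sum[of "\<lambda>k. f k x" "{..<n}"] by (meson order.trans)
    qed
  qed (use sum in auto)
  then show ?thesis using sum by auto
qed

instance L2 :: (euclidean_space) banach
proof
  fix X :: "nat \<Rightarrow> 'a L2" assume X: "Cauchy X"
  have "\<exists>N. \<forall>m\<ge>N. \<forall>n\<ge>N. norm (X m - X n) < (1/2)^k" for k
    using X by (auto simp: Cauchy_iff)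
  then obtain N where N: "\<And>k m n. m \<ge> N k \<Longrightarrow> n \<ge> N k \<Longrightarrow> norm (X m - X n) < (1/2)^k"
    by metis
  define r where "r k = (\<Sum>j\<le>k. Suc (N j))" for k
  have r: "strict_mono r" by (auto simp: r_def strict_mono_Suc_iff)
  have rN: "N k \<le> r k" for k
    using member_le_sum[of k "{..k}" "\<lambda>j. Suc (N j)"] by (simp add: r_def)
  \<comment> \<open>the differences along this subsequence are summable\<close>
  have "norm (X (r (Suc k)) - X (r k)) \<le> (1/2)^k" for k
  proof -
    have "N k \<le> r (Suc k)"
      using rN[of k] strict_monoD[OF r, of k "Suc k"] by linarith
    with N[OF this rN[of k]] show ?thesis by (rule_tac less_imp_le)
  qed
  then obtain v where "(\<lambda>n. \<Sum>k<n. X (r (Suc k)) - X (r k)) \<longlonglongrightarrow> v"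
    using L2_summable_limit[of "\<lambda>k. X (r (Suc k)) - X (r k)"] by blast
  then have "(\<lambda>n. X (r n) - X (r 0)) \<longlonglongrightarrow> v" 
    using sum_lessThan_telescope[of "\<lambda>k. X (r k)"] by simp
  then have "(\<lambda>n. (X (r n) - X (r 0)) + X (r 0)) \<longlonglongrightarrow> v + X (r 0)" by (intro tendsto_add) auto
  then have "(X \<circ> r) \<longlonglongrightarrow> v + X (r 0)" by (simp add: o_def)
  then have "X \<longlonglongrightarrow> v + X (r 0)" using Cauchy_converges_subseq[OF X r] by simp
  then show "convergent X" by (auto simp: convergent_def)
qed

section \<open>Density of the modulations of one function\<close>

lemma L2_cases: obtains f where "sqint f" "u = toL2 f"
  using that[of "fromL2 u"] by simp

definition mulL2 :: "('a::euclidean_space \<Rightarrow> complex) \<Rightarrow> 'a L2 \<Rightarrow> 'a L2" where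
  "mulL2 m u = toL2 (\<lambda>x. m x * fromL2 u x)"

definition bdd_mult :: "('a::euclidean_space \<Rightarrow> complex) \<Rightarrow> bool" where
  "bdd_mult m \<longleftrightarrow> m \<in> borel_measurable borel \<and> (\<exists>C. \<forall>x. cmod (m x) \<le> C)"

lemma bdd_mult_sqint: "bdd_mult m \<Longrightarrow> sqint f \<Longrightarrow> sqint (\<lambda>x. m x * f x)"
  unfolding bdd_mult_def by (auto intro: sqint_mult_bounded)

lemma mulL2_toL2:
  assumes "bdd_mult m" "sqint f"
  shows "mulL2 m (toL2 f) = toL2 (\<lambda>x. m x * f x)"
  unfolding mulL2_def
  by (subst toL2_eq_iff) (use AE_fromL2_toL2[OF assms(2)] in \<open>auto intro!: bdd_mult_sqint assms elim: eventually_mono\<close>)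

lemma mulL2_add:
  assumes m: "bdd_mult m"
  shows "mulL2 m (u + v) = mulL2 m u + mulL2 m v"
proof -
  obtain f g where f: "sqint f" "u = toL2 f" and g: "sqint g" "v = toL2 g" by (metis L2_cases)
  show ?thesis
    unfolding f(2) g(2) toL2_add[OF f(1) g(1)]
    by (simp add: mulL2_toL2 m f(1) g(1) sqint_add toL2_add bdd_mult_sqint distrib_left)
qed

lemma mulL2_scaleC:
  assumes m: "bdd_mult m"
  shows "mulL2 m (scaleC_L2 c u) = scaleC_L2 c (mulL2 m u)"
proof -
  obtain f where f: "sqint f" "u = toL2 f" by (metis L2_cases)
  show ?thesis
    unfolding f(2) toL2_scaleC[OF f(1)]
    by (simp add: mulL2_toL2 m f(1) sqint_scale toL2_scaleC bdd_mult_sqint mult.left_commute)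
qed

lemma bounded_linear_mulL2:
  assumes m: "bdd_mult m"
  shows "bounded_linear (mulL2 m)"
proof -
  obtain C where C: "\<And>x. cmod (m x) \<le> C" using m by (auto simp: bdd_mult_def)
  have C0: "C \<ge> 0" using C[of 0] norm_ge_zero[of "m 0"] by linarith
  have "norm (mulL2 m u) \<le> norm u * C" for u
  proof -
    have "(norm (mulL2 m u))\<^sup>2 = (LINT x|lborel. (cmod (m x * fromL2 u x))\<^sup>2)"
      by (simp add: mulL2_def norm_toL2 bdd_mult_sqint m)
    also have "\<dots> \<le> (LINT x|lborel. C\<^sup>2 * (cmod (fromL2 u x))\<^sup>2)"
    proof (rule integral_mono)
      show "integrable lborel (\<lambda>x. (cmod (m x * fromL2 u x))\<^sup>2)"
        using bdd_mult_sqint[OF m sqint_fromL2, of u] by (simp add: sqint_def)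
      show "integrable lborel (\<lambda>x. C\<^sup>2 * (cmod (fromL2 u x))\<^sup>2)"
        using sqint_fromL2[of u] by (simp add: sqint_def)
      show "(cmod (m x * fromL2 u x))\<^sup>2 \<le> C\<^sup>2 * (cmod (fromL2 u x))\<^sup>2" for x
        unfolding norm_mult power_mult_distrib by (intro mult_right_mono power_mono C) auto
    qed
    also have "\<dots> = (norm u * C)\<^sup>2" by (simp add: norm_fromL2 power_mult_distrib)
    finally show ?thesis using C0 by (rule_tac power2_le_imp_le) auto
  qed
  then show ?thesis
    by (rule_tac bounded_linear_intro[where K=C])
       (auto simp: mulL2_add mulL2_scaleC scaleR_eq_scaleC m)
qed

lemma bdd_mult_const [simp]: "bdd_mult (\<lambda>x. c)"
  by (auto simp: bdd_mult_def)

lemma bdd_mult_add: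
  assumes "bdd_mult m" "bdd_mult k" shows "bdd_mult (\<lambda>x. m x + k x)"
proof -
  obtain C D where "\<And>x. cmod (m x) \<le> C" "\<And>x. cmod (k x) \<le> D" using assms by (auto simp: bdd_mult_def)
  then have "cmod (m x + k x) \<le> C + D" for x by (rule_tac norm_triangle_le add_mono)+
  then show ?thesis using assms by (auto simp: bdd_mult_def)
qed

lemma bdd_mult_mult:
  assumes "bdd_mult m" "bdd_mult k" shows "bdd_mult (\<lambda>x. m x * k x)"
proof -
  obtain C D where "\<And>x. cmod (m x) \<le> C" "\<And>x. cmod (k x) \<le> D" using assms by (auto simp: bdd_mult_def)
  moreover from this have "C \<ge> 0" by (meson norm_ge_zero order.trans)
  ultimately have "cmod (m x * k x) \<le> C * D" for x by (auto simp: norm_mult intro!: mult_mono)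
  then show ?thesis using assms by (auto simp: bdd_mult_def)
qed

definition modul :: "'a::euclidean_space \<Rightarrow> 'a \<Rightarrow> complex" where
  "modul w x = exp (2 * of_real pi * \<i> * of_real (w \<bullet> x))"

lemma norm_modul [simp]: "cmod (modul w x) = 1"
  by (simp add: modul_def)

lemma modul_add: "modul (v + w) x = modul v x * modul w x"
  by (simp add: modul_def inner_add_left distrib_left exp_add)

lemma modul_measurable [measurable]: "modul w \<in> borel_measurable borel"
  unfolding modul_def by measurable

lemma bdd_mult_modul [simp]: "bdd_mult (modul w)"
  by (auto simp: bdd_mult_def intro: exI[of _ 1])

lemma closure_cspan_add:
  assumes "u \<in> closure (cL2.span B)" "v \<in> closure (cL2.span B)"
  shows "u + v \<in> closure (cL2.span B)"
proof -
  obtain X Y where X: "\<And>n. X n \<in> cL2.span B" "X \<longlonglongrightarrow> u" and Y: "\<And>n. Y n \<in> cL2.span B" "Y \<longlonglongrightarrow> v"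
    using assms by (auto simp: closure_sequential)
  have "(\<lambda>n. X n + Y n) \<longlonglongrightarrow> u + v" "\<And>n. X n + Y n \<in> cL2.span B"
    by (intro tendsto_add X Y cL2.span_add)+
  then show ?thesis unfolding closure_sequential by (rule_tac exI[of _ "\<lambda>n. X n + Y n"]) simp
qed

lemma closure_cspan_scale:
  assumes "u \<in> closure (cL2.span B)"
  shows "scaleC_L2 c u \<in> closure (cL2.span B)"
proof -
  obtain X where X: "\<And>n. X n \<in> cL2.span B" "X \<longlonglongrightarrow> u"
    using assms by (auto simp: closure_sequential)
  have "(\<lambda>n. scaleC_L2 c (X n)) \<longlonglongrightarrow> scaleC_L2 c u" "\<And>n. scaleC_L2 c (X n) \<in> cL2.span B"
    by (intro bounded_linear.tendsto[OF bounded_linear_scaleC] X cL2.span_scale)+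
  then show ?thesis unfolding closure_sequential by (rule_tac exI[of _ "\<lambda>n. scaleC_L2 c (X n)"]) simp
qed

text \<open>The density argument works with an algebra of functions. The bounded multipliers that map
  the closed span of the modulations of \<open>g\<close> into itself form one that is closed under bounded
  pointwise limits and contains the characters. Polynomials in a sine give the indicator of the set
  where the sine is positive; letting the period go to infinity gives half spaces; the indicators in
  the algebra form a \<open>\<sigma>\<close>-algebra, so all Borel sets follow. As \<open>g\<close> has no zeros, simple functions
  times \<open>g\<close> are dense.\<close>

locale modulation_span =
  fixes g :: "'a::euclidean_space \<Rightarrow> complex"
  assumes g: "sqint g" and g0: "\<And>x. g x \<noteq> 0"
begin

definition mod_closure :: "'a L2 set" where
  "mod_closure = closure (cL2.span (range (\<lambda>w. toL2 (\<lambda>x. modul w x * g x))))"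

definition multipliers :: "('a \<Rightarrow> complex) set" where
  "multipliers = {m. bdd_mult m \<and> (\<forall>u\<in>mod_closure. mulL2 m u \<in> mod_closure)}"

lemma mod_closure_add: "u \<in> mod_closure \<Longrightarrow> v \<in> mod_closure \<Longrightarrow> u + v \<in> mod_closure"
  unfolding mod_closure_def by (rule closure_cspan_add)

lemma mod_closure_scale: "u \<in> mod_closure \<Longrightarrow> scaleC_L2 c u \<in> mod_closure"
  unfolding mod_closure_def by (rule closure_cspan_scale)

lemma mod_closure_limit: "(\<And>n. X n \<in> mod_closure) \<Longrightarrow> X \<longlonglongrightarrow> u \<Longrightarrow> u \<in> mod_closure"
  unfolding mod_closure_def by (rule closed_sequentially[OF closed_closure])

lemma g_in_mod_closure: "toL2 g \<in> mod_closure"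
proof -
  have "toL2 g = toL2 (\<lambda>x. modul 0 x * g x)" by (simp add: modul_def)
  also have "\<dots> \<in> mod_closure" unfolding mod_closure_def
    by (rule subsetD[OF closure_subset], rule cL2.span_base) blast
  finally show ?thesis .
qed

lemma multipliers_const: "(\<lambda>x. c) \<in> multipliers"
proof -
  have "mulL2 (\<lambda>x. c) u = scaleC_L2 c u" for u :: "'a L2"
    by (simp add: mulL2_def flip: toL2_scaleC)
  then show ?thesis by (auto simp: multipliers_def mod_closure_scale)
qed

lemma multipliers_add: "m \<in> multipliers \<Longrightarrow> k \<in> multipliers \<Longrightarrow> (\<lambda>x. m x + k x) \<in> multipliers"
proof -
  assume a: "m \<in> multipliers" "k \<in> multipliers"
  have "mulL2 (\<lambda>x. m x + k x) u = mulL2 m u + mulL2 k u" for u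
    using a by (simp add: mulL2_def toL2_add multipliers_def bdd_mult_sqint distrib_right)
  then show ?thesis using a by (auto simp: multipliers_def mod_closure_add bdd_mult_add)
qed

lemma multipliers_mult: "m \<in> multipliers \<Longrightarrow> k \<in> multipliers \<Longrightarrow> (\<lambda>x. m x * k x) \<in> multipliers"
proof -
  assume a: "m \<in> multipliers" "k \<in> multipliers"
  have "mulL2 (\<lambda>x. m x * k x) u = mulL2 m (mulL2 k u)" for u
    using a mulL2_toL2[of m "\<lambda>x. k x * fromL2 u x"]
    by (simp add: multipliers_def bdd_mult_sqint mulL2_def mult.assoc)
  then show ?thesis using a by (auto simp: multipliers_def bdd_mult_mult)
qed

lemma multipliers_scale: "m \<in> multipliers \<Longrightarrow> (\<lambda>x. c * m x) \<in> multipliers"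
  using multipliers_mult[OF multipliers_const] by simp

lemma multipliers_sum: "finite A \<Longrightarrow> (\<And>i. i \<in> A \<Longrightarrow> m i \<in> multipliers) \<Longrightarrow> (\<lambda>x. \<Sum>i\<in>A. m i x) \<in> multipliers"
  by (induction A rule: finite_induct) (auto intro: multipliers_const multipliers_add)

lemma multipliers_limit:
  assumes m: "\<And>n. m n \<in> multipliers" and C: "\<And>n x. cmod (m n x) \<le> C" and lim: "\<And>x. (\<lambda>n. m n x) \<longlonglongrightarrow> k x"
  shows "k \<in> multipliers"
proof -
  have meas [measurable]: "m n \<in> borel_measurable borel" for n using m by (auto simp: multipliers_def bdd_mult_def)
  have [measurable]: "k \<in> borel_measurable borel"
    by (rule borel_measurable_LIMSEQ_metric[OF meas lim])
  have kC: "cmod (k x) \<le> C" for x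
    by (rule LIMSEQ_le_const2[OF tendsto_norm[OF lim]]) (use C in auto)
  have C0: "C \<ge> 0" using C by (meson norm_ge_zero order.trans)
  have "mulL2 k u \<in> mod_closure" if u: "u \<in> mod_closure" for u
  proof (rule mod_closure_limit)
    show "mulL2 (m n) u \<in> mod_closure" for n using m u by (auto simp: multipliers_def)
    have [measurable]: "fromL2 u \<in> borel_measurable borel" using sqint_measurable[OF sqint_fromL2, of u] by simp
    show "(\<lambda>n. mulL2 (m n) u) \<longlonglongrightarrow> mulL2 k u"
      unfolding mulL2_def
    proof (rule toL2_tendsto_dominated(2))
      show "sqint (\<lambda>x. m n x * fromL2 u x)" for n using m by (auto simp: multipliers_def bdd_mult_sqint)
      show "sqint (\<lambda>x. of_real C * fromL2 u x)" by (simp add: sqint_scale)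
      show "AE x in lborel. cmod (m n x * fromL2 u x) \<le> cmod (of_real C * fromL2 u x)" for n
        using C C0 by (auto simp: norm_mult intro!: mult_right_mono)
      show "AE x in lborel. (\<lambda>n. m n x * fromL2 u x) \<longlonglongrightarrow> k x * fromL2 u x"
        by (intro AE_I2 tendsto_mult lim tendsto_const)
    qed measurable
  qed
  moreover have "bdd_mult k" using kC by (auto simp: bdd_mult_def)
  ultimately show ?thesis by (auto simp: multipliers_def)
qed

lemma multipliers_modul: "modul w \<in> multipliers"
proof -
  have cont: "continuous_on UNIV (mulL2 (modul w) :: 'a L2 \<Rightarrow> _)"
    by (simp add: bounded_linear_mulL2 linear_continuous_on)
  let ?B = "range (\<lambda>w. toL2 (\<lambda>x. modul w x * g x))"
  have "mulL2 (modul w) u \<in> cL2.span ?B" if "u \<in> cL2.span ?B" for u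
    using that
  proof (induction rule: cL2.span_induct_alt)
    case base
    have "mulL2 (modul w) (0::'a L2) = 0"
      by (rule linear_0[OF bounded_linear.linear[OF bounded_linear_mulL2]]) simp
    then show ?case by (simp add: cL2.span_zero)
  next
    case (step c x y)
    then obtain v where x: "x = toL2 (\<lambda>x. modul v x * g x)" by auto
    have "mulL2 (modul w) x = toL2 (\<lambda>x. modul (w + v) x * g x)"
      by (simp add: x mulL2_toL2 bdd_mult_sqint g modul_add mult.assoc)
    also have "\<dots> \<in> cL2.span ?B" by (rule cL2.span_base) blast
    finally show ?case using step by (simp add: mulL2_add mulL2_scaleC cL2.span_add cL2.span_scale)
  qed
  then have "mulL2 (modul w) ` closure (cL2.span ?B) \<subseteq> closure (cL2.span ?B)"
    by (intro image_closure_subset[OF continuous_on_subset[OF cont]] closed_closure)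
       (use closure_subset in blast)+
  then show ?thesis by (auto simp: multipliers_def mod_closure_def)
qed

lemma multipliers_sin: "(\<lambda>x. of_real (sin (2 * pi * (w \<bullet> x) + b))) \<in> multipliers"
proof -
  have "(\<lambda>x. exp (\<i> * of_real b) / (2 * \<i>) * modul w x + - (exp (- \<i> * of_real b) / (2 * \<i>)) * modul (-w) x) \<in> multipliers"
    by (intro multipliers_add multipliers_scale multipliers_modul)
  moreover have "exp (\<i> * of_real b) / (2 * \<i>) * modul w x + - (exp (- \<i> * of_real b) / (2 * \<i>)) * modul (-w) x
      = of_real (sin (2 * pi * (w \<bullet> x) + b))" for x
  proof -
    have "of_real (sin (2 * pi * (w \<bullet> x) + b)) = (sin (of_real (2 * pi * (w \<bullet> x) + b)) :: complex)"
      by (rule sin_of_real[symmetric])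
    also have "\<dots> = (exp (\<i> * of_real b) * modul w x - exp (- \<i> * of_real b) * modul (-w) x) / (2 * \<i>)"
      by (simp add: sin_exp_eq modul_def flip: exp_add) (simp add: algebra_simps)
    finally show ?thesis by (simp add: algebra_simps diff_divide_distrib)
  qed
  ultimately show ?thesis by simp
qed

lemma multipliers_polynomial:
  assumes "real_polynomial_function p" "(\<lambda>x. of_real (h x)) \<in> multipliers"
  shows "(\<lambda>x. of_real (p (h x :: real))) \<in> multipliers"
  using assms(1)
proof (induction rule: real_polynomial_function.induct)
  case (linear f)
  then obtain c where "f = (\<lambda>x. x * c)"
    using real_bounded_linear by (auto simp: )
  then show ?case using multipliers_scale[OF assms(2), of "of_real c"] by (simp add: mult.commute)
next
  case (const c) show ?case by (rule multipliers_const)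
next
  case (add f g) then show ?case using multipliers_add by fastforce
next
  case (mult f g) then show ?case using multipliers_mult by fastforce
qed

text \<open>The ramp functions \<open>min 1 (max 0 (n y))\<close> tend to the indicator of \<open>y > 0\<close>; by Weierstrass each of
  them is within \<open>1 / (n + 1)\<close> of a polynomial on \<open>[-1, 1]\<close>, so the polynomials have the same limit and are
  uniformly bounded there.\<close>

lemma multipliers_pos_sin: "indicator {x. sin (2 * pi * (w \<bullet> x) + b) > 0} \<in> multipliers"
proof -
  let ?h = "\<lambda>n y. min 1 (max 0 (real n * y)) :: real"
  have "\<exists>p. real_polynomial_function p \<and> (\<forall>y\<in>{-1..1}. \<bar>?h n y - p y\<bar> < 1 / Suc n)" for n
  proof -
    have "continuous_on {-1..1} (?h n)" by (intro continuous_intros)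
    then obtain p where "real_polynomial_function p" "\<And>y. y \<in> {-1..1} \<Longrightarrow> \<bar>?h n y - p y\<bar> < 1 / Suc n"
      by (rule Stone_Weierstrass_real_polynomial_function[where e="1 / Suc n", rotated]) auto
    then show ?thesis by blast
  qed
  then obtain p where p: "\<And>n. real_polynomial_function (p n)" 
    and pd: "\<And>n y. y \<in> {-1..1} \<Longrightarrow> \<bar>?h n y - p n y\<bar> < 1 / Suc n" by metis
  let ?s = "\<lambda>x. sin (2 * pi * (w \<bullet> x) + b)"
  show ?thesis
  proof (rule multipliers_limit)
    show "(\<lambda>x. of_real (p n (?s x))) \<in> multipliers" for n
      by (rule multipliers_polynomial[OF p multipliers_sin])
    show "cmod (of_real (p n (?s x))) \<le> 2" for n x
    proof -
      have "\<bar>?h n (?s x) - p n (?s x)\<bar> < 1 / Suc n" by (rule pd) auto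
      also have "\<dots> \<le> 1" by simp
      finally have "\<bar>?h n (?s x) - p n (?s x)\<bar> < 1" .
      moreover have "0 \<le> ?h n (?s x)" "?h n (?s x) \<le> 1" by auto
      ultimately show ?thesis by (simp only: norm_of_real)
    qed
    fix x
    have "(\<lambda>n. ?h n (?s x)) \<longlonglongrightarrow> indicator {x. ?s x > 0} x"
    proof (cases "?s x > 0")
      case True
      have "eventually (\<lambda>n. real n \<ge> 1 / ?s x) sequentially" by real_asymp
      then have "eventually (\<lambda>n. ?h n (?s x) = 1) sequentially"
        by eventually_elim (use True in \<open>auto simp: field_simps\<close>)
      then show ?thesis using True by (auto intro: tendsto_eventually)
    next
      case False
      then have "?h n (?s x) = 0" for n by (auto simp: mult_nonneg_nonpos)
      then show ?thesis using False by auto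
    qed
    moreover have "(\<lambda>n. p n (?s x) - ?h n (?s x)) \<longlonglongrightarrow> 0"
    proof (rule Lim_null_comparison[where g="\<lambda>n. 1 / Suc n"])
      show "eventually (\<lambda>n. norm (p n (?s x) - ?h n (?s x)) \<le> 1 / Suc n) sequentially"
      proof (rule always_eventually, rule allI)
        fix n
        have "\<bar>?h n (?s x) - p n (?s x)\<bar> < 1 / Suc n" by (rule pd) auto
        then show "norm (p n (?s x) - ?h n (?s x)) \<le> 1 / Suc n" by (simp add: abs_minus_commute)
      qed
    qed real_asymp
    ultimately have "(\<lambda>n. ?h n (?s x) + (p n (?s x) - ?h n (?s x))) \<longlonglongrightarrow> indicator {x. ?s x > 0} x + 0"
      by (rule tendsto_add)
    then have "(\<lambda>n. p n (?s x)) \<longlonglongrightarrow> indicator {x. ?s x > 0} x" by simp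
    then have "(\<lambda>n. of_real (p n (?s x)) :: complex) \<longlonglongrightarrow> of_real (indicator {x. ?s x > 0} x)"
      by (rule tendsto_of_real)
    then show "(\<lambda>n. of_real (p n (?s x)) :: complex) \<longlonglongrightarrow> indicator {x. ?s x > 0} x"
      by (simp add: indicator_def of_bool_def split: if_splits)
  qed
qed

text \<open>For fixed \<open>x\<close> the sine of \<open>(x \<bullet> i - a) / (n + 1)\<close> has the sign of \<open>x \<bullet> i - a\<close> as soon as
  the argument lies in \<open>(- \<pi>, \<pi>)\<close>.\<close>

lemma multipliers_halfspace: "indicator {x. a < x \<bullet> i} \<in> multipliers"
proof (rule multipliers_limit)
  let ?t = "\<lambda>n x. 2 * pi * ((1 / (2 * pi * Suc n)) *\<^sub>R i \<bullet> x) + (- a / Suc n)"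
  show "indicator {x. sin (?t n x) > 0} \<in> multipliers" for n
    by (rule multipliers_pos_sin)
  show "cmod (indicator {x. sin (?t n x) > 0} x) \<le> 1" for n x
    by (simp add: indicator_def)
  fix x
  have t: "?t n x = (x \<bullet> i - a) / Suc n" for n
    by (simp add: diff_divide_distrib inner_commute)
  have "eventually (\<lambda>n. \<bar>x \<bullet> i - a\<bar> / real (Suc n) < pi) sequentially" by real_asymp
  then have "eventually (\<lambda>n. (sin (?t n x) > 0) = (a < x \<bullet> i)) sequentially"
  proof eventually_elim
    case (elim n)
    show ?case
    proof (cases "a < x \<bullet> i")
      case True
      then show ?thesis unfolding t using elim by (auto intro!: sin_gt_zero)
    next
      case False
      have "sin ((x \<bullet> i - a) / Suc n) = - sin (\<bar>x \<bullet> i - a\<bar> / Suc n)"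
        using False by (simp add: minus_divide_left flip: sin_minus del: sin_minus)
      moreover have "sin (\<bar>x \<bullet> i - a\<bar> / Suc n) \<ge> 0"
        using elim by (intro sin_ge_zero) auto
      ultimately show ?thesis unfolding t using False by auto
    qed
  qed
  then have "eventually (\<lambda>n. (indicator {x. sin (?t n x) > 0} x :: complex) = indicator {x. a < x \<bullet> i} x) sequentially"
    by eventually_elim (simp add: indicator_def)
  then show "(\<lambda>n. indicator {x. sin (?t n x) > 0} x :: complex) \<longlonglongrightarrow> indicator {x. a < x \<bullet> i} x"
    by (rule tendsto_eventually)
qed

lemma multipliers_indicator:
  assumes "A \<in> sets borel" shows "indicator A \<in> multipliers"
proof -
  let ?G = "(\<lambda>(a, i). {x::'a. a < x \<bullet> i}) ` (UNIV \<times> Basis)"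
  have "A \<in> sigma_sets UNIV ?G"
    using assms by (subst (asm) borel_eq_halfspace_greater) (simp add: sets_measure_of)
  then show ?thesis
  proof (induction rule: sigma_sets.induct)
    case (Basic a) then show ?case using multipliers_halfspace by auto
  next
    case Empty show ?case using multipliers_const[of 0] by (simp add: indicator_def[abs_def])
  next
    case (Compl a)
    have "(\<lambda>x. 1 + (-1) * indicator a x) \<in> multipliers" by (intro multipliers_add multipliers_scale multipliers_const Compl)
    moreover have "(\<lambda>x. 1 + (-1) * indicator a x) = (indicator (UNIV - a) :: 'a \<Rightarrow> complex)"
      by (auto simp: indicator_def)
    ultimately show ?case by simp
  next
    case (Union a)
    have fin: "indicator (\<Union>i<n. a i) \<in> multipliers" for n :: nat
    proof (induction n)
      case 0 show ?case using multipliers_const[of 0] by (simp add: indicator_def[abs_def])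
    next
      case (Suc n)
      have "(\<lambda>x. (indicator (\<Union>i<n. a i) x + indicator (a n) x) + (-1) * (indicator (\<Union>i<n. a i) x * indicator (a n) x)) \<in> multipliers"
        by (intro multipliers_add multipliers_scale multipliers_mult Suc Union)
      moreover have "(\<lambda>x. (indicator (\<Union>i<n. a i) x + indicator (a n) x) + (-1) * (indicator (\<Union>i<n. a i) x * indicator (a n) x))
          = (indicator (\<Union>i<Suc n. a i) :: 'a \<Rightarrow> complex)"
        by (auto simp: indicator_def less_Suc_eq fun_eq_iff)
      ultimately show ?case by simp
    qed
    show ?case
    proof (rule multipliers_limit[OF fin])
      show "cmod (indicator (\<Union>i<n. a i) x) \<le> 1" for n x by (simp add: indicator_def)
      fix x
      show "(\<lambda>n. indicator (\<Union>i<n. a i) x :: complex) \<longlonglongrightarrow> indicator (\<Union>i. a i) x"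
        by (rule LIMSEQ_indicator_UN)
    qed
  qed
qed

theorem modulations_dense: "mod_closure = UNIV"
proof -
  have "toL2 f \<in> mod_closure" if f: "sqint f" for f
  proof -
    have [measurable]: "f \<in> borel_measurable borel" "g \<in> borel_measurable borel"
      using f g by (auto simp: sqint_def)
    \<comment> \<open>simple functions approximating \<open>f / g\<close>, multiplied by \<open>g\<close>, tend to \<open>f\<close> and are dominated by \<open>2 f\<close>\<close>
    have "(\<lambda>x. f x / g x) \<in> borel_measurable borel" by measurable
    then obtain s where s: "\<And>i. simple_function borel (s i)"
        "\<And>x. (\<lambda>i. s i x) \<longlonglongrightarrow> f x / g x" "\<And>i x. cmod (s i x) \<le> 2 * cmod (f x / g x)"
      using borel_measurable_implies_sequence_metric[of "\<lambda>x. f x / g x" borel 0] by auto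
    have sm: "s i \<in> multipliers" for i
    proof -
      have fin: "finite (range (s i))" using s(1)[of i] by (simp add: simple_function_def)
      have "(\<lambda>x. \<Sum>y\<in>range (s i). y * indicator (s i -` {y}) x) \<in> multipliers"
        using s(1)[of i] by (intro multipliers_sum[OF fin] multipliers_scale multipliers_indicator) (auto simp: simple_function_def)
      moreover have "(\<Sum>y\<in>range (s i). y * indicator (s i -` {y}) x) = s i x" for x
        using fin by (subst sum.remove[of _ "s i x"]) (auto simp: indicator_def intro!: sum.neutral)
      ultimately show ?thesis by simp
    qed
    have in_closure: "toL2 (\<lambda>x. s i x * g x) \<in> mod_closure" for i
      using sm[of i] g_in_mod_closure mulL2_toL2[of "s i" g] g by (auto simp: multipliers_def)
    show "toL2 f \<in> mod_closure"
    proof (rule mod_closure_limit[OF in_closure])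
      show "(\<lambda>i. toL2 (\<lambda>x. s i x * g x)) \<longlonglongrightarrow> toL2 f"
      proof (rule toL2_tendsto_dominated(2))
        show "sqint (\<lambda>x. s i x * g x)" for i using sm[of i] g by (auto simp: multipliers_def bdd_mult_sqint)
        show "sqint (\<lambda>x. 2 * f x)" using f by (rule sqint_scale)
        show "AE x in lborel. (\<lambda>i. s i x * g x) \<longlonglongrightarrow> f x"
        proof (rule AE_I2)
          fix x
          have "(\<lambda>i. s i x * g x) \<longlonglongrightarrow> f x / g x * g x" by (intro tendsto_mult s tendsto_const)
          then show "(\<lambda>i. s i x * g x) \<longlonglongrightarrow> f x" using g0 by simp
        qed
        show "AE x in lborel. cmod (s i x * g x) \<le> cmod (2 * f x)" for i
        proof (rule AE_I2)
          fix x
          have "cmod (s i x) * cmod (g x) \<le> 2 * cmod (f x / g x) * cmod (g x)"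
            by (intro mult_right_mono s) auto
          then show "cmod (s i x * g x) \<le> cmod (2 * f x)" using g0 by (simp add: norm_mult norm_divide)
        qed
      qed auto
    qed
  qed
  from this[OF sqint_fromL2] show ?thesis by auto
qed

end

section \<open>Gaussian integrals\<close>

text \<open>The normal density with variance \<open>1 / (2 \<pi> c)\<close>, rescaled.\<close>

lemma gaussian_integral_real:
  assumes "c > 0"
  shows "integrable lborel (\<lambda>x::real. exp (- (pi * c * x\<^sup>2)))"
    and "(LINT x|lborel. exp (- (pi * c * x\<^sup>2))) = 1 / sqrt c"
proof -
  define s where "s = sqrt (1 / (2 * pi * c))"
  have s: "s > 0" "s\<^sup>2 = 1 / (2 * pi * c)" using assms by (auto simp: s_def)
  have eq: "sqrt (1 / c) * normal_density 0 s x = exp (- (pi * c * x\<^sup>2))" for x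
    using assms unfolding normal_density_def s(2)
    by (simp add: field_simps real_sqrt_divide)
  have "integrable lborel (\<lambda>x. sqrt (1 / c) * normal_density 0 s x)"
    using s by (intro integrable_mult_right integrable_normal_density) auto
  then show "integrable lborel (\<lambda>x::real. exp (- (pi * c * x\<^sup>2)))" by (simp only: eq)
  have "(LINT x|lborel. sqrt (1 / c) * normal_density 0 s x) = sqrt (1 / c)"
    using s by (subst integral_mult_right_zero) (simp add: integral_normal_density)
  then show "(LINT x|lborel. exp (- (pi * c * x\<^sup>2))) = 1 / sqrt c" by (simp only: eq) (simp add: real_sqrt_divide)
qed

lemma lborel_integral_prod:
  fixes f :: "'a::euclidean_space \<Rightarrow> real \<Rightarrow> complex"
  assumes f: "\<And>b. b \<in> Basis \<Longrightarrow> integrable lborel (f b)"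
  shows "integrable lborel (\<lambda>x::'a. \<Prod>b\<in>Basis. f b (x \<bullet> b))"
    and "(LINT x|lborel. (\<Prod>b\<in>Basis. f b (x \<bullet> b))) = (\<Prod>b\<in>Basis. (LINT t|lborel. f b t))"
proof -
  interpret P: finite_product_sigma_finite "\<lambda>_::'a. lborel :: real measure" Basis
    by standard auto
  have [measurable]: "f b \<in> borel_measurable borel" if "b \<in> Basis" for b
    using borel_measurable_integrable[OF f[OF that]] by simp
  have [measurable]: "(\<lambda>x::'a. \<Prod>b\<in>Basis. f b (x \<bullet> b)) \<in> borel_measurable borel"
    by (intro borel_measurable_prod) measurable
  have eq: "(\<Prod>b\<in>Basis. f b ((\<Sum>c\<in>Basis. y c *\<^sub>R c) \<bullet> b)) = (\<Prod>b\<in>Basis. f b (y b))" for y :: "'a \<Rightarrow> real"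
    by (intro prod.cong refl) (simp add: inner_sum_left_Basis)
  have "integrable (\<Pi>\<^sub>M b\<in>Basis. lborel) (\<lambda>y. \<Prod>b\<in>(Basis::'a set). f b (y b))"
    by (rule P.product_integrable_prod) (auto intro: f)
  then show "integrable lborel (\<lambda>x::'a. \<Prod>b\<in>Basis. f b (x \<bullet> b))"
    by (subst lborel_eq, subst integrable_distr_eq) (auto simp: eq)
  have "(LINT x|lborel. (\<Prod>b\<in>Basis. f b (x \<bullet> b))) = (LINT y|(\<Pi>\<^sub>M b\<in>Basis. lborel). (\<Prod>b\<in>(Basis::'a set). f b (y b)))"
    by (subst lborel_eq, subst integral_distr) (auto simp: eq)
  also have "\<dots> = (\<Prod>b\<in>Basis. (LINT t|lborel. f b t))"
    by (rule P.product_integral_prod) (auto intro: f)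
  finally show "(LINT x|lborel. (\<Prod>b\<in>Basis. f b (x \<bullet> b))) = (\<Prod>b\<in>Basis. (LINT t|lborel. f b t))" .
qed

lemma gaussian_integral_norm:
  assumes c: "c > 0"
  shows "integrable lborel (\<lambda>x::'a::euclidean_space. exp (- (pi * c * (norm x)\<^sup>2)))"
    and "(LINT x|lborel. exp (- (pi * (norm (x::'a))\<^sup>2))) = 1"
proof -
  have eq: "(\<Prod>b\<in>Basis. complex_of_real (exp (- (pi * c * (x \<bullet> b)\<^sup>2)))) = of_real (exp (- (pi * c * (norm x)\<^sup>2)))"
    for x :: 'a and c
  proof -
    have "(norm x)\<^sup>2 = (\<Sum>b\<in>Basis. (x \<bullet> b)\<^sup>2)"
      unfolding power2_norm_eq_inner by (subst euclidean_inner) (simp add: power2_eq_square)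
    then have "exp (- (pi * c * (norm x)\<^sup>2)) = (\<Prod>b\<in>Basis. exp (- (pi * c * (x \<bullet> b)\<^sup>2)))"
      by (simp add: sum_distrib_left exp_sum flip: sum_negf)
    then show ?thesis by simp
  qed
  have int: "integrable lborel (\<lambda>t::real. complex_of_real (exp (- (pi * c * t\<^sup>2))))" if "c > 0" for c
    using gaussian_integral_real(1)[OF that] by (rule integrable_of_real)
  show "integrable lborel (\<lambda>x::'a. exp (- (pi * c * (norm x)\<^sup>2)))"
    using lborel_integral_prod(1)[where f="\<lambda>_::'a. \<lambda>t. complex_of_real (exp (- (pi * c * t\<^sup>2)))", OF int[OF c], unfolded eq]
    by (simp add: complex_of_real_integrable_eq)
  have "complex_of_real (LINT x|lborel. exp (- (pi * (norm (x::'a))\<^sup>2)))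
      = (LINT x|lborel. of_real (exp (- (pi * 1 * (norm (x::'a))\<^sup>2))))"
    by simp
  also have "\<dots> = (\<Prod>b\<in>(Basis::'a set). (LINT t|lborel. complex_of_real (exp (- (pi * 1 * t\<^sup>2)))))"
    unfolding eq[symmetric] by (rule lborel_integral_prod(2)) (rule int, simp)
  also have "\<dots> = 1"
    unfolding integral_complex_of_real using gaussian_integral_real(2)[of 1] by simp
  finally show "(LINT x|lborel. exp (- (pi * (norm (x::'a))\<^sup>2))) = 1" by simp
qed

lemma lborel_integral_translate:
  fixes f :: "'a::euclidean_space \<Rightarrow> complex"
  assumes "f \<in> borel_measurable borel"
  shows "(LINT x|lborel. f (x + v)) = (LINT x|lborel. f x)"
proof -
  have "(LINT x|lborel. f x) = (LINT x|distr lborel borel ((+) v). f x)" by (simp only: lborel_distr_plus)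
  also have "\<dots> = (LINT x|lborel. f (v + x))" using assms by (subst integral_distr) auto
  finally show ?thesis by (simp add: add.commute)
qed

definition quad_gauss :: "('a::euclidean_space \<Rightarrow> 'a \<Rightarrow> complex) \<Rightarrow> ('a \<Rightarrow> complex) \<Rightarrow> 'a \<Rightarrow> complex" where
  "quad_gauss q l x = exp (- of_real pi * q x x + 2 * of_real pi * l x)"

text \<open>Gaussians are treated for a complex-valued form on an abstract Euclidean space, since the real
  line is needed for the factors of an atomic contraction and real coordinate space for everything
  else.\<close>

locale coercive_form =
  fixes q :: "'a::euclidean_space \<Rightarrow> 'a \<Rightarrow> complex" and m :: real
  assumes bil: "bounded_bilinear q" and sym: "q x y = q y x"
    and m0: "m > 0" and coercive: "Re (q x x) \<ge> m * (norm x)\<^sup>2"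
begin

lemma measurable_gauss:
  assumes "bounded_linear l" shows "quad_gauss q l \<in> borel_measurable borel"
  unfolding quad_gauss_def
  by (intro borel_measurable_continuous_onI continuous_intros
      bounded_bilinear.continuous_on[OF bil] linear_continuous_on assms)

lemma gauss_bound:
  assumes l: "bounded_linear l"
  obtains C where "\<And>x. cmod (quad_gauss q l x) \<le> C * exp (- (pi * (m / 2) * (norm x)\<^sup>2))"
proof -
  obtain K where K: "\<And>x. cmod (l x) \<le> norm x * K" "K > 0"
    using bounded_linear.pos_bounded[OF l] by auto
  have "cmod (quad_gauss q l x) \<le> exp (2 * pi * K\<^sup>2 / m) * exp (- (pi * (m / 2) * (norm x)\<^sup>2))" for x
  proof -
    have "Re (l x) \<le> norm x * K" using K(1)[of x] complex_Re_le_cmod order.trans by blast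
    also have "2 * (norm x * K) \<le> m / 2 * (norm x)\<^sup>2 + 2 * K\<^sup>2 / m"
    proof -
      \<comment> \<open>completing the square: the linear term costs only half of the quadratic decay\<close>
      have "0 \<le> (m * norm x - 2 * K)\<^sup>2 / (2 * m)" using m0 by simp
      also have "\<dots> = m / 2 * (norm x)\<^sup>2 + 2 * K\<^sup>2 / m - 2 * (norm x * K)"
        using m0 by (simp add: field_simps power2_eq_square)
      finally show ?thesis by simp
    qed
    finally have *: "2 * Re (l x) \<le> m / 2 * (norm x)\<^sup>2 + 2 * K\<^sup>2 / m" by simp
    have "- Re (q x x) + 2 * Re (l x) \<le> 2 * K\<^sup>2 / m - m / 2 * (norm x)\<^sup>2"
      using * coercive[of x] by simp
    then have "pi * (- Re (q x x) + 2 * Re (l x)) \<le> pi * (2 * K\<^sup>2 / m - m / 2 * (norm x)\<^sup>2)"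
      by (rule mult_left_mono) simp
    then have "exp (- pi * Re (q x x) + 2 * pi * Re (l x)) \<le> exp (2 * pi * K\<^sup>2 / m + - (pi * (m / 2) * (norm x)\<^sup>2))"
      by (subst exp_le_cancel_iff) (simp add: algebra_simps)
    moreover have "cmod (quad_gauss q l x) = exp (- pi * Re (q x x) + 2 * pi * Re (l x))"
      by (simp add: quad_gauss_def norm_exp_eq_Re)
    ultimately show ?thesis
      by (simp only: exp_add[of "2 * pi * K\<^sup>2 / m" "- (pi * (m / 2) * (norm x)\<^sup>2)"])
  qed
  then show ?thesis by (rule that)
qed

lemma integrable_gauss:
  assumes l: "bounded_linear l" shows "integrable lborel (quad_gauss q l)"
proof -
  obtain C where C: "\<And>x. cmod (quad_gauss q l x) \<le> C * exp (- (pi * (m / 2) * (norm x)\<^sup>2))"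
    using gauss_bound[OF l] by blast
  have "integrable lborel (\<lambda>x::'a. C * exp (- (pi * (m / 2) * (norm x)\<^sup>2)))"
    by (intro integrable_mult_right gaussian_integral_norm(1)) (use m0 in simp)
  then show ?thesis
    by (rule Bochner_Integration.integrable_bound)
       (use measurable_gauss[OF l] C in \<open>auto intro!: AE_I2 order.trans[OF _ abs_ge_self]\<close>)
qed

lemma sqint_gauss:
  assumes l: "bounded_linear l" shows "sqint (quad_gauss q l)"
proof -
  obtain C where C: "\<And>x. cmod (quad_gauss q l x) \<le> C * exp (- (pi * (m / 2) * (norm x)\<^sup>2))"
    using gauss_bound[OF l] by blast
  have [measurable]: "quad_gauss q l \<in> borel_measurable borel" by (rule measurable_gauss[OF l])
  have "integrable lborel (\<lambda>x::'a. C\<^sup>2 * exp (- (pi * m * (norm x)\<^sup>2)))"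
    by (intro integrable_mult_right gaussian_integral_norm(1)) (use m0 in simp)
  then have "integrable lborel (\<lambda>x. (cmod (quad_gauss q l x))\<^sup>2)"
  proof (rule Bochner_Integration.integrable_bound)
    have "(cmod (quad_gauss q l x))\<^sup>2 \<le> C\<^sup>2 * exp (- (pi * m * (norm x)\<^sup>2))" for x
    proof -
      have "(cmod (quad_gauss q l x))\<^sup>2 \<le> (C * exp (- (pi * (m / 2) * (norm x)\<^sup>2)))\<^sup>2"
        by (intro power_mono C) auto
      also have "\<dots> = C\<^sup>2 * exp (- (pi * m * (norm x)\<^sup>2))"
        by (simp add: power_mult_distrib flip: exp_double)
      finally show ?thesis .
    qed
    then show "AE x in lborel. norm ((cmod (quad_gauss q l x))\<^sup>2) \<le> norm (C\<^sup>2 * exp (- (pi * m * (norm x)\<^sup>2)))"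
      by (auto intro!: AE_I2)
  qed measurable
  then show ?thesis by (simp add: sqint_def)
qed

lemma bl_q: "bounded_linear (q v)"
  by (rule bounded_bilinear.bounded_linear_right[OF bil])

text \<open>Substituting \<open>x + t v\<close> for \<open>x\<close>, which is possible for real \<open>t\<close> only.\<close>

lemma integral_shift:
  assumes l: "bounded_linear l"
  shows "(LINT x|lborel. quad_gauss q (\<lambda>x. l x + of_real t * q v x) x)
     = exp (2 * of_real pi * of_real t * l v + of_real pi * (of_real t)\<^sup>2 * q v v) * (LINT x|lborel. quad_gauss q l x)"
proof -
  let ?l = "\<lambda>x. l x + of_real t * q v x"
  have bl: "bounded_linear ?l"
    by (intro bounded_linear_add l bounded_linear_const_mult bl_q)
  interpret q: bounded_bilinear q by (rule bil)
  interpret l: bounded_linear l by (rule l)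
  have "(LINT x|lborel. quad_gauss q ?l x) = (LINT x|lborel. quad_gauss q ?l (x + t *\<^sub>R v))"
    by (rule lborel_integral_translate[symmetric, OF measurable_gauss[OF bl]])
  also have "\<dots> = (LINT x|lborel. exp (2 * of_real pi * of_real t * l v + of_real pi * (of_real t)\<^sup>2 * q v v) * quad_gauss q l x)"
  proof (rule Bochner_Integration.integral_cong[OF refl])
    fix x
    show "quad_gauss q ?l (x + t *\<^sub>R v) = exp (2 * of_real pi * of_real t * l v + of_real pi * (of_real t)\<^sup>2 * q v v) * quad_gauss q l x"
      unfolding quad_gauss_def exp_add[symmetric] q.add_left q.add_right q.scaleR_left q.scaleR_right l.add l.scaleR
      by (rule arg_cong[where f=exp]) (simp add: sym[of x v] scaleR_conv_of_real algebra_simps power2_eq_square)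
  qed
  also have "\<dots> = exp (2 * of_real pi * of_real t * l v + of_real pi * (of_real t)\<^sup>2 * q v v) * (LINT x|lborel. quad_gauss q l x)"
    by (rule integral_mult_right_zero)
  finally show ?thesis .
qed

text \<open>Expanding the exponential in \<open>\<zeta>\<close> gives a power series that converges for every \<open>\<zeta>\<close>: the sum of
  the moduli is dominated by a Gaussian times the exponential of a linear function of the norm, which is
  integrable.\<close>

lemma holomorphic_param:
  assumes l: "bounded_linear l" and k: "bounded_linear k"
  shows "(\<lambda>\<zeta>. LINT x|lborel. quad_gauss q (\<lambda>x. l x + \<zeta> * k x) x) holomorphic_on ball 0 r"
proof -
  define a where "a n = (LINT x|lborel. quad_gauss q l x * ((2 * of_real pi * k x) ^ n /\<^sub>R fact n))" for n
  obtain K where K: "\<And>x. cmod (k x) \<le> norm x * K" "K > 0"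
    using bounded_linear.pos_bounded[OF k] by auto
  have [measurable]: "quad_gauss q l \<in> borel_measurable borel" by (rule measurable_gauss[OF l])
  have [measurable]: "k \<in> borel_measurable borel"
    by (intro borel_measurable_continuous_onI linear_continuous_on k)
  obtain C where C: "\<And>x. cmod (quad_gauss q l x) \<le> C * exp (- (pi * (m / 2) * (norm x)\<^sup>2))"
    using gauss_bound[OF l] by blast
  have sums: "(\<lambda>n. a n * (\<zeta> - 0) ^ n) sums (LINT x|lborel. quad_gauss q (\<lambda>x. l x + \<zeta> * k x) x)" for \<zeta>
  proof -
    let ?f = "\<lambda>n x. quad_gauss q l x * ((2 * of_real pi * \<zeta> * k x) ^ n /\<^sub>R fact n)"
    let ?E = "\<lambda>x. cmod (quad_gauss q l x) * exp (2 * pi * cmod \<zeta> * cmod (k x))"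
    have sE: "(\<lambda>n. cmod (?f n x)) sums ?E x" for x
    proof -
      have "(\<lambda>n. cmod (quad_gauss q l x) * ((2 * pi * cmod \<zeta> * cmod (k x)) ^ n /\<^sub>R fact n)) sums ?E x"
        by (intro sums_mult exp_converges)
      then show ?thesis by (simp add: norm_mult norm_power mult.left_commute)
    qed
    \<comment> \<open>the linear growth in the second factor costs half of the decay that \<open>gauss_bound\<close> provides\<close>
    have iE: "integrable lborel ?E"
    proof (rule Bochner_Integration.integrable_bound)
      let ?B = "2 * cmod \<zeta> * K"
      have ex: "integrable lborel (\<lambda>x::'a. (C * exp (pi * ?B\<^sup>2 / m)) * exp (- (pi * (m / 4) * (norm x)\<^sup>2)))"
        by (intro integrable_mult_right gaussian_integral_norm(1)) (use m0 in simp)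
      then show "integrable lborel (\<lambda>x::'a. (C * exp (pi * ?B\<^sup>2 / m)) * exp (- (pi * (m / 4) * (norm x)\<^sup>2)))" .
      show "AE x in lborel. norm (?E x) \<le> norm ((C * exp (pi * ?B\<^sup>2 / m)) * exp (- (pi * (m / 4) * (norm x)\<^sup>2)))"
      proof (rule AE_I2)
        fix x
        have "2 * pi * cmod \<zeta> * cmod (k x) \<le> 2 * pi * cmod \<zeta> * (norm x * K)"
          by (intro mult_left_mono K) auto
        also have "\<dots> = pi * (?B * norm x)" by simp
        also have "?B * norm x \<le> ?B\<^sup>2 / m + m / 4 * (norm x)\<^sup>2"
        proof -
          have "0 \<le> (m * norm x - 2 * ?B)\<^sup>2 / (4 * m)" using m0 by simp
          also have "\<dots> = ?B\<^sup>2 / m + m / 4 * (norm x)\<^sup>2 - ?B * norm x"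
            using m0 by (simp add: field_simps power2_eq_square)
          finally show ?thesis by simp
        qed
        finally have "2 * pi * cmod \<zeta> * cmod (k x) \<le> pi * (?B\<^sup>2 / m + m / 4 * (norm x)\<^sup>2)"
          by (simp add: mult_left_mono)
        then have "?E x \<le> C * exp (- (pi * (m / 2) * (norm x)\<^sup>2)) * exp (pi * (?B\<^sup>2 / m + m / 4 * (norm x)\<^sup>2))"
          by (intro mult_mono C) (use C[of x] in \<open>auto intro: order.trans[OF norm_ge_zero]\<close>)
        also have "\<dots> = (C * exp (pi * ?B\<^sup>2 / m)) * exp (- (pi * (m / 4) * (norm x)\<^sup>2))"
          by (simp add: mult.assoc flip: exp_add) (simp add: algebra_simps)
        finally show "norm (?E x) \<le> norm ((C * exp (pi * ?B\<^sup>2 / m)) * exp (- (pi * (m / 4) * (norm x)\<^sup>2)))"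
          by (simp add: norm_mult) 
      qed
    qed measurable
    have intf: "integrable lborel (?f n)" for n
    proof (rule Bochner_Integration.integrable_bound[OF iE])
      have "cmod (?f n x) \<le> ?E x" for x
        using sums_le[OF _ sums_If_finite_set[of "{n}" "\<lambda>n. cmod (?f n x)"] sE[of x]] by auto
      then show "AE x in lborel. norm (?f n x) \<le> norm (?E x)" by (intro AE_I2) simp
    qed measurable
    have "(\<lambda>n. integral\<^sup>L lborel (?f n)) sums (LINT x|lborel. (\<Sum>n. ?f n x))"
    proof (rule sums_integral[OF intf])
      show "AE x in lborel. summable (\<lambda>n. norm (?f n x))"
        using sE by (intro AE_I2) (rule sums_summable)
      show "summable (\<lambda>n. LINT x|lborel. norm (?f n x))"
      proof (rule summableI_nonneg_bounded)
        fix N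
        have "(\<Sum>n<N. LINT x|lborel. norm (?f n x)) = (LINT x|lborel. (\<Sum>n<N. norm (?f n x)))"
          by (rule Bochner_Integration.integral_sum[symmetric]) (rule integrable_norm[OF intf])
        also have "\<dots> \<le> (LINT x|lborel. ?E x)"
        proof (rule integral_mono[OF _ iE])
          show "integrable lborel (\<lambda>x. \<Sum>n<N. norm (?f n x))"
            by (intro Bochner_Integration.integrable_sum integrable_norm[OF intf])
          show "(\<Sum>n<N. norm (?f n x)) \<le> ?E x" for x
            unfolding sums_unique[OF sE] by (rule sum_le_suminf[OF sums_summable[OF sE]]) simp_all
        qed
        finally show "(\<Sum>n<N. LINT x|lborel. norm (?f n x)) \<le> (LINT x|lborel. ?E x)" .
      qed auto
    qed
    moreover have "(\<Sum>n. ?f n x) = quad_gauss q (\<lambda>x. l x + \<zeta> * k x) x" for x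
    proof -
      have "(\<lambda>n. ?f n x) sums (quad_gauss q l x * exp (2 * of_real pi * \<zeta> * k x))"
        by (intro sums_mult exp_converges)
      then show ?thesis
        by (simp add: sums_unique[symmetric] quad_gauss_def algebra_simps flip: exp_add)
    qed
    moreover have "integral\<^sup>L lborel (?f n) = a n * (\<zeta> - 0) ^ n" for n
    proof -
      have "integral\<^sup>L lborel (?f n) = (LINT x|lborel. (quad_gauss q l x * ((2 * of_real pi * k x) ^ n /\<^sub>R fact n)) * \<zeta> ^ n)"
        by (intro Bochner_Integration.integral_cong refl) (simp add: power_mult_distrib mult_ac)
      then show ?thesis by (simp add: a_def)
    qed
    ultimately show ?thesis by simp
  qed
  show ?thesis by (rule power_series_holomorphic[where z=0, OF sums])
qed

text \<open>Both sides, with \<open>\<i>\<close> replaced by \<open>\<zeta>\<close>, are holomorphic in \<open>\<zeta>\<close>, and they agree for real \<open>\<zeta>\<close> by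
  \<open>integral_shift\<close>. This replaces the shift of the contour by one complex variable.\<close>

lemma integral_imag_shift:
  "(LINT x|lborel. quad_gauss q (\<lambda>x. \<i> * q v x) x) = exp (- of_real pi * q v v) * (LINT x|lborel. quad_gauss q (\<lambda>x. 0) x)"
proof -
  let ?h = "\<lambda>\<zeta>. (LINT x|lborel. quad_gauss q (\<lambda>x. 0 + \<zeta> * q v x) x)
     - exp (of_real pi * \<zeta>\<^sup>2 * q v v) * (LINT x|lborel. quad_gauss q (\<lambda>x. 0) x)"
  have hol: "?h holomorphic_on ball 0 2"
    by (intro holomorphic_intros holomorphic_param bl_q bounded_linear_zero)
  have "?h \<i> = 0"
  proof (rule analytic_continuation[OF hol, of "\<real> \<inter> ball 0 2" 0])
    show "(0::complex) islimpt \<real> \<inter> ball 0 2"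
      unfolding islimpt_approachable
    proof (intro allI impI)
      fix e :: real assume "e > 0"
      then show "\<exists>x'\<in>\<real> \<inter> ball 0 2. x' \<noteq> (0::complex) \<and> dist x' 0 < e"
        by (intro bexI[of _ "of_real (min (e/2) 1)"]) auto
    qed
    show "?h z = 0" if "z \<in> \<real> \<inter> ball 0 2" for z
    proof -
      obtain t where "z = of_real t" using \<open>z \<in> \<real> \<inter> ball 0 2\<close> by (auto elim: Reals_cases)
      then show ?thesis using integral_shift[of "\<lambda>_. 0" t v] by (simp add: bounded_linear_zero)
    qed
  qed auto
  then show ?thesis by simp
qed

text \<open>The usual formula with exponent \<open>\<pi> A\<inverse> b \<cdot> b\<close>, stated without an inverse: the linear term is
  parametrized as \<open>b = A (u + i v)\<close> with real \<open>u\<close> and \<open>v\<close>.\<close>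

theorem gauss_integral:
  "(LINT x|lborel. quad_gauss q (\<lambda>x. q u x + \<i> * q v x) x)
    = exp (of_real pi * (q u u - q v v + 2 * \<i> * q u v)) * (LINT x|lborel. quad_gauss q (\<lambda>x. 0) x)"
proof -
  have "(LINT x|lborel. quad_gauss q (\<lambda>x. \<i> * q v x + of_real 1 * q u x) x)
    = exp (2 * of_real pi * of_real 1 * (\<i> * q v u) + of_real pi * (of_real 1)\<^sup>2 * q u u) * (LINT x|lborel. quad_gauss q (\<lambda>x. \<i> * q v x) x)"
    by (rule integral_shift) (intro bounded_linear_const_mult bl_q)
  then show ?thesis
    unfolding integral_imag_shift
    by (simp add: add.commute sym[of v u] flip: exp_add mult.assoc) (simp add: algebra_simps)
qed

end

section \<open>Maps that scale Lebesgue measure\<close>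

text \<open>In terms of integrals: \<open>\<integral> f = c \<integral> f \<circ> \<phi>\<close>, so that \<open>c = \<bar>a\<bar>\<close> for multiplication by \<open>a\<close> on the line.\<close>

definition scales_lborel :: "('a::euclidean_space \<Rightarrow> 'a) \<Rightarrow> real \<Rightarrow> bool" where
  "scales_lborel \<phi> c \<longleftrightarrow> \<phi> \<in> borel_measurable borel \<and> c > 0
     \<and> lborel = density (distr lborel borel \<phi>) (\<lambda>_. ennreal c)"

definition compL2 :: "('a::euclidean_space \<Rightarrow> 'a) \<Rightarrow> 'a L2 \<Rightarrow> 'a L2" where
  "compL2 \<phi> u = toL2 (\<lambda>x. fromL2 u (\<phi> x))"

lemma scales_nn_integral:
  assumes "scales_lborel \<phi> c" "f \<in> borel_measurable borel"
  shows "(\<integral>\<^sup>+x. f x \<partial>lborel) = ennreal c * (\<integral>\<^sup>+x. f (\<phi> x) \<partial>lborel)"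
proof -
  have [measurable]: "\<phi> \<in> borel_measurable borel" "f \<in> borel_measurable borel"
    and eq: "lborel = density (distr lborel borel \<phi>) (\<lambda>_. ennreal c)"
    using assms by (auto simp: scales_lborel_def)
  have "(\<integral>\<^sup>+x. f x \<partial>lborel) = (\<integral>\<^sup>+x. f x \<partial>density (distr lborel borel \<phi>) (\<lambda>_. ennreal c))"
    using eq by simp
  also have "\<dots> = ennreal c * (\<integral>\<^sup>+x. f (\<phi> x) \<partial>lborel)"
    by (subst nn_integral_density) (auto simp: nn_integral_cmult nn_integral_distr)
  finally show ?thesis .
qed

lemma scales_AE:
  assumes s: "scales_lborel \<phi> c" and "AE x in lborel. P x"
  shows "AE x in lborel. P (\<phi> x)"
proof -
  have [measurable]: "\<phi> \<in> borel_measurable borel" using s by (auto simp: scales_lborel_def)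
  obtain N where N: "{x. \<not> P x} \<subseteq> N" "emeasure lborel N = 0" "N \<in> sets borel"
    using assms(2) by (auto elim!: AE_E)
  have vN: "\<phi> -` N \<in> sets borel" by (rule measurable_sets_borel[OF _ N(3)]) measurable
  have "(\<integral>\<^sup>+x. indicator N (\<phi> x) \<partial>lborel) = (\<integral>\<^sup>+x. indicator (\<phi> -` N) x \<partial>lborel)"
    by (intro nn_integral_cong) (auto simp: indicator_def)
  also have "\<dots> = emeasure lborel (\<phi> -` N)" using vN by simp
  finally have "(\<integral>\<^sup>+x. indicator N (\<phi> x) \<partial>lborel) = emeasure lborel (\<phi> -` N)" .
  then have "ennreal c * emeasure lborel (\<phi> -` N) = 0"
    using scales_nn_integral[OF s, of "indicator N"] N by simp
  then have "emeasure lborel (\<phi> -` N) = 0" using s by (auto simp: scales_lborel_def)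
  then show ?thesis
    using N vN by (intro AE_I'[of "\<phi> -` N"]) (auto simp: null_sets_def)
qed

lemma scales_sqint:
  assumes s: "scales_lborel \<phi> c" and f: "sqint f"
  shows "sqint (\<lambda>x. f (\<phi> x))" "(norm (toL2 f))\<^sup>2 = c * (norm (toL2 (\<lambda>x. f (\<phi> x))))\<^sup>2"
proof -
  have [measurable]: "\<phi> \<in> borel_measurable borel" "f \<in> borel_measurable borel"
    using s f by (auto simp: scales_lborel_def sqint_def)
  have c: "c > 0" using s by (auto simp: scales_lborel_def)
  have eq: "(\<integral>\<^sup>+x. ennreal ((cmod (f x))\<^sup>2) \<partial>lborel) = ennreal c * (\<integral>\<^sup>+x. ennreal ((cmod (f (\<phi> x)))\<^sup>2) \<partial>lborel)"
    by (rule scales_nn_integral[OF s]) measurable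
  have "(\<integral>\<^sup>+x. ennreal ((cmod (f x))\<^sup>2) \<partial>lborel) < \<infinity>"
    using f by (auto simp: sqint_def integrable_iff_bounded)
  then have "(\<integral>\<^sup>+x. ennreal ((cmod (f (\<phi> x)))\<^sup>2) \<partial>lborel) < \<infinity>"
    unfolding eq using c by (auto simp: ennreal_mult_less_top)
  then show sq: "sqint (\<lambda>x. f (\<phi> x))"
    by (auto simp: sqint_def integrable_iff_bounded)
  have "ennreal (LINT x|lborel. (cmod (f x))\<^sup>2) = ennreal c * ennreal (LINT x|lborel. (cmod (f (\<phi> x)))\<^sup>2)"
    using eq f sq by (subst (asm) (1 2) nn_integral_eq_integral) (auto simp: sqint_def)
  then show "(norm (toL2 f))\<^sup>2 = c * (norm (toL2 (\<lambda>x. f (\<phi> x))))\<^sup>2"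
    using c by (simp add: norm_toL2 f sq flip: ennreal_mult)
qed

lemma compL2_toL2:
  assumes s: "scales_lborel \<phi> c" and f: "sqint f"
  shows "compL2 \<phi> (toL2 f) = toL2 (\<lambda>x. f (\<phi> x))"
  unfolding compL2_def
  by (subst toL2_eq_iff) (auto intro!: scales_sqint(1)[OF s] f scales_AE[OF s] AE_fromL2_toL2)

lemma compL2_scaleC:
  assumes s: "scales_lborel \<phi> c"
  shows "compL2 \<phi> (scaleC_L2 a u) = scaleC_L2 a (compL2 \<phi> u)"
proof -
  obtain f where f: "sqint f" "u = toL2 f" by (metis L2_cases)
  show ?thesis unfolding f(2) toL2_scaleC[OF f(1)]
    by (simp add: compL2_toL2[OF s] f(1) sqint_scale scales_sqint[OF s] toL2_scaleC)
qed

lemma bounded_linear_compL2: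
  assumes s: "scales_lborel \<phi> c"
  shows "bounded_linear (compL2 \<phi>)"
proof (rule bounded_linear_intro[where K="1 / sqrt c"])
  fix u v :: "'a L2" and r :: real
  obtain f g where f: "sqint f" "u = toL2 f" and g: "sqint g" "v = toL2 g" by (metis L2_cases)
  show "compL2 \<phi> (u + v) = compL2 \<phi> u + compL2 \<phi> v"
    unfolding f(2) g(2) toL2_add[OF f(1) g(1)]
    by (simp add: compL2_toL2[OF s] f(1) g(1) sqint_add scales_sqint[OF s] toL2_add)
  show "compL2 \<phi> (r *\<^sub>R u) = r *\<^sub>R compL2 \<phi> u"
    by (simp add: scaleR_eq_scaleC compL2_scaleC[OF s])
  have c: "c > 0" using s by (auto simp: scales_lborel_def)
  have "(norm (compL2 \<phi> u))\<^sup>2 = (norm u * (1 / sqrt c))\<^sup>2"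
    using scales_sqint(2)[OF s f(1)] c unfolding f(2) compL2_toL2[OF s f(1)]
    by (simp add: power_mult_distrib power_divide)
  then show "norm (compL2 \<phi> u) \<le> norm u * (1 / sqrt c)"
    using c by (rule_tac power2_le_imp_le) auto
qed

lemma scales_uminus: "scales_lborel (uminus :: 'a::euclidean_space \<Rightarrow> 'a) 1"
  using lborel_affine[of "-1" "0::'a"] by (simp add: scales_lborel_def)

lemma scales_real: "c \<noteq> 0 \<Longrightarrow> scales_lborel (\<lambda>x::real. c * x) \<bar>c\<bar>"
  using lborel_real_affine[of c 0] by (simp add: scales_lborel_def)

lemma nn_integral_translate:
  fixes f :: "'a::euclidean_space \<Rightarrow> ennreal"
  assumes "f \<in> borel_measurable borel"
  shows "(\<integral>\<^sup>+x. f (x + v) \<partial>lborel) = (\<integral>\<^sup>+x. f x \<partial>lborel)"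
proof -
  have "(\<integral>\<^sup>+x. f x \<partial>lborel) = (\<integral>\<^sup>+x. f x \<partial>distr lborel borel ((+) v))" by (simp only: lborel_distr_plus)
  also have "\<dots> = (\<integral>\<^sup>+x. f (v + x) \<partial>lborel)" using assms by (subst nn_integral_distr) auto
  finally show ?thesis by (simp add: add.commute)
qed

text \<open>The image of Lebesgue measure under a linear bijection is translation invariant, and a
  translation invariant measure is a multiple of Lebesgue measure by the Fubini argument with an
  auxiliary set, here the unit ball.\<close>

lemma scales_linear:
  fixes \<phi> \<psi> :: "'a::euclidean_space \<Rightarrow> 'a"
  assumes \<phi>: "linear \<phi>" and \<psi>: "linear \<psi>" and inv: "\<And>x. \<phi> (\<psi> x) = x" "\<And>x. \<psi> (\<phi> x) = x"
  shows "\<exists>c. scales_lborel \<phi> c"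
proof -
  have bl: "bounded_linear \<phi>" "bounded_linear \<psi>" using \<phi> \<psi> by (simp_all add: linear_conv_bounded_linear)
  have [measurable]: "\<phi> \<in> borel_measurable borel"
    by (intro borel_measurable_continuous_onI linear_continuous_on bl)
  let ?B = "cball (0::'a) 1"
  define G :: "'a \<Rightarrow> ennreal" where "G = indicator ?B"
  have [measurable]: "G \<in> borel_measurable borel" unfolding G_def by (rule borel_measurable_indicator) simp
  define C where "C = {x. norm (\<phi> x) \<le> 1}"
  have C: "C \<in> sets borel" unfolding C_def by measurable
  obtain K where K: "K > 0" "\<And>x. norm (\<psi> x) \<le> norm x * K" using bounded_linear.pos_bounded[OF bl(2)] by blast
  obtain L where L: "L > 0" "\<And>x. norm (\<phi> x) \<le> norm x * L" using bounded_linear.pos_bounded[OF bl(1)] by blast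
  have "norm x \<le> K" if "x \<in> C" for x
  proof -
    have "norm x \<le> norm (\<phi> x) * K" using K(2)[of "\<phi> x"] by (simp add: inv)
    also have "\<dots> \<le> 1 * K" using that K(1) by (intro mult_right_mono) (auto simp: C_def)
    finally show ?thesis by simp
  qed
  then have "bounded C" by (auto simp: bounded_iff)
  then have Cfin: "emeasure lborel C < \<infinity>" by (rule emeasure_bounded_finite)
  have sub: "cball 0 (1 / L) \<subseteq> C"
  proof
    fix x :: 'a assume "x \<in> cball 0 (1 / L)"
    then have "norm x * L \<le> 1" using L(1) by (simp add: field_simps)
    then show "x \<in> C" using L(2)[of x] by (simp add: C_def)
  qed
  have ball_pos: "emeasure lborel (cball (0::'a) r) = ennreal (measure lborel (cball (0::'a) r))" "measure lborel (cball (0::'a) r) > 0"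
    if "r > 0" for r
    using that content_cball_pos[of r "0::'a"] emeasure_bounded_finite[of "cball (0::'a) r"]
    by (auto simp: emeasure_eq_ennreal_measure)
  have "emeasure lborel (cball (0::'a) (1 / L)) \<le> emeasure lborel C" by (rule emeasure_mono[OF sub]) (simp add: C)
  moreover have "0 < emeasure lborel (cball (0::'a) (1 / L))" using ball_pos[of "1 / L"] L(1) by simp
  ultimately have Cpos: "0 < emeasure lborel C" by order
  define c where "c = measure lborel C"
  have c: "emeasure lborel C = ennreal c" "c > 0"
  proof -
    show "emeasure lborel C = ennreal c" unfolding c_def using Cfin by (intro emeasure_eq_ennreal_measure) auto
    then show "c > 0" using Cpos by simp
  qed
  define a where "a = measure lborel ?B"
  have a: "emeasure lborel ?B = ennreal a" "a > 0" using ball_pos[of 1] by (auto simp: a_def)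
  have key: "(\<integral>\<^sup>+x. f (\<phi> x) \<partial>lborel) * ennreal a = ennreal c * (\<integral>\<^sup>+x. f x \<partial>lborel)"
    if [measurable]: "f \<in> borel_measurable borel" for f
  proof -
    \<comment> \<open>each of the two integrals is translated by an amount that depends on the other variable\<close>
    have "(\<integral>\<^sup>+x. f (\<phi> x) \<partial>lborel) * ennreal a = (\<integral>\<^sup>+x. f (\<phi> x) \<partial>lborel) * (\<integral>\<^sup>+y. G y \<partial>lborel)"
      by (simp add: G_def a)
    also have "\<dots> = (\<integral>\<^sup>+y. (\<integral>\<^sup>+x. f (\<phi> x) \<partial>lborel) * G y \<partial>lborel)" by (simp add: nn_integral_cmult)
    also have "\<dots> = (\<integral>\<^sup>+y. \<integral>\<^sup>+x. f (\<phi> x + y) * G y \<partial>lborel \<partial>lborel)"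
    proof (rule nn_integral_cong)
      fix y
      have "(\<integral>\<^sup>+x. f (\<phi> x) \<partial>lborel) = (\<integral>\<^sup>+x. f (\<phi> (x + \<psi> y)) \<partial>lborel)"
        by (rule nn_integral_translate[symmetric]) measurable
      also have "\<dots> = (\<integral>\<^sup>+x. f (\<phi> x + y) \<partial>lborel)" by (simp add: linear_add[OF \<phi>] inv)
      finally show "(\<integral>\<^sup>+x. f (\<phi> x) \<partial>lborel) * G y = (\<integral>\<^sup>+x. f (\<phi> x + y) * G y \<partial>lborel)"
        by (simp add: nn_integral_multc)
    qed
    also have "\<dots> = (\<integral>\<^sup>+x. \<integral>\<^sup>+y. f (\<phi> x + y) * G y \<partial>lborel \<partial>lborel)"
      by (rule lborel_pair.Fubini'[where f="\<lambda>x y. f (\<phi> x + y) * G y"]) measurable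
    also have "\<dots> = (\<integral>\<^sup>+x. \<integral>\<^sup>+y. f y * G (y - \<phi> x) \<partial>lborel \<partial>lborel)"
    proof (rule nn_integral_cong)
      fix x
      have "(\<integral>\<^sup>+y. f y * G (y - \<phi> x) \<partial>lborel) = (\<integral>\<^sup>+y. f (y + \<phi> x) * G (y + \<phi> x - \<phi> x) \<partial>lborel)"
        by (rule nn_integral_translate[symmetric]) measurable
      then show "(\<integral>\<^sup>+y. f (\<phi> x + y) * G y \<partial>lborel) = (\<integral>\<^sup>+y. f y * G (y - \<phi> x) \<partial>lborel)"
        by (simp add: add.commute)
    qed
    also have "\<dots> = (\<integral>\<^sup>+y. \<integral>\<^sup>+x. f y * G (y - \<phi> x) \<partial>lborel \<partial>lborel)"
      by (rule lborel_pair.Fubini'[symmetric, where f="\<lambda>x y. f y * G (y - \<phi> x)"]) measurable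
    also have "\<dots> = (\<integral>\<^sup>+y. f y * ennreal c \<partial>lborel)"
    proof (rule nn_integral_cong)
      fix y
      have "(\<integral>\<^sup>+x. G (y - \<phi> x) \<partial>lborel) = (\<integral>\<^sup>+x. G (y - \<phi> (x + \<psi> y)) \<partial>lborel)"
        by (rule nn_integral_translate[symmetric]) measurable
      also have "\<dots> = (\<integral>\<^sup>+x. indicator C x \<partial>lborel)"
        by (intro nn_integral_cong) (auto simp: G_def C_def indicator_def linear_add[OF \<phi>] inv)
      also have "\<dots> = ennreal c" using C c by simp
      finally show "(\<integral>\<^sup>+x. f y * G (y - \<phi> x) \<partial>lborel) = f y * ennreal c" by (simp add: nn_integral_cmult)
    qed
    also have "\<dots> = ennreal c * (\<integral>\<^sup>+y. f y \<partial>lborel)"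
      by (subst nn_integral_multc) (simp_all add: mult.commute)
    finally show ?thesis .
  qed
  have "lborel = density (distr lborel borel \<phi>) (\<lambda>_. ennreal (a / c))"
  proof (rule measure_eqI)
    fix A :: "'a set" assume "A \<in> sets lborel"
    then have A [measurable]: "A \<in> sets borel" by simp
    have "emeasure (density (distr lborel borel \<phi>) (\<lambda>_. ennreal (a / c))) A = ennreal (a / c) * (\<integral>\<^sup>+x. indicator A (\<phi> x) \<partial>lborel)"
    proof -
      have "emeasure (distr lborel borel \<phi>) A = (\<integral>\<^sup>+x. indicator A x \<partial>distr lborel borel \<phi>)" by simp
      also have "\<dots> = (\<integral>\<^sup>+x. indicator A (\<phi> x) \<partial>lborel)" by (rule nn_integral_distr) auto
      finally show ?thesis by (subst emeasure_density) (auto simp: nn_integral_cmult)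
    qed
    also have "\<dots> = ennreal (1 / c) * ((\<integral>\<^sup>+x. indicator A (\<phi> x) \<partial>lborel) * ennreal a)"
      using a(2) c(2) by (simp add: divide_inverse ennreal_mult mult_ac)
    also have "\<dots> = ennreal (1 / c) * ennreal c * emeasure lborel A"
      by (subst key) (auto simp: mult.assoc)
    also have "ennreal (1 / c) * ennreal c = 1" using c(2) by (simp flip: ennreal_mult)
    finally show "emeasure lborel A = emeasure (density (distr lborel borel \<phi>) (\<lambda>_. ennreal (a / c))) A" by simp
  qed simp
  then show ?thesis using a(2) c(2) by (intro exI[of _ "a / c"]) (simp add: scales_lborel_def)
qed

section \<open>The Plancherel theorem\<close>

text \<open>The form in which density is used: an operator is determined by what it does to the modulations of
  one function.\<close>

lemma L2_map_ext:
  fixes A B :: "'a::euclidean_space L2 \<Rightarrow> 'b::real_normed_vector"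
  assumes g: "sqint g" "\<And>x. g x \<noteq> 0"
    and A: "bounded_linear A" and B: "bounded_linear B"
    and eq: "\<And>c w. A (scaleC_L2 c (toL2 (\<lambda>x. modul w x * g x))) = B (scaleC_L2 c (toL2 (\<lambda>x. modul w x * g x)))"
  shows "A u = B u"
proof -
  interpret modulation_span g using g by unfold_locales
  let ?S = "range (\<lambda>w. toL2 (\<lambda>x. modul w x * g x))"
  have span: "A v = B v" if "v \<in> cL2.span ?S" for v
    using that
  proof (induction rule: cL2.span_induct_alt)
    case base show ?case using A B by (simp add: linear_0 bounded_linear.linear)
  next
    case (step c x y)
    then show ?case using eq by (auto simp: linear_add[OF bounded_linear.linear] A B)
  qed
  have "u \<in> closure (cL2.span ?S)" using modulations_dense by (simp add: mod_closure_def)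
  then obtain X where X: "\<And>n. X n \<in> cL2.span ?S" "X \<longlonglongrightarrow> u" by (auto simp: closure_sequential)
  have "(\<lambda>n. A (X n)) \<longlonglongrightarrow> A u" "(\<lambda>n. B (X n)) \<longlonglongrightarrow> B u"
    by (intro bounded_linear.tendsto[OF A] bounded_linear.tendsto[OF B] X)+
  then show ?thesis using span[OF X(1)] LIMSEQ_unique by simp
qed

abbreviation wave_packet_phase :: "'a::euclidean_space \<Rightarrow> 'a \<Rightarrow> 'a \<Rightarrow> complex" where
  "wave_packet_phase s t x \<equiv> of_real (s \<bullet> x) + \<i> * of_real (t \<bullet> x)"

text \<open>The standard Gaussian shifted by \<open>s\<close> and modulated by \<open>t\<close>, up to a factor. This two-parameter
  family is stable under the Fourier transform, in any Euclidean space, and the Plancherel theorem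
  is derived from it.\<close>

definition wave_packet :: "'a::euclidean_space \<Rightarrow> 'a \<Rightarrow> 'a \<Rightarrow> complex" where
  "wave_packet s t = quad_gauss (\<lambda>x y. of_real (x \<bullet> y)) (wave_packet_phase s t)"

lemma bounded_bilinear_inner_complex: "bounded_bilinear (\<lambda>x y. complex_of_real (x \<bullet> y))"
  by (rule bounded_bilinear.intro)
     (auto simp: inner_add_left inner_add_right scaleR_conv_of_real intro!: exI[of _ 1] Cauchy_Schwarz_ineq2)

interpretation std: coercive_form "\<lambda>x y::'a::euclidean_space. complex_of_real (x \<bullet> y)" 1
  by (intro coercive_form.intro bounded_bilinear_inner_complex)
     (simp_all add: inner_commute power2_norm_eq_inner)

lemma bl_wave_packet_phase: "bounded_linear (wave_packet_phase s t)"
  by (intro bounded_linear_add bounded_linear_const_mult bounded_linear_compose[OF bounded_linear_of_real] bounded_linear_inner_right)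

lemma integrable_wave_packet: "integrable lborel (wave_packet s t)" and sqint_wave_packet: "sqint (wave_packet s t)"
  unfolding wave_packet_def by (intro std.integrable_gauss std.sqint_gauss bl_wave_packet_phase)+

definition wave_packet_const :: "'a::euclidean_space \<Rightarrow> 'a \<Rightarrow> complex" where
  "wave_packet_const s t = exp (of_real pi * (of_real (s \<bullet> s) - of_real (t \<bullet> t) + 2 * \<i> * of_real (s \<bullet> t)))"

lemma fourier_wave_packet: "fourier (wave_packet s t) \<xi> = wave_packet_const s t * wave_packet t (- s) \<xi>"
proof -
  have "fourier (wave_packet s t) \<xi> = (LINT x|lborel. quad_gauss (\<lambda>x y. of_real (x \<bullet> y)) (wave_packet_phase s (t - \<xi>)) x)"
    unfolding fourier_def wave_packet_def quad_gauss_def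
    by (intro Bochner_Integration.integral_cong refl) (simp add: inner_diff_left algebra_simps flip: exp_add)
  also have "\<dots> = exp (of_real pi * (of_real (s \<bullet> s) - of_real ((t - \<xi>) \<bullet> (t - \<xi>)) + 2 * \<i> * of_real (s \<bullet> (t - \<xi>))))
      * (LINT x|lborel. quad_gauss (\<lambda>x y. of_real (x \<bullet> y)) (\<lambda>x. 0) (x::'a))"
    by (rule std.gauss_integral)
  also have "(LINT x|lborel. quad_gauss (\<lambda>x y. of_real (x \<bullet> y)) (\<lambda>x. 0) (x::'a)) = 1"
  proof -
    have "quad_gauss (\<lambda>x y. of_real (x \<bullet> y)) (\<lambda>x. 0) x = of_real (exp (- (pi * (norm x)\<^sup>2)))" for x :: 'a
      by (simp add: quad_gauss_def power2_norm_eq_inner exp_of_real[symmetric] del: exp_of_real)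
    then show ?thesis by (simp add: gaussian_integral_norm(2)[OF zero_less_one] integral_complex_of_real del: of_real_exp exp_of_real)
  qed
  also have "exp (of_real pi * (of_real (s \<bullet> s) - of_real ((t - \<xi>) \<bullet> (t - \<xi>)) + 2 * \<i> * of_real (s \<bullet> (t - \<xi>)))) * 1
      = wave_packet_const s t * wave_packet t (- s) \<xi>"
    unfolding wave_packet_const_def wave_packet_def quad_gauss_def exp_add[symmetric] mult_1_right
    by (rule arg_cong[where f=exp]) (simp add: inner_diff_left inner_diff_right inner_commute algebra_simps)
  finally show ?thesis .
qed

lemma wave_packet_const_inverse: "wave_packet_const s t * wave_packet_const t (- s) = 1"
  by (simp add: wave_packet_const_def inner_commute algebra_simps flip: exp_add)

lemma fourier_measurable [measurable]:
  assumes [measurable]: "f \<in> borel_measurable borel"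
  shows "fourier f \<in> borel_measurable borel"
  unfolding fourier_def by measurable

lemma integrable_fourier_kernel:
  assumes f: "integrable lborel f"
  shows "integrable lborel (\<lambda>x. f x * exp (- 2 * of_real pi * \<i> * of_real (\<eta> \<bullet> x)))"
proof -
  have [measurable]: "f \<in> borel_measurable borel" using borel_measurable_integrable[OF f] by simp
  show ?thesis
    by (rule Bochner_Integration.integrable_bound[OF f]) (auto simp: norm_mult norm_exp_eq_Re)
qed

lemma fourier_bound:
  assumes f: "integrable lborel f"
  shows "cmod (fourier f \<eta>) \<le> (LINT x|lborel. cmod (f x))"
  unfolding fourier_def
  by (rule order.trans[OF integral_norm_bound]) (simp add: norm_mult norm_exp_eq_Re)

lemma fourier_add: "integrable lborel f \<Longrightarrow> integrable lborel g \<Longrightarrow>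
    fourier (\<lambda>x. f x + g x) \<eta> = fourier f \<eta> + fourier g \<eta>"
  unfolding fourier_def distrib_right
  by (rule Bochner_Integration.integral_add) (rule integrable_fourier_kernel, assumption)+

lemma fourier_diff: "integrable lborel f \<Longrightarrow> integrable lborel g \<Longrightarrow>
    fourier (\<lambda>x. f x - g x) \<eta> = fourier f \<eta> - fourier g \<eta>"
  unfolding fourier_def left_diff_distrib
  by (rule Bochner_Integration.integral_diff) (rule integrable_fourier_kernel, assumption)+

lemma fourier_scale: "fourier (\<lambda>x. c * f x) \<eta> = c * fourier f \<eta>"
  unfolding fourier_def by (simp add: mult.assoc)

lemma fourier_cong_AE:
  assumes "f \<in> borel_measurable borel" "g \<in> borel_measurable borel" "AE x in lborel. f x = g x"
  shows "fourier f \<eta> = fourier g \<eta>"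
proof -
  note [measurable] = assms(1,2)
  show ?thesis
    unfolding fourier_def by (rule integral_cong_AE) (use assms(3) in \<open>auto elim: eventually_mono\<close>)
qed

text \<open>Fubini, as the kernel is symmetric.\<close>

lemma fourier_multiplication:
  assumes f: "integrable lborel f" and h: "integrable lborel h"
  shows "(LINT \<eta>|lborel. fourier f \<eta> * h \<eta>) = (LINT x|lborel. f x * fourier h x)"
proof -
  let ?k = "\<lambda>x y. exp (- 2 * of_real pi * \<i> * of_real (y \<bullet> x)) :: complex"
  have [measurable]: "f \<in> borel_measurable borel" "h \<in> borel_measurable borel"
    using borel_measurable_integrable[OF f] borel_measurable_integrable[OF h] by auto
  have int: "integrable (lborel \<Otimes>\<^sub>M lborel) (\<lambda>(x, y). f x * h y * ?k x y)"
  proof (rule lborel_pair.Fubini_integrable)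
    show "(\<lambda>(x, y). f x * h y * ?k x y) \<in> borel_measurable (lborel \<Otimes>\<^sub>M lborel)" by measurable
    have n: "cmod (f x * h y * ?k x y) = cmod (f x) * cmod (h y)" for x y
      by (simp add: norm_mult norm_exp_eq_Re)
    have "integrable lborel (\<lambda>x. cmod (f x) * (LINT y|lborel. cmod (h y)))"
      using f by (intro integrable_mult_left integrable_norm)
    then show "integrable lborel (\<lambda>x. LINT y|lborel. norm (case (x, y) of (x, y) \<Rightarrow> f x * h y * ?k x y))"
      by (simp only: prod.case n integral_mult_right_zero)
    have "integrable lborel (\<lambda>y. f x * h y * ?k x y)" for x
      by (rule Bochner_Integration.integrable_bound[OF integrable_mult_right[OF h, of "f x"]])
         (auto simp: norm_mult norm_exp_eq_Re)
    then show "AE x in lborel. integrable lborel (\<lambda>y. case (x, y) of (x, y) \<Rightarrow> f x * h y * ?k x y)"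
      by simp
  qed
  have "(LINT y|lborel. LINT x|lborel. f x * h y * ?k x y) = (LINT x|lborel. LINT y|lborel. f x * h y * ?k x y)"
    using lborel_pair.Fubini_integral[OF int] .
  moreover have "(LINT x|lborel. f x * h y * ?k x y) = fourier f y * h y" for y
    unfolding fourier_def by (simp add: mult_ac flip: integral_mult_right_zero)
  moreover have "(LINT y|lborel. f x * h y * ?k x y) = f x * fourier h x" for x
    unfolding fourier_def by (simp add: mult_ac inner_commute flip: integral_mult_right_zero)
  ultimately show ?thesis by simp
qed

text \<open>For these functions Fourier inversion, in the conjugated form of the last conjunct, is an
  identity of integrals. Together with \<open>fourier_multiplication\<close> it says at once that the Fourier
  transform is isometric. All conditions are preserved by linear combinations, so they pass
  from wave packets to their span.\<close>

definition plancherel_core :: "('a::euclidean_space \<Rightarrow> complex) \<Rightarrow> bool" where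
  "plancherel_core f \<longleftrightarrow> integrable lborel f \<and> sqint f \<and> integrable lborel (fourier f)
     \<and> sqint (fourier f) \<and> (\<forall>x. fourier (\<lambda>\<xi>. cnj (fourier f \<xi>)) x = cnj (f x))"

lemma plancherel_core_wave_packet: "plancherel_core (wave_packet s t)"
proof -
  have 1: "fourier (wave_packet s t) = (\<lambda>\<xi>. wave_packet_const s t * wave_packet t (- s) \<xi>)" by (simp add: fourier_wave_packet fun_eq_iff)
  have 2: "cnj (wave_packet s t x) = wave_packet s (- t) x" for s t x :: 'a
    by (simp add: wave_packet_def quad_gauss_def exp_cnj)
  have 3: "cnj (wave_packet_const s t) = wave_packet_const s (- t)"
    by (simp add: wave_packet_const_def exp_cnj)
  have 4: "wave_packet_const s (- t) * wave_packet_const t s = 1"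
    using wave_packet_const_inverse[of t s] wave_packet_const_inverse[of s "-t"] by (simp add: wave_packet_const_def flip: exp_add)
  have "fourier (\<lambda>\<xi>. cnj (fourier (wave_packet s t) \<xi>)) x = cnj (wave_packet s t x)" for x
    using 4 by (simp add: 1 2 3 fourier_scale fourier_wave_packet)
  then show ?thesis
    by (auto simp: plancherel_core_def integrable_wave_packet sqint_wave_packet 1 sqint_scale)
qed

lemma plancherel_core_add:
  assumes "plancherel_core f" "plancherel_core g"
  shows "plancherel_core (\<lambda>x. f x + g x)"
proof -
  have F: "fourier (\<lambda>x. f x + g x) = (\<lambda>\<xi>. fourier f \<xi> + fourier g \<xi>)"
    using assms by (auto simp: plancherel_core_def fourier_add)
  show ?thesis using assms
    by (auto simp: plancherel_core_def F sqint_add fourier_add)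
qed

lemma plancherel_core_scale:
  assumes "plancherel_core f"
  shows "plancherel_core (\<lambda>x. c * f x)"
proof -
  have F: "fourier (\<lambda>x. c * f x) = (\<lambda>\<xi>. c * fourier f \<xi>)"
    by (auto simp: fourier_scale)
  show ?thesis using assms
    by (auto simp: plancherel_core_def F sqint_scale fourier_scale)
qed

lemma norm_toL2_complex:
  assumes "sqint f"
  shows "of_real ((norm (toL2 f))\<^sup>2) = (LINT x|lborel. f x * cnj (f x))"
  unfolding norm_toL2[OF assms] complex_norm_square[symmetric] integral_complex_of_real ..

lemma plancherel_core_norm:
  assumes f: "plancherel_core f"
  shows "norm (toL2 (fourier f)) = norm (toL2 f)"
proof -
  have "complex_of_real ((norm (toL2 (fourier f)))\<^sup>2) = (LINT x|lborel. fourier f x * cnj (fourier f x))"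
    using f by (intro norm_toL2_complex[symmetric] norm_toL2_complex) (simp add: plancherel_core_def)
  also have "\<dots> = (LINT x|lborel. f x * fourier (\<lambda>\<xi>. cnj (fourier f \<xi>)) x)"
    using f by (intro fourier_multiplication) (auto simp: plancherel_core_def)
  also have "\<dots> = (LINT x|lborel. f x * cnj (f x))"
    using f by (simp add: plancherel_core_def)
  also have "\<dots> = complex_of_real ((norm (toL2 f))\<^sup>2)"
    using f by (intro norm_toL2_complex[symmetric] norm_toL2_complex) (simp add: plancherel_core_def)
  finally show ?thesis by (simp only: of_real_eq_iff) simp
qed

lemma modul_gauss_eq_wave_packet: "modul w x * wave_packet 0 0 x = wave_packet 0 w x"
  by (simp add: modul_def wave_packet_def quad_gauss_def flip: exp_add) (simp add: algebra_simps)

lemma wave_packet_nonzero: "wave_packet s t x \<noteq> 0"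
  by (simp add: wave_packet_def quad_gauss_def)

lemma plancherel_core_dense: "\<exists>f. (\<forall>n. plancherel_core (f n)) \<and> (\<lambda>n. toL2 (f n)) \<longlonglongrightarrow> (u :: 'a::euclidean_space L2)"
proof -
  interpret modulation_span "wave_packet (0::'a) 0" by unfold_locales (auto simp: sqint_wave_packet wave_packet_nonzero)
  let ?S = "range (\<lambda>w. toL2 (\<lambda>x. modul w x * wave_packet (0::'a) 0 x))"
  have core: "\<exists>f. plancherel_core f \<and> v = toL2 f" if "v \<in> cL2.span ?S" for v
    using that
  proof (induction rule: cL2.span_induct_alt)
    case base
    have "plancherel_core (\<lambda>x::'a. 0)" using plancherel_core_scale[OF plancherel_core_wave_packet, of 0] by simp
    then show ?case using toL2_zero by blast
  next
    case (step c x y)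
    then obtain w f where w: "x = toL2 (wave_packet 0 w)" and f: "plancherel_core f" "y = toL2 f"
      by (auto simp: modul_gauss_eq_wave_packet)
    have "plancherel_core (\<lambda>x. c * wave_packet 0 w x + f x)" by (intro plancherel_core_add plancherel_core_scale plancherel_core_wave_packet f)
    moreover have "scaleC_L2 c x + y = toL2 (\<lambda>x. c * wave_packet 0 w x + f x)"
      using f by (simp add: w toL2_scaleC toL2_add sqint_wave_packet sqint_scale plancherel_core_def)
    ultimately show ?case by blast
  qed
  have "u \<in> closure (cL2.span ?S)" using modulations_dense by (simp add: mod_closure_def)
  then obtain X where X: "\<And>n. X n \<in> cL2.span ?S" "X \<longlonglongrightarrow> u" by (auto simp: closure_sequential)
  from core[OF X(1)] obtain f where "\<And>n. plancherel_core (f n)" "\<And>n. X n = toL2 (f n)" by metis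
  moreover from this have "X = (\<lambda>n. toL2 (f n))" by auto
  ultimately show ?thesis using X(2) by (intro exI[of _ f]) auto
qed

lemma tendsto_pairing:
  assumes "\<And>n. sqint (s n)" "sqint f" "sqint h" "(\<lambda>n. toL2 (s n)) \<longlonglongrightarrow> toL2 f"
  shows "(\<lambda>n. LINT x|lborel. s n x * h x) \<longlonglongrightarrow> (LINT x|lborel. f x * h x)"
proof (rule Lim_null_comparison[THEN Lim_null[THEN iffD2]])
  show "(\<lambda>n. norm (toL2 (s n) - toL2 f) * norm (toL2 h)) \<longlonglongrightarrow> 0"
    using assms(4) by (intro tendsto_mult_left_zero tendsto_norm_zero) (simp add: LIM_zero)
  show "\<forall>\<^sub>F n in sequentially. norm ((LINT x|lborel. s n x * h x) - (LINT x|lborel. f x * h x))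
      \<le> norm (toL2 (s n) - toL2 f) * norm (toL2 h)"
  proof (rule always_eventually, rule allI)
    fix n
    have "(LINT x|lborel. s n x * h x) - (LINT x|lborel. f x * h x) = (LINT x|lborel. (s n x - f x) * h x)"
      unfolding left_diff_distrib by (rule Bochner_Integration.integral_diff[symmetric]) (intro sqint_mult_integrable assms)+
    then show "norm ((LINT x|lborel. s n x * h x) - (LINT x|lborel. f x * h x)) \<le> norm (toL2 (s n) - toL2 f) * norm (toL2 h)"
      using Cauchy_Schwarz_L2[of "\<lambda>x. s n x - f x" h] by (simp add: assms sqint_diff toL2_diff)
  qed
qed

text \<open>The pairing with \<open>k\<close> is a continuous functional, so by density it vanishes everywhere, in
  particular at the conjugate of \<open>k\<close>.\<close>

lemma AE_zero_of_modulations: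
  assumes k: "sqint k" and g: "sqint g" "\<And>x. g x \<noteq> 0"
    and zero: "\<And>w. (LINT x|lborel. k x * (modul w x * g x)) = 0"
  shows "AE x in lborel. k x = 0"
proof -
  have add: "(LINT x|lborel. k x * fromL2 (u + v) x) = (LINT x|lborel. k x * fromL2 u x) + (LINT x|lborel. k x * fromL2 v x)" for u v
  proof -
    have ae: "AE x in lborel. fromL2 (u + v) x = fromL2 u x + fromL2 v x"
      using AE_fromL2_toL2[of "\<lambda>x. fromL2 u x + fromL2 v x"] by (simp add: sqint_add flip: toL2_add)
    have [measurable]: "fromL2 w \<in> borel_measurable borel" for w :: "'a L2"
      using sqint_measurable[OF sqint_fromL2, of w] by simp
    have [measurable]: "k \<in> borel_measurable borel" using sqint_measurable[OF k] by simp
    have "(LINT x|lborel. k x * fromL2 (u + v) x) = (LINT x|lborel. k x * fromL2 u x + k x * fromL2 v x)"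
      by (rule integral_cong_AE) (use ae in \<open>auto simp: distrib_left elim: eventually_mono\<close>)
    also have "\<dots> = (LINT x|lborel. k x * fromL2 u x) + (LINT x|lborel. k x * fromL2 v x)"
      by (rule Bochner_Integration.integral_add) (intro sqint_mult_integrable k sqint_fromL2)+
    finally show ?thesis .
  qed
  have pair_toL2: "(LINT x|lborel. k x * fromL2 (toL2 f) x) = (LINT x|lborel. k x * f x)" if f: "sqint f" for f
  proof -
    have [measurable]: "fromL2 (toL2 f) \<in> borel_measurable borel" "f \<in> borel_measurable borel" "k \<in> borel_measurable borel"
      using sqint_measurable[OF sqint_fromL2, of "toL2 f"] sqint_measurable[OF f] sqint_measurable[OF k] by auto
    show ?thesis by (rule integral_cong_AE) (use AE_fromL2_toL2[OF f] in \<open>auto elim: eventually_mono\<close>)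
  qed
  have scale: "(LINT x|lborel. k x * fromL2 (scaleC_L2 c u) x) = c * (LINT x|lborel. k x * fromL2 u x)" for c u
  proof -
    have "(LINT x|lborel. k x * fromL2 (scaleC_L2 c u) x) = (LINT x|lborel. k x * (c * fromL2 u x))"
      using pair_toL2[OF sqint_scale[OF sqint_fromL2], of c u] by (simp flip: toL2_scaleC)
    then show ?thesis by (simp add: mult.left_commute)
  qed
  have bl: "bounded_linear (\<lambda>u. LINT x|lborel. k x * fromL2 u x)"
    by (rule bounded_linear_intro[where K="norm (toL2 k)"])
       (use Cauchy_Schwarz_L2[OF k sqint_fromL2] in \<open>auto simp: add scale scaleR_eq_scaleC mult.commute scaleR_conv_of_real\<close>)
  have "(LINT x|lborel. k x * fromL2 u x) = 0" for u
    by (rule L2_map_ext[OF g bl bounded_linear_zero])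
       (use zero in \<open>simp add: scale pair_toL2 bdd_mult_sqint g(1)\<close>)
  from this[of "toL2 (\<lambda>x. cnj (k x))"] have "(LINT x|lborel. k x * cnj (k x)) = 0"
    by (simp add: pair_toL2 sqint_cnj k)
  then have "complex_of_real ((norm (toL2 k))\<^sup>2) = 0"
    by (simp only: norm_toL2_complex[OF k])
  then have "toL2 k = 0" by simp
  then show ?thesis unfolding toL2_zero using k by (subst (asm) toL2_eq_iff) (auto simp: sqint_zero)
qed

lemma bounded_bilinear_scaled_inner: "bounded_bilinear (\<lambda>x y. a * complex_of_real (x \<bullet> y))"
proof (rule bounded_bilinear.intro)
  show "\<exists>K. \<forall>x y::'a. cmod (a * complex_of_real (x \<bullet> y)) \<le> norm x * norm y * K"
    by (auto simp: norm_mult mult.commute[of _ "cmod a"] intro!: exI[of _ "cmod a"] mult_left_mono Cauchy_Schwarz_ineq2)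
qed (auto simp: inner_add_left inner_add_right scaleR_conv_of_real algebra_simps)

text \<open>Approximate \<open>f\<close> by core functions. Their transforms form a Cauchy sequence with a limit \<open>v\<close> in
  \<open>L\<^sup>2\<close>, and it remains to identify \<open>v\<close> with the Fourier integral of \<open>f\<close>. By
  \<open>fourier_multiplication\<close> both have the same integral against every modulated standard Gaussian.
  The Fourier integral is so far only known to be bounded; the standard Gaussian is therefore split
  into two equal factors, one of which makes the difference square-integrable while the other one
  serves as test function.\<close>

theorem plancherel:
  assumes f: "integrable lborel f" "sqint f"
  shows "sqint (fourier f)" "norm (toL2 (fourier f)) = norm (toL2 f)"
proof -
  obtain s where s: "\<And>n. plancherel_core (s n)" "(\<lambda>n. toL2 (s n)) \<longlonglongrightarrow> toL2 f"
    using plancherel_core_dense by blast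
  have core: "integrable lborel (s n)" "sqint (s n)" "sqint (fourier (s n))" for n
    using s(1)[of n] by (auto simp: plancherel_core_def)
  have diff: "norm (toL2 (fourier (s m)) - toL2 (fourier (s n))) = norm (toL2 (s m) - toL2 (s n))" for m n
  proof -
    have "plancherel_core (\<lambda>x. s m x + (-1) * s n x)"
      by (rule plancherel_core_add[OF s(1) plancherel_core_scale[OF s(1)]])
    then have c: "plancherel_core (\<lambda>x. s m x - s n x)" by simp
    have "fourier (\<lambda>x. s m x - s n x) = (\<lambda>\<xi>. fourier (s m) \<xi> - fourier (s n) \<xi>)"
      by (intro ext fourier_diff core)
    with plancherel_core_norm[OF c] show ?thesis by (simp add: toL2_diff core)
  qed
  have "Cauchy (\<lambda>n. toL2 (s n))" by (rule LIMSEQ_imp_Cauchy[OF s(2)])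
  then have "Cauchy (\<lambda>n. toL2 (fourier (s n)))"
    by (simp add: Cauchy_iff diff)
  then obtain v where v: "(\<lambda>n. toL2 (fourier (s n))) \<longlonglongrightarrow> v"
    by (auto simp: Cauchy_convergent_iff convergent_def)
  have [measurable]: "f \<in> borel_measurable borel" using sqint_measurable[OF f(2)] by simp
  have [measurable]: "fromL2 v \<in> borel_measurable borel" using sqint_measurable[OF sqint_fromL2, of v] by simp
  let ?k = "\<lambda>x. fromL2 v x - fourier f x"
  \<comment> \<open>the square root of the standard Gaussian\<close>
  let ?g = "quad_gauss (\<lambda>x y::'a. (1/2) * complex_of_real (x \<bullet> y)) (\<lambda>x. 0)"
  interpret half: coercive_form "\<lambda>x y::'a. (1/2) * complex_of_real (x \<bullet> y)" "1/2"
    by (intro coercive_form.intro bounded_bilinear_scaled_inner)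
       (simp_all add: inner_commute power2_norm_eq_inner)
  have g: "sqint ?g" and gi: "integrable lborel ?g"
    by (intro half.sqint_gauss half.integrable_gauss bounded_linear_zero)+
  have [measurable]: "?g \<in> borel_measurable borel" by (rule half.measurable_gauss[OF bounded_linear_zero])
  have gb: "cmod (?g x) \<le> 1" for x by (simp add: quad_gauss_def norm_exp_eq_Re)
  have g2: "?g x * ?g x = wave_packet 0 0 x" for x
    by (simp add: quad_gauss_def wave_packet_def flip: exp_add)
  have sk: "sqint (\<lambda>x. ?k x * ?g x)"
  proof -
    have "sqint (\<lambda>x. ?g x * fromL2 v x)"
      by (rule sqint_mult_bounded[OF sqint_fromL2 _ gb]) measurable
    moreover have "sqint (\<lambda>x. fourier f x * ?g x)"
      by (rule sqint_mult_bounded[OF g _ fourier_bound[OF f(1)]]) measurable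
    ultimately show ?thesis
      using sqint_diff[of "\<lambda>x. ?g x * fromL2 v x" "\<lambda>x. fourier f x * ?g x"] by (simp add: algebra_simps)
  qed
  have "(LINT x|lborel. (?k x * ?g x) * (modul w x * ?g x)) = 0" for w
  proof -
    have h: "sqint (wave_packet 0 w)" "integrable lborel (wave_packet 0 w)" by (rule sqint_wave_packet integrable_wave_packet)+
    have Fh: "sqint (fourier (wave_packet 0 w))" using plancherel_core_wave_packet by (auto simp: plancherel_core_def)
    have "(\<lambda>n. LINT x|lborel. fourier (s n) x * wave_packet 0 w x) \<longlonglongrightarrow> (LINT x|lborel. fromL2 v x * wave_packet 0 w x)"
      using v by (intro tendsto_pairing core h sqint_fromL2) simp
    moreover have "(\<lambda>n. LINT x|lborel. s n x * fourier (wave_packet 0 w) x) \<longlonglongrightarrow> (LINT x|lborel. f x * fourier (wave_packet 0 w) x)"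
      by (intro tendsto_pairing core Fh f s)
    ultimately have "(LINT x|lborel. fromL2 v x * wave_packet 0 w x) = (LINT x|lborel. f x * fourier (wave_packet 0 w) x)"
      using LIMSEQ_unique by (simp add: fourier_multiplication core h)
    then have eq: "(LINT x|lborel. fromL2 v x * wave_packet 0 w x) = (LINT x|lborel. fourier f x * wave_packet 0 w x)"
      by (simp add: fourier_multiplication f h)
    have "integrable lborel (\<lambda>x. fourier f x * wave_packet 0 w x)"
    proof (rule Bochner_Integration.integrable_bound)
      show "integrable lborel (\<lambda>x. of_real (LINT x|lborel. cmod (f x)) * wave_packet 0 w x)"
        by (intro integrable_mult_right h)
      have [measurable]: "wave_packet 0 w \<in> borel_measurable borel" using sqint_measurable[OF h(1)] by simp
      show "(\<lambda>x. fourier f x * wave_packet 0 w x) \<in> borel_measurable lborel" by measurable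
      show "AE x in lborel. norm (fourier f x * wave_packet 0 w x) \<le> norm (of_real (LINT x|lborel. cmod (f x)) * wave_packet 0 w x)"
        unfolding norm_mult norm_of_real
        by (intro AE_I2 mult_right_mono order.trans[OF fourier_bound[OF f(1)] abs_ge_self]) auto
    qed
    then have "(LINT x|lborel. fromL2 v x * wave_packet 0 w x - fourier f x * wave_packet 0 w x) = 0"
      using eq by (subst Bochner_Integration.integral_diff) (auto intro: sqint_mult_integrable h)
    moreover have "(?k x * ?g x) * (modul w x * ?g x) = fromL2 v x * wave_packet 0 w x - fourier f x * wave_packet 0 w x" for x
    proof -
      have "(?k x * ?g x) * (modul w x * ?g x) = ?k x * (modul w x * (?g x * ?g x))" by (simp only: mult_ac)
      also have "\<dots> = fromL2 v x * wave_packet 0 w x - fourier f x * wave_packet 0 w x"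
        unfolding g2 modul_gauss_eq_wave_packet by (simp add: left_diff_distrib)
      finally show ?thesis .
    qed
    ultimately show ?thesis by simp
  qed
  then have "AE x in lborel. ?k x * ?g x = 0"
    by (intro AE_zero_of_modulations[OF sk g]) (auto simp: quad_gauss_def)
  then have ae: "AE x in lborel. fromL2 v x = fourier f x"
    by eventually_elim (simp add: quad_gauss_def)
  show "sqint (fourier f)" by (rule toL2_cong_AE(1)[OF sqint_fromL2 _ ae]) measurable
  have "toL2 (fourier f) = v"
    using toL2_cong_AE(2)[OF sqint_fromL2 _ ae] by simp
  moreover have "(\<lambda>n. norm (toL2 (fourier (s n)))) \<longlonglongrightarrow> norm v" by (intro tendsto_norm v)
  moreover have "(\<lambda>n. norm (toL2 (fourier (s n)))) \<longlonglongrightarrow> norm (toL2 f)"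
    using tendsto_norm[OF s(2)] by (simp add: plancherel_core_norm[OF s(1)])
  ultimately show "norm (toL2 (fourier f)) = norm (toL2 f)" using LIMSEQ_unique by blast
qed

text \<open>The truncation in the definition of the Fourier--Plancherel operator.\<close>

definition ball_cutoff :: "nat \<Rightarrow> ('a::euclidean_space \<Rightarrow> complex) \<Rightarrow> 'a \<Rightarrow> complex" where
  "ball_cutoff n f x = indicator (cball 0 (real n)) x * f x"

lemma ball_cutoff_props:
  assumes f: "sqint f"
  shows "integrable lborel (ball_cutoff n f)" "sqint (ball_cutoff n f)" "(\<lambda>n. toL2 (ball_cutoff n f)) \<longlonglongrightarrow> toL2 f"
proof -
  have [measurable]: "f \<in> borel_measurable borel" using sqint_measurable[OF f] by simp
  have "integrable lborel (\<lambda>x::'a. indicator (cball 0 (real n)) x :: real)"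
    by (subst integrable_indicator_iff) (use emeasure_bounded_finite[of "cball (0::'a) (real n)"] in auto)
  moreover have "(cmod (indicator A x))\<^sup>2 = indicator A x" for A and x :: 'a by (auto simp: indicator_def)
  moreover have "(indicator (cball 0 (real n)) :: 'a \<Rightarrow> complex) \<in> borel_measurable borel"
    by (rule borel_measurable_indicator) simp
  ultimately have "sqint (indicator (cball (0::'a) (real n)))" by (simp add: sqint_def)
  then show "integrable lborel (ball_cutoff n f)" unfolding ball_cutoff_def by (rule sqint_mult_integrable[OF _ f])
  show s: "sqint (ball_cutoff n f)" for n unfolding ball_cutoff_def
    by (rule sqint_mult_bounded[OF f, where C=1]) (auto simp: indicator_def)
  show "(\<lambda>n. toL2 (ball_cutoff n f)) \<longlonglongrightarrow> toL2 f"
  proof (rule toL2_tendsto_dominated(2)[OF s _ f])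
    show "AE x in lborel. (\<lambda>n. ball_cutoff n f x) \<longlonglongrightarrow> f x"
    proof (rule AE_I2)
      fix x :: 'a
      have "eventually (\<lambda>n. norm x \<le> real n) sequentially" by real_asymp
      then have "eventually (\<lambda>n. ball_cutoff n f x = f x) sequentially"
        by eventually_elim (simp add: ball_cutoff_def)
      then show "(\<lambda>n. ball_cutoff n f x) \<longlonglongrightarrow> f x" by (rule tendsto_eventually)
    qed
    show "AE x in lborel. cmod (ball_cutoff n f x) \<le> cmod (f x)" for n
      by (auto simp: ball_cutoff_def indicator_def)
  qed auto
qed

lemma fourier_diff_norm:
  assumes "integrable lborel f" "sqint f" "integrable lborel g" "sqint g"
  shows "norm (toL2 (fourier f) - toL2 (fourier g)) = norm (toL2 f - toL2 g)"
proof -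
  have "fourier (\<lambda>x. f x - g x) = (\<lambda>\<xi>. fourier f \<xi> - fourier g \<xi>)"
    by (intro ext fourier_diff assms)
  then show ?thesis
    using plancherel(2)[of "\<lambda>x. f x - g x"] assms by (simp add: toL2_diff plancherel(1) sqint_diff)
qed

lemma fourier_ball_cutoff_tendsto:
  assumes "integrable lborel f" "sqint f"
  shows "(\<lambda>n. toL2 (fourier (ball_cutoff n f))) \<longlonglongrightarrow> toL2 (fourier f)"
proof -
  have "(\<lambda>n. norm (toL2 (ball_cutoff n f) - toL2 f)) \<longlonglongrightarrow> 0"
    using ball_cutoff_props(3)[OF assms(2)] by (intro tendsto_norm_zero) (simp add: LIM_zero)
  then have "(\<lambda>n. norm (toL2 (fourier (ball_cutoff n f)) - toL2 (fourier f))) \<longlonglongrightarrow> 0"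
    using assms by (simp add: fourier_diff_norm ball_cutoff_props)
  then show ?thesis by (simp add: tendsto_norm_zero_iff LIM_zero_iff)
qed

lemma fourierL2_limit: "(\<lambda>n. toL2 (fourier (ball_cutoff n (fromL2 u)))) \<longlonglongrightarrow> fourierL2 u"
proof -
  have "Cauchy (\<lambda>n. toL2 (ball_cutoff n (fromL2 u)))"
    using ball_cutoff_props(3)[OF sqint_fromL2, of u] by (rule LIMSEQ_imp_Cauchy)
  then have "Cauchy (\<lambda>n. toL2 (fourier (ball_cutoff n (fromL2 u))))"
    by (simp add: Cauchy_iff fourier_diff_norm ball_cutoff_props)
  then have "convergent (\<lambda>n. toL2 (fourier (ball_cutoff n (fromL2 u))))"
    by (simp add: Cauchy_convergent_iff)
  moreover have "fourierL2 u = lim (\<lambda>n. toL2 (fourier (ball_cutoff n (fromL2 u))))"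
    by (simp add: fourierL2_def ball_cutoff_def[abs_def])
  ultimately show ?thesis by (simp add: convergent_LIMSEQ_iff)
qed

lemma fourier_ball_cutoff_cong_AE:
  assumes "f \<in> borel_measurable borel" "g \<in> borel_measurable borel" "AE x in lborel. f x = g x"
  shows "fourier (ball_cutoff n f) = fourier (ball_cutoff n g)"
proof (intro ext fourier_cong_AE)
  note [measurable] = assms(1,2)
  show "ball_cutoff n f \<in> borel_measurable borel" "ball_cutoff n g \<in> borel_measurable borel"
    unfolding ball_cutoff_def[abs_def] by (intro borel_measurable_times borel_measurable_indicator assms; simp)+
  show "AE x in lborel. ball_cutoff n f x = ball_cutoff n g x"
    using assms(3) by eventually_elim (simp add: ball_cutoff_def)
qed

lemma fourierL2_toL2:
  assumes f: "integrable lborel f" "sqint f"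
  shows "fourierL2 (toL2 f) = toL2 (fourier f)"
proof -
  have [measurable]: "f \<in> borel_measurable borel" "fromL2 (toL2 f) \<in> borel_measurable borel"
    using sqint_measurable[OF f(2)] sqint_measurable[OF sqint_fromL2, of "toL2 f"] by auto
  have "fourier (ball_cutoff n (fromL2 (toL2 f))) = fourier (ball_cutoff n f)" for n
    by (rule fourier_ball_cutoff_cong_AE[OF _ _ AE_fromL2_toL2[OF f(2)]]) measurable
  then have "(\<lambda>n. toL2 (fourier (ball_cutoff n f))) \<longlonglongrightarrow> fourierL2 (toL2 f)"
    using fourierL2_limit[of "toL2 f"] by simp
  with fourier_ball_cutoff_tendsto[OF f] show ?thesis using LIMSEQ_unique by blast
qed

lemma fourierL2_norm: "norm (fourierL2 u) = norm u"
proof -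
  have "(\<lambda>n. norm (toL2 (fourier (ball_cutoff n (fromL2 u))))) \<longlonglongrightarrow> norm (fourierL2 u)"
    by (intro tendsto_norm fourierL2_limit)
  moreover have "(\<lambda>n. norm (toL2 (ball_cutoff n (fromL2 u)))) \<longlonglongrightarrow> norm u"
    using tendsto_norm[OF ball_cutoff_props(3)[OF sqint_fromL2, of u]] by simp
  ultimately show ?thesis
    using LIMSEQ_unique by (simp add: plancherel ball_cutoff_props)
qed

lemma fourierL2_add: "fourierL2 (u + v) = fourierL2 u + fourierL2 v"
proof -
  let ?t = "\<lambda>n. ball_cutoff n (\<lambda>x. fromL2 u x + fromL2 v x)"
  have f: "sqint (\<lambda>x. fromL2 u x + fromL2 v x)" by (simp add: sqint_add)
  have lim: "(\<lambda>n. fourierL2 (toL2 (ball_cutoff n h))) \<longlonglongrightarrow> fourierL2 (toL2 h)" if "sqint h" for h :: "'a \<Rightarrow> complex"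
  proof -
    have [measurable]: "h \<in> borel_measurable borel" "fromL2 (toL2 h) \<in> borel_measurable borel"
      using sqint_measurable[OF that] sqint_measurable[OF sqint_fromL2, of "toL2 h"] by auto
    have "fourier (ball_cutoff n (fromL2 (toL2 h))) = fourier (ball_cutoff n h)" for n
      by (rule fourier_ball_cutoff_cong_AE[OF _ _ AE_fromL2_toL2[OF that]]) measurable
    then show ?thesis
      using fourierL2_limit[of "toL2 h"] that by (simp add: fourierL2_toL2 ball_cutoff_props)
  qed
  have F: "fourier (\<lambda>x. ball_cutoff n (fromL2 u) x + ball_cutoff n (fromL2 v) x)
      = (\<lambda>\<xi>. fourier (ball_cutoff n (fromL2 u)) \<xi> + fourier (ball_cutoff n (fromL2 v)) \<xi>)" for n
    by (intro ext fourier_add ball_cutoff_props sqint_fromL2)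
  have "?t n = (\<lambda>x. ball_cutoff n (fromL2 u) x + ball_cutoff n (fromL2 v) x)" for n
    by (auto simp: ball_cutoff_def distrib_left)
  then have "fourierL2 (toL2 (?t n)) = toL2 (fourier (\<lambda>x. ball_cutoff n (fromL2 u) x + ball_cutoff n (fromL2 v) x))" for n
    by (simp add: fourierL2_toL2 ball_cutoff_props sqint_add)
  also have "\<dots>n = fourierL2 (toL2 (ball_cutoff n (fromL2 u))) + fourierL2 (toL2 (ball_cutoff n (fromL2 v)))" for n
    by (simp add: fourierL2_toL2 ball_cutoff_props sqint_add toL2_add plancherel F)
  finally have "(\<lambda>n. fourierL2 (toL2 (?t n))) \<longlonglongrightarrow> fourierL2 u + fourierL2 v"
    using tendsto_add[OF lim[OF sqint_fromL2, of u] lim[OF sqint_fromL2, of v]] by simp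
  moreover have "(\<lambda>n. fourierL2 (toL2 (?t n))) \<longlonglongrightarrow> fourierL2 (u + v)"
    using lim[OF f] by (simp flip: toL2_add)
  ultimately show ?thesis using LIMSEQ_unique by blast
qed

lemma fourierL2_scaleC: "fourierL2 (scaleC_L2 c u) = scaleC_L2 c (fourierL2 u)"
proof -
  have [measurable]: "fromL2 v \<in> borel_measurable borel" for v :: "'a L2"
    using sqint_measurable[OF sqint_fromL2, of v] by simp
  have ae: "AE x in lborel. fromL2 (scaleC_L2 c u) x = c * fromL2 u x"
    using AE_fromL2_toL2[OF sqint_scale[OF sqint_fromL2, of c u]] by (simp flip: toL2_scaleC)
  have "fourier (ball_cutoff n (fromL2 (scaleC_L2 c u))) = fourier (ball_cutoff n (\<lambda>x. c * fromL2 u x))" for n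
    by (rule fourier_ball_cutoff_cong_AE[OF _ _ ae]) measurable
  moreover have "ball_cutoff n (\<lambda>x. c * fromL2 u x) = (\<lambda>x. c * ball_cutoff n (fromL2 u) x)" for n
    by (auto simp: ball_cutoff_def)
  ultimately have "fourier (ball_cutoff n (fromL2 (scaleC_L2 c u))) = (\<lambda>\<xi>. c * fourier (ball_cutoff n (fromL2 u)) \<xi>)" for n
    by (simp add: fun_eq_iff fourier_scale)
  then have "toL2 (fourier (ball_cutoff n (fromL2 (scaleC_L2 c u)))) = scaleC_L2 c (toL2 (fourier (ball_cutoff n (fromL2 u))))" for n
    by (simp add: toL2_scaleC plancherel ball_cutoff_props)
  then have "(\<lambda>n. scaleC_L2 c (toL2 (fourier (ball_cutoff n (fromL2 u))))) \<longlonglongrightarrow> fourierL2 (scaleC_L2 c u)"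
    using fourierL2_limit[of "scaleC_L2 c u"] by simp
  moreover have "(\<lambda>n. scaleC_L2 c (toL2 (fourier (ball_cutoff n (fromL2 u))))) \<longlonglongrightarrow> scaleC_L2 c (fourierL2 u)"
    by (intro bounded_linear.tendsto[OF bounded_linear_scaleC] fourierL2_limit)
  ultimately show ?thesis using LIMSEQ_unique by blast
qed

lemma bounded_linear_fourierL2: "bounded_linear fourierL2"
  by (rule bounded_linear_intro[where K=1])
     (auto simp: fourierL2_add scaleR_eq_scaleC fourierL2_scaleC fourierL2_norm)

text \<open>Checked on modulated Gaussians, where it says that the constants of two successive transforms
  cancel. It makes the Fourier--Plancherel operator bijective, with its third power as inverse.\<close>

theorem fourierL2_twice: "fourierL2 (fourierL2 u) = compL2 uminus u"
proof (rule L2_map_ext[where g="wave_packet 0 0" and A="\<lambda>u. fourierL2 (fourierL2 u)" and B="compL2 uminus" and u=u])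
  show "bounded_linear (\<lambda>u. fourierL2 (fourierL2 u))"
    by (intro bounded_linear_compose[OF bounded_linear_fourierL2] bounded_linear_fourierL2)
  show "bounded_linear (compL2 uminus)" by (rule bounded_linear_compL2[OF scales_uminus])
  fix c and w :: 'a
  have F: "fourierL2 (toL2 (wave_packet s t)) = scaleC_L2 (wave_packet_const s t) (toL2 (wave_packet t (- s)))" for s t :: 'a
    by (simp add: fourierL2_toL2 integrable_wave_packet sqint_wave_packet fourier_wave_packet[abs_def] toL2_scaleC)
  have "fourierL2 (fourierL2 (toL2 (wave_packet 0 w))) = toL2 (wave_packet 0 (- w))"
    using wave_packet_const_inverse[of 0 w] by (simp add: F fourierL2_scaleC)
  also have "wave_packet 0 (- w) = (\<lambda>x. wave_packet 0 w (- x))" by (simp add: wave_packet_def quad_gauss_def fun_eq_iff)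
  also have "toL2 \<dots> = compL2 uminus (toL2 (wave_packet 0 w))" by (simp add: compL2_toL2[OF scales_uminus] sqint_wave_packet)
  finally show "fourierL2 (fourierL2 (scaleC_L2 c (toL2 (\<lambda>x. modul w x * wave_packet 0 0 x))))
      = compL2 uminus (scaleC_L2 c (toL2 (\<lambda>x. modul w x * wave_packet 0 0 x)))"
    by (simp add: fourierL2_scaleC compL2_scaleC[OF scales_uminus] modul_gauss_eq_wave_packet)
qed (auto simp: sqint_wave_packet wave_packet_nonzero)

lemma compL2_uminus_twice: "compL2 uminus (compL2 uminus u) = (u :: 'a::euclidean_space L2)"
proof -
  obtain f where f: "sqint f" "u = toL2 f" by (metis L2_cases)
  show ?thesis
    by (simp add: f compL2_toL2[OF scales_uminus] scales_sqint[OF scales_uminus])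
qed

section \<open>Complex vectors and matrices\<close>

lemma cdot_commute: "cdot a b = cdot b a"
  by (simp add: cdot_def mult.commute)
lemma cdot_add_left: "cdot (a + b) c = cdot a c + cdot b c"
  by (simp add: cdot_def distrib_right sum.distrib)
lemma cdot_add_right: "cdot a (b + c) = cdot a b + cdot a c"
  by (simp add: cdot_def distrib_left sum.distrib)
lemma cdot_diff_left: "cdot (a - b) c = cdot a c - cdot b c"
  by (simp add: cdot_def left_diff_distrib sum_subtractf)
lemma cdot_diff_right: "cdot a (b - c) = cdot a b - cdot a c"
  by (simp add: cdot_def right_diff_distrib sum_subtractf)
lemma cdot_minus_left: "cdot (- a) c = - cdot a c"
  by (simp add: cdot_def sum_negf)
lemma cdot_minus_right: "cdot a (- c) = - cdot a c"
  by (simp add: cdot_def sum_negf)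
lemma cdot_scale_left: "cdot (k *s a) c = k * cdot a c"
  by (simp add: cdot_def sum_distrib_left mult.assoc)
lemma cdot_scale_right: "cdot a (k *s c) = k * cdot a c"
  by (simp add: cdot_def sum_distrib_left mult.left_commute)
lemma cdot_zero [simp]: "cdot 0 a = 0" "cdot a 0 = 0"
  by (simp_all add: cdot_def)

lemma cdot_transpose: "cdot (A *v x) y = cdot x (transpose A *v y)"
proof -
  have "cdot (A *v x) y = (\<Sum>i\<in>UNIV. \<Sum>j\<in>UNIV. A $ i $ j * x $ j * y $ i)"
    by (simp add: cdot_def matrix_vector_mult_def sum_distrib_right)
  also have "\<dots> = (\<Sum>j\<in>UNIV. \<Sum>i\<in>UNIV. A $ i $ j * x $ j * y $ i)" by (rule sum.swap)
  also have "\<dots> = cdot x (transpose A *v y)"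
    by (simp add: cdot_def matrix_vector_mult_def transpose_def sum_distrib_left mult_ac)
  finally show ?thesis .
qed

lemma cdot_sym: "transpose A = A \<Longrightarrow> cdot (A *v x) y = cdot (A *v y) x"
  by (metis cdot_transpose cdot_commute)

lemma matrix_vector_minus: "A *v (- x) = - (A *v (x::complex^'n))"
  by (simp add: matrix_vector_mult_def vec_eq_iff sum_negf)

lemmas cdot_simps = cdot_add_left cdot_add_right cdot_diff_left cdot_diff_right
  cdot_minus_left cdot_minus_right cdot_scale_left cdot_scale_right
  matrix_vector_right_distrib matrix_vector_mult_diff_distrib matrix_vector_minus vector_scalar_commute

lemma cvec_add: "cvec (x + y) = cvec x + cvec y" by (simp add: cvec_def vec_eq_iff)
lemma cvec_scaleR: "cvec (r *\<^sub>R x) = of_real r *s cvec x" by (simp add: cvec_def vec_eq_iff)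
lemma cvec_uminus: "cvec (- x) = - cvec x" by (simp add: cvec_def vec_eq_iff)
lemma cvec_0 [simp]: "cvec 0 = 0" by (simp add: cvec_def vec_eq_iff)
lemma cvec_eq_0 [simp]: "cvec x = 0 \<longleftrightarrow> x = 0" by (simp add: cvec_def vec_eq_iff)
lemma cdot_cvec: "cdot (cvec x) (cvec y) = of_real (x \<bullet> y)"
  by (simp add: cdot_def cvec_def inner_vec_def)
lemma cmat_cvec: "cmat M *v cvec x = cvec (M *v x)"
  by (simp add: cmat_def cvec_def matrix_vector_mult_def)

text \<open>Together with the imaginary part below, this turns a complex linear term into the real parameters \<open>u\<close>, \<open>v\<close> of
  \<open>gauss_integral\<close>.\<close>

definition re_vec :: "complex^'n \<Rightarrow> real^'n" where "re_vec z = (\<chi> i. Re (z $ i))"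
definition im_vec :: "complex^'n \<Rightarrow> real^'n" where "im_vec z = (\<chi> i. Im (z $ i))"

lemma vec_re_im: "z = cvec (re_vec z) + \<i> *s cvec (im_vec z)"
  by (simp add: vec_eq_iff cvec_def re_vec_def im_vec_def complex_eq mult.commute)

lemma matrix_inv_props:
  assumes "invertible A"
  shows "A ** matrix_inv A = mat 1" "matrix_inv A ** A = mat 1"
proof -
  have "A ** matrix_inv A = mat 1 \<and> matrix_inv A ** A = mat 1"
    unfolding matrix_inv_def by (rule someI_ex) (use assms in \<open>auto simp: invertible_def\<close>)
  then show "A ** matrix_inv A = mat 1" "matrix_inv A ** A = mat 1" by auto
qed

lemma matrix_inv_mult_vec:
  assumes "invertible (A :: 'a::comm_ring_1^'n^'n)"
  shows "A *v (matrix_inv A *v x) = x" "matrix_inv A *v (A *v x) = x"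
  by (simp_all add: matrix_vector_mul_assoc matrix_inv_props assms)

lemma matrix_inv_unique:
  assumes "A ** B = mat 1" "B ** A = mat (1::'a::comm_ring_1)"
  shows "matrix_inv A = B"
proof -
  have "invertible A" using assms by (auto simp: invertible_def)
  then have "B ** (A ** matrix_inv A) = B" by (simp add: matrix_inv_props)
  then show ?thesis by (simp add: matrix_mul_assoc assms)
qed

lemma invertible_matrix_inv: "invertible A \<Longrightarrow> invertible (matrix_inv A)"
  using matrix_inv_props[of A] by (auto simp: invertible_def)

lemma matrix_inv_twice: "invertible (A :: 'a::comm_ring_1^'n^'n) \<Longrightarrow> matrix_inv (matrix_inv A) = A"
  by (rule matrix_inv_unique) (simp_all add: matrix_inv_props)

section \<open>Complex Gaussians\<close>

text \<open>Multiplied by \<open>\<i>\<close>, these are the points of the Siegel upper half space.\<close>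

definition gauss_mat :: "complex^'n^'n \<Rightarrow> bool" where
  "gauss_mat A \<longleftrightarrow> transpose A = A \<and> (\<forall>x. x \<noteq> 0 \<longrightarrow> Re (cdot (A *v cvec x) (cvec x)) > 0)"

definition cgauss :: "complex^'n^'n \<Rightarrow> complex^'n \<Rightarrow> real^'n \<Rightarrow> complex" where
  "cgauss A b = quad_gauss (\<lambda>x y. cdot (A *v cvec x) (cvec y)) (\<lambda>x. cdot b (cvec x))"

lemma cgauss_nonzero: "cgauss A b x \<noteq> 0" by (simp add: cgauss_def quad_gauss_def)

lemma bounded_linear_cdot: "bounded_linear (\<lambda>x. cdot b (cvec x))"
  by (intro linear_conv_bounded_linear[THEN iffD1] linearI)
     (simp_all add: cvec_add cvec_scaleR cdot_simps scaleR_conv_of_real[where 'a=complex])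

lemma bounded_bilinear_cdot: "bounded_bilinear (\<lambda>x y. cdot (A *v cvec x) (cvec y))"
  unfolding bilinear_conv_bounded_bilinear[symmetric] bilinear_def
  by (auto intro!: linearI simp: cvec_add cvec_scaleR cdot_simps scaleR_conv_of_real[where 'a=complex])

text \<open>The minimum of \<open>Re A x \<cdot> x\<close> over the unit sphere is attained, hence positive.\<close>

lemma gauss_mat_coercive:
  assumes A: "gauss_mat A"
  obtains m where "coercive_form (\<lambda>x y. cdot (A *v cvec x) (cvec y)) m"
proof -
  let ?q = "\<lambda>x. Re (cdot (A *v cvec x) (cvec x))"
  have "continuous_on (sphere 0 1) ?q"
    by (intro continuous_intros bounded_bilinear.continuous_on[OF bounded_bilinear_cdot])
  moreover have "sphere (0::real^'n) 1 \<noteq> {}" by simp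
  ultimately obtain x0 where x0: "x0 \<in> sphere 0 1" "\<And>x. x \<in> sphere 0 1 \<Longrightarrow> ?q x0 \<le> ?q x"
    using continuous_attains_inf[of "sphere 0 1" ?q] by auto
  have "?q x0 * (norm x)\<^sup>2 \<le> ?q x" for x
  proof (cases "x = 0")
    case False
    have "?q x0 \<le> ?q ((1 / norm x) *\<^sub>R x)" using False by (intro x0(2)) simp
    also have "\<dots> = ?q x / (norm x)\<^sup>2"
      by (simp add: cvec_scaleR cdot_simps power2_eq_square flip: of_real_mult)
    finally show ?thesis using False by (simp add: field_simps)
  qed simp
  moreover have "x0 \<noteq> 0" using x0(1) by auto
  then have "?q x0 > 0" using A by (simp add: gauss_mat_def)
  moreover have "transpose A = A" using A by (simp add: gauss_mat_def)
  ultimately have "coercive_form (\<lambda>x y. cdot (A *v cvec x) (cvec y)) (?q x0)"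
    by (intro coercive_form.intro bounded_bilinear_cdot) (simp_all add: cdot_sym)
  then show ?thesis by (rule that)
qed

lemma cgauss_measurable [measurable]: "cgauss A b \<in> borel_measurable borel"
  unfolding cgauss_def quad_gauss_def
  by (intro borel_measurable_continuous_onI continuous_intros
      bounded_bilinear.continuous_on[OF bounded_bilinear_cdot] linear_continuous_on bounded_linear_cdot)

lemma integrable_cgauss: assumes "gauss_mat A" shows "integrable lborel (cgauss A b)"
  unfolding cgauss_def by (rule gauss_mat_coercive[OF assms], erule coercive_form.integrable_gauss) (rule bounded_linear_cdot)

lemma sqint_cgauss: assumes "gauss_mat A" shows "sqint (cgauss A b)"
  unfolding cgauss_def by (rule gauss_mat_coercive[OF assms], erule coercive_form.sqint_gauss) (rule bounded_linear_cdot)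

text \<open>By symmetry of \<open>A\<close> the mixed terms of \<open>A (u + i v) \<cdot> (u - i v)\<close> cancel, which leaves
  \<open>A u \<cdot> u + A v \<cdot> v\<close>. Invertibility of \<open>A\<close> is an immediate consequence, and so is the positivity of the
  inverse.\<close>

lemma gauss_mat_Re_cnj:
  assumes A: "gauss_mat A" and y: "y \<noteq> 0"
  shows "Re (cdot (A *v y) (cnj_vec y)) > 0"
proof -
  let ?u = "cvec (re_vec y)" and ?v = "cvec (im_vec y)"
  have sym: "transpose A = A" and pos: "\<And>x. x \<noteq> 0 \<Longrightarrow> Re (cdot (A *v cvec x) (cvec x)) > 0"
    using A by (auto simp: gauss_mat_def)
  have c: "cnj_vec y = ?u - \<i> *s ?v"
    by (simp add: vec_eq_iff cnj_vec_def cvec_def re_vec_def im_vec_def complex_eq_iff)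
  have "cdot (A *v y) (cnj_vec y) = cdot (A *v ?u) ?u + cdot (A *v ?v) ?v"
    unfolding c by (subst (1) vec_re_im) (simp add: cdot_simps cdot_sym[OF sym, of ?u ?v] algebra_simps)
  moreover have "re_vec y \<noteq> 0 \<or> im_vec y \<noteq> 0"
  proof (rule ccontr)
    assume "\<not> ?thesis"
    then have "?u = 0" "?v = 0" by auto
    then have "y = 0" by (subst vec_re_im) simp
    with y show False by simp
  qed
  moreover have "Re (cdot (A *v ?u) ?u) \<ge> 0" "Re (cdot (A *v ?v) ?v) \<ge> 0"
    using pos[of "re_vec y"] pos[of "im_vec y"] by (cases "re_vec y = 0"; cases "im_vec y = 0"; fastforce)+
  ultimately show ?thesis
    using pos[of "re_vec y"] pos[of "im_vec y"] by (auto intro: add_pos_nonneg add_nonneg_pos)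
qed

lemma gauss_mat_invertible: 
  assumes "gauss_mat A" shows "invertible A"
  unfolding invertible_left_inverse matrix_left_invertible_ker
proof (intro allI impI)
  fix x assume "A *v x = 0"
  then show "x = 0" using gauss_mat_Re_cnj[OF assms, of x] by (cases "x = 0") auto
qed

lemma gauss_mat_inv:
  assumes A: "gauss_mat A" shows "gauss_mat (matrix_inv A)"
proof -
  note inv = gauss_mat_invertible[OF A]
  have sym: "transpose A = A" using A by (simp add: gauss_mat_def)
  have "transpose (matrix_inv A) = matrix_inv A"
  proof (rule matrix_inv_unique[symmetric])
    show "A ** transpose (matrix_inv A) = mat 1"
      using arg_cong[OF matrix_inv_props(2)[OF inv], of transpose] by (simp add: matrix_transpose_mul sym)
    show "transpose (matrix_inv A) ** A = mat 1"
      using arg_cong[OF matrix_inv_props(1)[OF inv], of transpose] by (simp add: matrix_transpose_mul sym)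
  qed
  moreover have "Re (cdot (matrix_inv A *v cvec x) (cvec x)) > 0" if x: "x \<noteq> 0" for x
  proof -
    let ?y = "matrix_inv A *v cvec x"
    have Ay: "A *v ?y = cvec x" by (rule matrix_inv_mult_vec[OF inv])
    then have "?y \<noteq> 0" using x by (metis cvec_eq_0 matrix_vector_mult_0_right)
    from gauss_mat_Re_cnj[OF A this] have "Re (cdot (cvec x) (cnj_vec ?y)) > 0" by (simp only: Ay)
    moreover have "cdot (cvec x) (cnj_vec ?y) = cnj (cdot ?y (cvec x))"
      by (simp add: cdot_def cnj_vec_def cvec_def mult.commute)
    ultimately show ?thesis by simp
  qed
  ultimately show ?thesis by (simp add: gauss_mat_def)
qed

definition gauss_const :: "complex^'n^'n \<Rightarrow> complex" where "gauss_const A = (LINT x|lborel. cgauss A 0 x)"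

lemma integral_cgauss:
  assumes A: "gauss_mat A"
  shows "(LINT x|lborel. cgauss A b x) = gauss_const A * exp (of_real pi * cdot (matrix_inv A *v b) b)"
proof -
  note inv = gauss_mat_invertible[OF A]
  have sym: "transpose A = A" using A by (simp add: gauss_mat_def)
  define c where "c = matrix_inv A *v b"
  let ?u = "cvec (re_vec c)" and ?v = "cvec (im_vec c)"
  have b: "b = A *v c" by (simp add: c_def matrix_inv_mult_vec[OF inv])
  have b2: "b = A *v ?u + \<i> *s (A *v ?v)"
    unfolding b by (subst (1) vec_re_im) (simp add: cdot_simps)
  let ?q = "\<lambda>x y. cdot (A *v cvec x) (cvec y)"
  obtain m where "coercive_form ?q m" using gauss_mat_coercive[OF A] .
  then interpret cf: coercive_form ?q m .
  have "(LINT x|lborel. cgauss A b x) = (LINT x|lborel. quad_gauss ?q (\<lambda>x. ?q (re_vec c) x + \<i> * ?q (im_vec c) x) x)"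
    by (simp add: cgauss_def b2 cdot_simps)
  also have "\<dots> = exp (of_real pi * (?q (re_vec c) (re_vec c) - ?q (im_vec c) (im_vec c) + 2 * \<i> * ?q (re_vec c) (im_vec c)))
      * (LINT x|lborel. quad_gauss ?q (\<lambda>x. 0) x)"
    by (rule cf.gauss_integral)
  also have "?q (re_vec c) (re_vec c) - ?q (im_vec c) (im_vec c) + 2 * \<i> * ?q (re_vec c) (im_vec c) = cdot c b"
    unfolding b by (subst (6 7) vec_re_im)
      (simp add: cdot_simps cdot_commute[of "cvec _" "A *v _"] cdot_sym[OF sym, of ?v ?u] algebra_simps)
  finally show ?thesis by (simp add: gauss_const_def cgauss_def c_def mult.commute)
qed

lemma cgauss_mult_exp:
  "cgauss A b x * exp (2 * of_real pi * cdot c (cvec x)) = cgauss A (b + c) x"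
  by (simp add: cgauss_def quad_gauss_def cdot_simps flip: exp_add) (simp add: algebra_simps)

lemma fourier_cgauss:
  assumes A: "gauss_mat A"
  shows "fourier (cgauss A b) \<xi> = gauss_const A * exp (of_real pi * cdot (matrix_inv A *v b) b)
      * cgauss (matrix_inv A) (- \<i> *s (matrix_inv A *v b)) \<xi>"
proof -
  have sym: "transpose (matrix_inv A) = matrix_inv A" using gauss_mat_inv[OF A] by (simp add: gauss_mat_def)
  have "fourier (cgauss A b) \<xi> = (LINT x|lborel. cgauss A (b + (- \<i>) *s cvec \<xi>) x)"
    unfolding fourier_def cgauss_mult_exp[symmetric]
    by (simp add: cdot_simps cdot_cvec mult_ac)
  also have "\<dots> = gauss_const A * exp (of_real pi * cdot (matrix_inv A *v (b + (- \<i>) *s cvec \<xi>)) (b + (- \<i>) *s cvec \<xi>))"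
    by (rule integral_cgauss[OF A])
  also have "\<dots> = gauss_const A * exp (of_real pi * cdot (matrix_inv A *v b) b)
      * cgauss (matrix_inv A) (- \<i> *s (matrix_inv A *v b)) \<xi>"
    unfolding cgauss_def quad_gauss_def mult.assoc exp_add[symmetric]
    by (rule arg_cong[where f="\<lambda>x. gauss_const A * exp x"])
       (simp add: cdot_simps cdot_sym[OF sym, of "cvec \<xi>" b] algebra_simps)
  finally show ?thesis .
qed

lemma toL2_cgauss_nonzero:
  fixes A :: "complex^'n^'n"
  assumes A: "gauss_mat A" shows "toL2 (cgauss A b) \<noteq> 0"
proof
  assume "toL2 (cgauss A b) = 0"
  then have "AE x::real^'n in lborel. cgauss A b x = 0"
    unfolding toL2_zero by (subst (asm) toL2_eq_iff) (auto simp: sqint_cgauss sqint_zero A)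
  then have "AE x::real^'n in lborel. False" by eventually_elim (simp add: cgauss_nonzero)
  then have "emeasure lborel (UNIV :: (real^'n) set) = 0"
    by (subst (asm) AE_iff_measurable[of UNIV]) auto
  then show False by simp
qed

lemma fourierL2_cgauss:
  assumes A: "gauss_mat A"
  shows "fourierL2 (toL2 (cgauss A b)) = scaleC_L2 (gauss_const A * exp (of_real pi * cdot (matrix_inv A *v b) b))
     (toL2 (cgauss (matrix_inv A) (- \<i> *s (matrix_inv A *v b))))"
proof -
  have "fourier (cgauss A b) = (\<lambda>\<xi>. (gauss_const A * exp (of_real pi * cdot (matrix_inv A *v b) b))
      * cgauss (matrix_inv A) (- \<i> *s (matrix_inv A *v b)) \<xi>)"
    by (rule ext) (rule fourier_cgauss[OF A])
  then show ?thesis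
    by (simp only: fourierL2_toL2 integrable_cgauss sqint_cgauss A toL2_scaleC gauss_mat_inv)
qed

text \<open>Two Fourier transforms multiply a centred Gaussian by this product, and they act as the reflection,
  which fixes it.\<close>

lemma gauss_const_inverse:
  assumes A: "gauss_mat A"
  shows "gauss_const A * gauss_const (matrix_inv A) = 1"
proof -
  have "fourierL2 (fourierL2 (toL2 (cgauss A 0))) = scaleC_L2 (gauss_const A * gauss_const (matrix_inv A)) (toL2 (cgauss A 0))"
    by (simp add: fourierL2_cgauss A gauss_mat_inv fourierL2_scaleC matrix_inv_twice gauss_mat_invertible)
  moreover have "fourierL2 (fourierL2 (toL2 (cgauss A 0))) = toL2 (cgauss A 0)"
    unfolding fourierL2_twice compL2_toL2[OF scales_uminus sqint_cgauss[OF A]]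
    by (rule arg_cong[where f=toL2]) (simp add: fun_eq_iff cgauss_def quad_gauss_def cvec_uminus cdot_simps)
  ultimately have "scaleC_L2 (gauss_const A * gauss_const (matrix_inv A)) (toL2 (cgauss A 0)) = scaleC_L2 1 (toL2 (cgauss A 0))" by simp
  then show ?thesis using toL2_cgauss_nonzero[OF A, of 0] by (simp only: cL2.scale_right_imp_eq)
qed

section \<open>Phase space shifts of complex Gaussians\<close>

text \<open>Fourier inversion at the complex point \<open>p\<close>: the inner integrand is a Gaussian with matrix the
  inverse of \<open>A\<close>, so both integrals are known and the exponents can be compared.\<close>

lemma inverse_fourier_cgauss:
  assumes A: "gauss_mat A"
  shows "integrable lborel (\<lambda>\<eta>. fourier (cgauss A b) \<eta> * exp (2 * of_real pi * \<i> * cdot (cvec \<eta>) p))" (is ?I)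
    and "(LINT \<eta>|lborel. fourier (cgauss A b) \<eta> * exp (2 * of_real pi * \<i> * cdot (cvec \<eta>) p))
       = exp (- of_real pi * cdot (A *v p) p + 2 * of_real pi * cdot b p)" (is "?L = ?R")
proof -
  note inv = gauss_mat_invertible[OF A]
  let ?A = "matrix_inv A"
  have A': "gauss_mat ?A" by (rule gauss_mat_inv[OF A])
  have sym: "transpose A = A" "transpose ?A = ?A" using A A' by (auto simp: gauss_mat_def)
  let ?c = "- \<i> *s (?A *v b) + \<i> *s p"
  have eq: "fourier (cgauss A b) \<eta> * exp (2 * of_real pi * \<i> * cdot (cvec \<eta>) p)
      = (gauss_const A * exp (of_real pi * cdot (?A *v b) b)) * cgauss ?A ?c \<eta>" for \<eta>
    unfolding fourier_cgauss[OF A] cgauss_mult_exp[symmetric]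
    by (simp add: cdot_simps cdot_commute mult_ac)
  show ?I unfolding eq by (intro integrable_mult_right integrable_cgauss A')
  have "?L = gauss_const A * exp (of_real pi * cdot (?A *v b) b) * (gauss_const ?A * exp (of_real pi * cdot (A *v ?c) ?c))"
    unfolding eq by (simp add: integral_cgauss A' matrix_inv_twice inv)
  also have "\<dots> = (gauss_const A * gauss_const ?A) * exp (of_real pi * cdot (?A *v b) b + of_real pi * cdot (A *v ?c) ?c)"
    by (simp add: exp_add)
  also have "of_real pi * cdot (?A *v b) b + of_real pi * cdot (A *v ?c) ?c
      = - of_real pi * cdot (A *v p) p + 2 * of_real pi * cdot b p"
    by (simp add: cdot_simps matrix_inv_mult_vec inv cdot_sym[OF sym(1), of p "?A *v b"]
        cdot_commute[of "?A *v b" b] cdot_commute[of p b] algebra_simps)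
  finally show "?L = ?R" by (simp add: gauss_const_inverse A)
qed

text \<open>The scalar factor and the new linear term of a Gaussian after a phase space shift, obtained by
  expanding \<open>exp (- \<pi> A (y - z) \<cdot> (y - z) + 2 \<pi> b \<cdot> (y - z))\<close> and multiplying by the remaining factors
  of the representation; the factor for \<open>\<tau>\<close> is kept separate because every operator commutes with it.\<close>

definition rho_coeff :: "complex^'n^'n \<Rightarrow> complex^'n \<Rightarrow> complex^('n+'n) \<Rightarrow> complex" where
  "rho_coeff A b Z = exp (- \<i> * of_real pi * cdot (pos_part Z) (freq_part Z)
     - of_real pi * cdot (A *v pos_part Z) (pos_part Z) - 2 * of_real pi * cdot b (pos_part Z))"

definition rho_lin :: "complex^'n^'n \<Rightarrow> complex^'n \<Rightarrow> complex^('n+'n) \<Rightarrow> complex^'n" where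
  "rho_lin A b Z = b + \<i> *s freq_part Z + A *v pos_part Z"

definition phase :: "real \<Rightarrow> complex" where
  "phase \<tau> = exp (2 * of_real pi * \<i> * of_real \<tau>)"

lemma rho_fun_cgauss:
  assumes A: "gauss_mat A"
  shows "rho_fun Z \<tau> (cgauss A b) y = phase \<tau> * rho_coeff A b Z * cgauss A (rho_lin A b Z) y"
proof -
  have sym: "transpose A = A" using A by (auto simp: gauss_mat_def)
  let ?z = "pos_part Z"
  show ?thesis
    unfolding rho_fun_def inverse_fourier_cgauss(2)[OF A] phase_def rho_coeff_def rho_lin_def
    unfolding cgauss_def quad_gauss_def exp_add[symmetric]
    by (rule arg_cong[where f=exp])
       (simp add: cdot_simps cdot_sym[OF sym, of "cvec y" ?z] algebra_simps)
qed

lemma rho_fun_cong_AE: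
  assumes "f \<in> borel_measurable borel" "g \<in> borel_measurable borel" "AE x in lborel. f x = g x"
  shows "rho_fun Z \<tau> f = rho_fun Z \<tau> g"
  by (simp add: rho_fun_def fun_eq_iff fourier_cong_AE[OF assms])

lemma rho_dom_toL2:
  assumes f: "sqint f" "integrable lborel f"
    and i: "\<And>y. integrable lborel (\<lambda>\<eta>. fourier f \<eta> * exp (2 * of_real pi * \<i> * cdot (cvec \<eta>) (cvec y - pos_part Z)))"
    and s: "sqint (rho_fun Z \<tau> f)"
  shows "toL2 f \<in> rho_dom Z \<tau>" "rho Z \<tau> (toL2 f) = toL2 (rho_fun Z \<tau> f)"
proof -
  have m: "fromL2 (toL2 f) \<in> borel_measurable borel" "f \<in> borel_measurable borel"
    using sqint_measurable[OF sqint_fromL2, of "toL2 f"] sqint_measurable[OF f(1)] by auto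
  note ae = AE_fromL2_toL2[OF f(1)]
  have r: "rho_fun Z \<tau> (fromL2 (toL2 f)) = rho_fun Z \<tau> f" by (rule rho_fun_cong_AE[OF m ae])
  have F: "fourier (fromL2 (toL2 f)) = fourier f" by (intro ext fourier_cong_AE[OF m ae])
  have "integrable lborel (fromL2 (toL2 f))"
    by (rule integrable_cong_AE_imp[OF f(2)]) (use m ae in \<open>auto elim: eventually_mono\<close>)
  then show "toL2 f \<in> rho_dom Z \<tau>" using i s by (simp add: rho_dom_def r F)
  show "rho Z \<tau> (toL2 f) = toL2 (rho_fun Z \<tau> f)" by (simp add: rho_def r)
qed

lemma rho_cgauss:
  assumes A: "gauss_mat A"
  shows "toL2 (cgauss A b) \<in> rho_dom Z \<tau>"
    and "rho Z \<tau> (toL2 (cgauss A b)) = scaleC_L2 (phase \<tau> * rho_coeff A b Z) (toL2 (cgauss A (rho_lin A b Z)))"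
proof -
  have r: "rho_fun Z \<tau> (cgauss A b) = (\<lambda>y. phase \<tau> * rho_coeff A b Z * cgauss A (rho_lin A b Z) y)"
    by (simp add: fun_eq_iff rho_fun_cgauss[OF A])
  have s: "sqint (rho_fun Z \<tau> (cgauss A b))" unfolding r by (intro sqint_scale sqint_cgauss A)
  note rd = rho_dom_toL2[OF sqint_cgauss[OF A] integrable_cgauss[OF A] inverse_fourier_cgauss(1)[OF A] s]
  show "toL2 (cgauss A b) \<in> rho_dom Z \<tau>" by (rule rd(1))
  show "rho Z \<tau> (toL2 (cgauss A b)) = scaleC_L2 (phase \<tau> * rho_coeff A b Z) (toL2 (cgauss A (rho_lin A b Z)))"
    unfolding rd(2) by (simp add: r toL2_scaleC sqint_cgauss A)
qed

lemma rho_add: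
  assumes u: "u \<in> rho_dom Z \<tau>" and v: "v \<in> rho_dom Z \<tau>"
  shows "u + v \<in> rho_dom Z \<tau>" "rho Z \<tau> (u + v) = rho Z \<tau> u + rho Z \<tau> v"
proof -
  let ?f = "fromL2 u" and ?g = "fromL2 v"
  have i: "integrable lborel ?f" "integrable lborel ?g" using u v by (auto simp: rho_dom_def)
  have F: "fourier (\<lambda>x. ?f x + ?g x) = (\<lambda>\<eta>. fourier ?f \<eta> + fourier ?g \<eta>)" by (intro ext fourier_add i)
  have r: "rho_fun Z \<tau> (\<lambda>x. ?f x + ?g x) = (\<lambda>y. rho_fun Z \<tau> ?f y + rho_fun Z \<tau> ?g y)"
    unfolding rho_fun_def F distrib_right
    by (subst Bochner_Integration.integral_add) (use u v in \<open>auto simp: rho_dom_def distrib_left\<close>)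
  have s: "sqint (rho_fun Z \<tau> ?f)" "sqint (rho_fun Z \<tau> ?g)" using u v by (auto simp: rho_dom_def)
  have uv: "u + v = toL2 (\<lambda>x. ?f x + ?g x)" by (simp flip: toL2_add)
  have h: "sqint (\<lambda>x. ?f x + ?g x)" "integrable lborel (\<lambda>x. ?f x + ?g x)"
    using i by (auto simp: sqint_add)
  have "integrable lborel (\<lambda>\<eta>. fourier (\<lambda>x. ?f x + ?g x) \<eta> * exp (2 * of_real pi * \<i> * cdot (cvec \<eta>) (cvec y - pos_part Z)))" for y
    unfolding F distrib_right using u v by (intro Bochner_Integration.integrable_add) (auto simp: rho_dom_def)
  note rd = rho_dom_toL2[OF h this, of \<tau>]
  show "u + v \<in> rho_dom Z \<tau>" "rho Z \<tau> (u + v) = rho Z \<tau> u + rho Z \<tau> v"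
    unfolding uv using rd s by (simp_all add: r sqint_add toL2_add rho_def)
qed

lemma rho_scaleC:
  assumes u: "u \<in> rho_dom Z \<tau>"
  shows "scaleC_L2 c u \<in> rho_dom Z \<tau>" "rho Z \<tau> (scaleC_L2 c u) = scaleC_L2 c (rho Z \<tau> u)"
proof -
  let ?f = "fromL2 u"
  have i: "integrable lborel ?f" using u by (auto simp: rho_dom_def)
  have F: "fourier (\<lambda>x. c * ?f x) = (\<lambda>\<eta>. c * fourier ?f \<eta>)" by (intro ext fourier_scale)
  have r: "rho_fun Z \<tau> (\<lambda>x. c * ?f x) = (\<lambda>y. c * rho_fun Z \<tau> ?f y)"
    unfolding rho_fun_def F by (simp add: mult.assoc mult.left_commute)
  have s: "sqint (rho_fun Z \<tau> ?f)" using u by (auto simp: rho_dom_def)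
  have uv: "scaleC_L2 c u = toL2 (\<lambda>x. c * ?f x)" by (simp flip: toL2_scaleC)
  have h: "sqint (\<lambda>x. c * ?f x)" "integrable lborel (\<lambda>x. c * ?f x)"
    using i by (auto simp: sqint_scale)
  have "integrable lborel (\<lambda>\<eta>. fourier (\<lambda>x. c * ?f x) \<eta> * exp (2 * of_real pi * \<i> * cdot (cvec \<eta>) (cvec y - pos_part Z)))" for y
    unfolding F mult.assoc[of c] using u by (intro integrable_mult_right) (auto simp: rho_dom_def)
  note rd = rho_dom_toL2[OF h this, of \<tau>]
  show "scaleC_L2 c u \<in> rho_dom Z \<tau>" "rho Z \<tau> (scaleC_L2 c u) = scaleC_L2 c (rho Z \<tau> u)"
    unfolding uv using rd s by (simp_all add: r sqint_scale toL2_scaleC rho_def)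
qed

lemma rho_zero: "0 \<in> rho_dom Z \<tau>" "rho Z \<tau> 0 = (0 :: (real^'n) L2)"
proof -
  have "gauss_mat (mat 1 :: complex^'n^'n)"
    by (simp add: gauss_mat_def cdot_cvec)
  from rho_scaleC[OF rho_cgauss(1)[OF this, of 0 Z \<tau>], of 0]
  show "0 \<in> rho_dom Z \<tau>" "rho Z \<tau> 0 = (0 :: (real^'n) L2)" by simp_all
qed

section \<open>Operators covering a symplectic matrix\<close>

definition gauss_class :: "(real^'n) L2 set" where
  "gauss_class = {scaleC_L2 c (toL2 (cgauss A b)) | c A b. gauss_mat A}"

definition covers :: "((real^'n) L2 \<Rightarrow> (real^'n) L2) \<Rightarrow> complex^('n+'n)^('n+'n) \<Rightarrow> bool" where
  "covers X S \<longleftrightarrow> (\<forall>u v. X (u + v) = X u + X v) \<and> (\<forall>c u. X (scaleC_L2 c u) = scaleC_L2 c (X u))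
     \<and> (\<forall>u\<in>gauss_class. X u \<in> gauss_class \<and> (\<forall>Z \<tau>. X (rho Z \<tau> u) = rho (S *v Z) \<tau> (X u)))"

lemma gauss_class_scale: "u \<in> gauss_class \<Longrightarrow> scaleC_L2 c u \<in> gauss_class"
  by (auto simp: gauss_class_def) (metis cL2.scale_scale)

lemma gauss_class_rho:
  assumes "u \<in> gauss_class"
  shows "u \<in> rho_dom Z \<tau>" "rho Z \<tau> u \<in> gauss_class"
proof -
  obtain c A b where u: "u = scaleC_L2 c (toL2 (cgauss A b))" and A: "gauss_mat A"
    using assms by (auto simp: gauss_class_def)
  show "u \<in> rho_dom Z \<tau>" unfolding u by (intro rho_scaleC rho_cgauss A)
  have "rho Z \<tau> u = scaleC_L2 (c * (phase \<tau> * rho_coeff A b Z)) (toL2 (cgauss A (rho_lin A b Z)))"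
    unfolding u by (simp add: rho_scaleC rho_cgauss A)
  then show "rho Z \<tau> u \<in> gauss_class" using A by (auto simp: gauss_class_def)
qed

lemma covers_comp:
  assumes "covers X S" "covers Y T"
  shows "covers (X \<circ> Y) (S ** T)"
  using assms unfolding covers_def by (simp flip: matrix_vector_mul_assoc)

lemma covers_scale:
  assumes "covers X S"
  shows "covers (\<lambda>u. scaleC_L2 k (X u)) S"
  using assms unfolding covers_def
  by (simp add: cL2.scale_right_distrib cL2.scale_left_commute gauss_class_scale rho_scaleC gauss_class_rho)

text \<open>The criterion used for each generator. The quadratic part of the image may depend on the quadratic
  part of the argument only, so that the relation reduces to one equation for linear terms and one
  for scalars.\<close>

lemma coversI:
  fixes X :: "(real^'n) L2 \<Rightarrow> (real^'n) L2"
  assumes lin: "\<And>u v. X (u + v) = X u + X v" "\<And>c u. X (scaleC_L2 c u) = scaleC_L2 c (X u)"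
    and A': "\<And>A. gauss_mat A \<Longrightarrow> gauss_mat (Q A)"
    and act: "\<And>A b. gauss_mat A \<Longrightarrow> X (toL2 (cgauss A b)) = scaleC_L2 (k A b) (toL2 (cgauss (Q A) (\<beta> A b)))"
    and shift: "\<And>A b Z. gauss_mat A \<Longrightarrow> \<beta> A (rho_lin A b Z) = rho_lin (Q A) (\<beta> A b) (S *v Z)"
    and coeff: "\<And>A b Z. gauss_mat A \<Longrightarrow> k A (rho_lin A b Z) * rho_coeff A b Z = k A b * rho_coeff (Q A) (\<beta> A b) (S *v Z)"
  shows "covers X S"
  unfolding covers_def
proof (intro conjI ballI allI lin)
  fix u :: "(real^'n) L2" assume "u \<in> gauss_class"
  then obtain c A b where u: "u = scaleC_L2 c (toL2 (cgauss A b))" and A: "gauss_mat A"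
    by (auto simp: gauss_class_def)
  show "X u \<in> gauss_class"
    unfolding u lin(2) act[OF A] cL2.scale_scale using A'[OF A] by (auto simp: gauss_class_def)
  fix Z \<tau>
  have "X (rho Z \<tau> u) = scaleC_L2 (c * (phase \<tau> * (k A (rho_lin A b Z) * rho_coeff A b Z))) (toL2 (cgauss (Q A) (rho_lin (Q A) (\<beta> A b) (S *v Z))))"
    by (simp add: u rho_scaleC rho_cgauss A lin(2) act shift mult_ac)
  also have "\<dots> = rho (S *v Z) \<tau> (X u)"
    unfolding coeff[OF A] by (simp add: u lin(2) act A rho_scaleC rho_cgauss A' mult_ac)
  finally show "X (rho Z \<tau> u) = rho (S *v Z) \<tau> (X u)" .
qed

lemma sum_UNIV_sum:
  fixes f :: "'n::finite + 'n \<Rightarrow> complex"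
  shows "(\<Sum>j\<in>UNIV. f j) = (\<Sum>j\<in>UNIV. f (Inl j)) + (\<Sum>j\<in>UNIV. f (Inr j))"
  by (subst UNIV_Plus_UNIV[symmetric], subst sum.Plus) (simp_all add: o_def)

lemma block_mat_parts:
  "pos_part (block_mat A B C D *v Z) = A *v pos_part Z + B *v freq_part Z"
  "freq_part (block_mat A B C D *v Z) = C *v pos_part Z + D *v freq_part Z"
  by (simp_all add: pos_part_def freq_part_def block_mat_def matrix_vector_mult_def vec_eq_iff sum_UNIV_sum)

lemma parts_eqI: "pos_part Z = pos_part Y \<Longrightarrow> freq_part Z = freq_part Y \<Longrightarrow> Z = Y"
  unfolding vec_eq_iff pos_part_def freq_part_def by (metis (no_types, lifting) sumE vec_lambda_beta)

lemma matrix_parts_eqI: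
  fixes S T :: "complex^('n::finite+'n)^('n+'n)"
  assumes "\<And>Z. pos_part (S *v Z) = pos_part (T *v Z)" "\<And>Z. freq_part (S *v Z) = freq_part (T *v Z)"
  shows "S = T"
  unfolding matrix_eq using parts_eqI assms by blast

lemma minus_matrix_vector: "(- A) *v (x::complex^'n) = - (A *v x)"
  by (simp add: matrix_vector_mult_def vec_eq_iff sum_negf)

lemma J_mat_parts: "pos_part (J_mat *v Z) = freq_part Z" "freq_part (J_mat *v Z) = - pos_part Z"
  by (simp_all add: J_mat_def block_mat_parts minus_matrix_vector)

text \<open>With \<open>Z = (z, w)\<close>, the exponents on both sides are \<open>i z \<cdot> w + A\<inverse> b \<cdot> b - A\<inverse> w \<cdot> w + 2 i A\<inverse> b \<cdot> w\<close>, up to the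
  common factor \<open>\<pi>\<close>.\<close>

lemma covers_fourierL2: "covers fourierL2 (J_mat :: complex^('n::finite+'n)^('n+'n))"
proof (rule coversI[where Q=matrix_inv and \<beta>="\<lambda>A b. - \<i> *s (matrix_inv A *v b)"
      and k="\<lambda>A b. gauss_const A * exp (of_real pi * cdot (matrix_inv A *v b) b)"])
  fix A :: "complex^'n^'n" and b :: "complex^'n" and Z :: "complex^('n+'n)"
  assume A: "gauss_mat A"
  note inv = gauss_mat_invertible[OF A]
  let ?A = "matrix_inv A" and ?z = "pos_part Z" and ?w = "freq_part Z"
  have sym: "transpose A = A" "transpose ?A = ?A" using A gauss_mat_inv[OF A] by (auto simp: gauss_mat_def)
  show "gauss_mat ?A" by (rule gauss_mat_inv[OF A])
  show "fourierL2 (toL2 (cgauss A b)) = scaleC_L2 (gauss_const A * exp (of_real pi * cdot (?A *v b) b)) (toL2 (cgauss ?A (- \<i> *s (?A *v b))))"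
    by (rule fourierL2_cgauss[OF A])
  show "- \<i> *s (?A *v rho_lin A b Z) = rho_lin ?A (- \<i> *s (?A *v b)) (J_mat *v Z)"
    by (simp add: rho_lin_def J_mat_parts cdot_simps matrix_inv_mult_vec inv vec_eq_iff algebra_simps)
  have 1: "cdot (?A *v x) (A *v y) = cdot x y" for x y
    by (simp add: cdot_transpose sym matrix_inv_mult_vec inv)
  have "of_real pi * cdot (?A *v rho_lin A b Z) (rho_lin A b Z)
       + (- \<i> * of_real pi * cdot ?z ?w - of_real pi * cdot (A *v ?z) ?z - 2 * of_real pi * cdot b ?z)
     = of_real pi * cdot (?A *v b) b
       + (- \<i> * of_real pi * cdot ?w (- ?z) - of_real pi * cdot (?A *v ?w) ?w - 2 * of_real pi * cdot (- \<i> *s (?A *v b)) ?w)"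
    by (simp add: rho_lin_def cdot_simps matrix_inv_mult_vec inv 1 cdot_sym[OF sym(2), of ?w b]
        cdot_commute[of ?z b] cdot_commute[of ?z ?w] cdot_commute[of ?z "A *v ?z"] algebra_simps)
  then show "gauss_const A * exp (of_real pi * cdot (?A *v rho_lin A b Z) (rho_lin A b Z)) * rho_coeff A b Z
     = gauss_const A * exp (of_real pi * cdot (?A *v b) b) * rho_coeff ?A (- \<i> *s (?A *v b)) (J_mat *v Z)"
    unfolding rho_coeff_def J_mat_parts mult.assoc exp_add[symmetric] by simp
qed (auto simp: fourierL2_add fourierL2_scaleC)

definition cscale :: "complex \<Rightarrow> complex^'n^'n \<Rightarrow> complex^'n^'n" where
  "cscale c M = (\<chi> i j. c * M $ i $ j)"

lemma cscale_vec: "cscale c M *v x = c *s (M *v x)"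
  by (simp add: cscale_def matrix_vector_mult_def vec_eq_iff sum_distrib_left mult.assoc)

text \<open>With \<open>P = - i Q\<close> this is the multiplier of \<open>met_p Q\<close> for real \<open>Q\<close>, and with real diagonal \<open>P\<close> the
  damping that occurs in the contractions; one computation serves both.\<close>

definition chirp :: "complex^'n^'n \<Rightarrow> real^'n \<Rightarrow> complex" where
  "chirp P x = exp (- of_real pi * cdot (P *v cvec x) (cvec x))"

definition chirp_mat :: "complex^'n^'n \<Rightarrow> bool" where
  "chirp_mat P \<longleftrightarrow> transpose P = P \<and> (\<forall>x. Re (cdot (P *v cvec x) (cvec x)) \<ge> 0)"

lemma bdd_mult_chirp: "chirp_mat P \<Longrightarrow> bdd_mult (chirp P)"
proof -
  assume P: "chirp_mat P"
  have "chirp P \<in> borel_measurable borel"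
    unfolding chirp_def
    by (intro borel_measurable_continuous_onI continuous_intros
      bounded_bilinear.continuous_on[OF bounded_bilinear_cdot])
  moreover have "cmod (chirp P x) \<le> 1" for x
    using P by (simp add: chirp_def norm_exp_eq_Re chirp_mat_def)
  ultimately show ?thesis by (auto simp: bdd_mult_def)
qed

lemma chirp_cgauss: "chirp P x * cgauss A b x = cgauss (A + P) b x"
  by (simp add: chirp_def cgauss_def quad_gauss_def cdot_simps matrix_vector_mult_add_rdistrib flip: exp_add)
     (simp add: algebra_simps)

lemma transpose_add: "transpose (A + B) = transpose A + transpose B"
  by (simp add: transpose_def vec_eq_iff)

lemma gauss_mat_add_chirp: "gauss_mat A \<Longrightarrow> chirp_mat P \<Longrightarrow> gauss_mat (A + P)"
  unfolding gauss_mat_def chirp_mat_def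
  by (auto simp: transpose_add matrix_vector_mult_add_rdistrib cdot_add_left intro: add_pos_nonneg)

lemma covers_chirp:
  fixes P :: "complex^'n^'n"
  assumes P: "chirp_mat P"
  shows "covers (mulL2 (chirp P)) (block_mat (mat 1) 0 (cscale \<i> P) (mat 1))"
proof (rule coversI[where Q="\<lambda>A. A + P" and \<beta>="\<lambda>A b. b" and k="\<lambda>A b. 1"])
  fix A :: "complex^'n^'n" and b :: "complex^'n" and Z :: "complex^('n+'n)"
  assume A: "gauss_mat A"
  have sym: "transpose P = P" using P by (simp add: chirp_mat_def)
  let ?z = "pos_part Z" and ?w = "freq_part Z"
  show "gauss_mat (A + P)" by (rule gauss_mat_add_chirp[OF A P])
  show "mulL2 (chirp P) (toL2 (cgauss A b)) = scaleC_L2 1 (toL2 (cgauss (A + P) b))"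
    by (simp add: mulL2_toL2 bdd_mult_chirp P sqint_cgauss A chirp_cgauss)
  show "rho_lin A b Z = rho_lin (A + P) b (block_mat (mat 1) 0 (cscale \<i> P) (mat 1) *v Z)"
    by (simp add: rho_lin_def block_mat_parts cscale_vec vec_eq_iff matrix_vector_mult_add_rdistrib algebra_simps)
  show "1 * rho_coeff A b Z = 1 * rho_coeff (A + P) b (block_mat (mat 1) 0 (cscale \<i> P) (mat 1) *v Z)"
    by (simp add: rho_coeff_def block_mat_parts cscale_vec cdot_simps matrix_vector_mult_add_rdistrib
        cdot_commute[of ?z "P *v ?z"] algebra_simps)
qed (auto simp: mulL2_add mulL2_scaleC bdd_mult_chirp P)

section \<open>Invertible real matrices as substitutions\<close>

lemma scales_matrix:
  fixes E :: "real^'n^'n"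
  assumes "invertible E"
  shows "\<exists>c. scales_lborel (\<lambda>x. E *v x) c"
  by (rule scales_linear[where \<psi>="\<lambda>x. matrix_inv E *v x"]) (simp_all add: matrix_inv_mult_vec assms)

lemma cmat_transpose: "cmat (transpose E) = transpose (cmat E)"
  by (simp add: cmat_def transpose_def vec_eq_iff)
lemma cmat_minus: "cmat (- A) = - cmat A"
  by (simp add: cmat_def vec_eq_iff)
lemma cmat_mult: "cmat (A ** B) = cmat A ** cmat B"
  by (simp add: cmat_def matrix_matrix_mult_def vec_eq_iff)
lemma cmat_one: "cmat (mat 1) = mat 1"
  by (simp add: cmat_def mat_def vec_eq_iff)

lemma cmat_inv_vec:
  assumes "invertible E"
  shows "cmat E *v (cmat (matrix_inv E) *v x) = x" "cmat (matrix_inv E) *v (cmat E *v x) = x"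
  by (simp_all add: matrix_vector_mul_assoc cmat_one matrix_inv_props assms flip: cmat_mult)

text \<open>The adjoint identity for \<^const>\<open>cdot\<close> is stated with transposed matrices, so the row vector
  notation must not be introduced.\<close>

declare transpose_matrix_vector [simp del]

lemma covers_compL2:
  fixes E :: "real^'n^'n"
  assumes E: "invertible E"
  shows "covers (compL2 (\<lambda>x. E *v x)) (D_mat E)"
proof -
  obtain s where s: "scales_lborel (\<lambda>x. E *v x) s" using scales_matrix[OF E] by blast
  show ?thesis
  proof (rule coversI[where Q="\<lambda>A. transpose (cmat E) ** A ** cmat E" and \<beta>="\<lambda>A b. transpose (cmat E) *v b" and k="\<lambda>A b. 1"])
    fix A :: "complex^'n^'n" and b :: "complex^'n" and Z :: "complex^('n+'n)"
    assume A: "gauss_mat A"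
    let ?z = "pos_part Z" and ?w = "freq_part Z" and ?Q = "transpose (cmat E) ** A ** cmat E"
    have sym: "transpose A = A" using A by (simp add: gauss_mat_def)
    have Q: "?Q *v x = transpose (cmat E) *v (A *v (cmat E *v x))" for x
      by (simp only: matrix_vector_mul_assoc matrix_mul_assoc)
    have tr: "cdot (transpose (cmat E) *v x) y = cdot x (cmat E *v y)" for x y
      by (simp only: cdot_transpose transpose_transpose)
    have tr2: "cdot (cmat (matrix_inv E) *v x) (transpose (cmat E) *v y) = cdot x y" for x y
      by (simp only: cdot_commute[of "cmat (matrix_inv E) *v x"] tr cmat_inv_vec[OF E]) (rule cdot_commute)
    have "E *v x \<noteq> 0" if "x \<noteq> 0" for x using matrix_inv_mult_vec(2)[OF E, of x] that by force
    then show "gauss_mat ?Q"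
      using A by (auto simp: gauss_mat_def Q tr cmat_cvec matrix_transpose_mul matrix_mul_assoc)
    then have sq: "sqint (cgauss ?Q (transpose (cmat E) *v b))" by (rule sqint_cgauss)
    have "cgauss A b (E *v x) = cgauss ?Q (transpose (cmat E) *v b) x" for x
      by (simp add: cgauss_def quad_gauss_def Q tr cmat_cvec)
    then show "compL2 (\<lambda>x. E *v x) (toL2 (cgauss A b)) = scaleC_L2 1 (toL2 (cgauss ?Q (transpose (cmat E) *v b)))"
      by (simp add: compL2_toL2[OF s] sqint_cgauss A)
    show "transpose (cmat E) *v rho_lin A b Z = rho_lin ?Q (transpose (cmat E) *v b) (D_mat E *v Z)"
      by (simp add: rho_lin_def D_mat_def block_mat_parts Q cmat_inv_vec E cmat_transpose cdot_simps)
    show "1 * rho_coeff A b Z = 1 * rho_coeff ?Q (transpose (cmat E) *v b) (D_mat E *v Z)"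
      by (simp add: rho_coeff_def D_mat_def block_mat_parts Q tr tr2 cmat_inv_vec E cmat_transpose)
  qed (auto simp: compL2_scaleC[OF s] linear_add[OF bounded_linear.linear[OF bounded_linear_compL2[OF s]]])
qed

section \<open>The metaplectic group\<close>

text \<open>The last conjunct is what lets a cover be inverted: the intertwining relation for the inverse is
  the original one read at elements of the form \<open>inv X u\<close>, which must lie in the class.\<close>

definition covers_bij :: "((real^'n) L2 \<Rightarrow> (real^'n) L2) \<Rightarrow> complex^('n+'n)^('n+'n) \<Rightarrow> bool" where
  "covers_bij X S \<longleftrightarrow> covers X S \<and> bij X \<and> invertible S \<and> (\<forall>u\<in>gauss_class. inv X u \<in> gauss_class)"

lemma covers_bijI:
  assumes "covers X S" "invertible S" "\<And>u. X (Y u) = u" "\<And>u. Y (X u) = u"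
    and "\<And>u. u \<in> gauss_class \<Longrightarrow> Y u \<in> gauss_class"
  shows "covers_bij X S"
proof -
  have b: "bij X" by (rule bij_betw_byWitness[where f'=Y]) (auto simp: assms)
  have "inv X = Y" by (rule inv_unique_comp) (auto simp: fun_eq_iff assms)
  then show ?thesis using assms b by (simp add: covers_bij_def)
qed

lemma covers_bij_comp:
  assumes X: "covers_bij X S" and Y: "covers_bij Y T"
  shows "covers_bij (X \<circ> Y) (S ** T)"
  using assms unfolding covers_bij_def
  by (simp add: covers_comp bij_comp invertible_mult o_inv_distrib)

lemma covers_bij_inv:
  fixes X :: "(real^'n) L2 \<Rightarrow> (real^'n) L2"
  assumes X: "covers_bij X S"
  shows "covers_bij (inv X) (matrix_inv S)"
proof -
  have cov: "covers X S" and b: "bij X" and S: "invertible S"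
    and G: "\<And>u. u \<in> gauss_class \<Longrightarrow> inv X u \<in> gauss_class"
    using X by (auto simp: covers_bij_def)
  have XI: "X (inv X u) = u" "inv X (X u) = u" for u
    using b by (simp_all add: bij_is_surj surj_f_inv_f bij_is_inj)
  have add: "X (u + v) = X u + X v" and scale: "X (scaleC_L2 c u) = scaleC_L2 c (X u)" for u v c
    using cov by (auto simp: covers_def)
  have "covers (inv X) (matrix_inv S)"
    unfolding covers_def
  proof (intro conjI allI ballI)
    fix u v :: "(real^'n) L2"
    have "inv X (X (inv X u) + X (inv X v)) = inv X (X (inv X u + inv X v))" by (simp only: add)
    then show "inv X (u + v) = inv X u + inv X v" by (simp add: XI)
  next
    fix c and u :: "(real^'n) L2"
    have "inv X (scaleC_L2 c (X (inv X u))) = inv X (X (scaleC_L2 c (inv X u)))" by (simp only: scale)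
    then show "inv X (scaleC_L2 c u) = scaleC_L2 c (inv X u)" by (simp add: XI)
  next
    fix u :: "(real^'n) L2" assume u: "u \<in> gauss_class"
    show v: "inv X u \<in> gauss_class" by (rule G[OF u])
    fix Z \<tau>
    have "X (rho (matrix_inv S *v Z) \<tau> (inv X u)) = rho (S *v (matrix_inv S *v Z)) \<tau> (X (inv X u))"
      using cov v by (auto simp: covers_def)
    also have "\<dots> = rho Z \<tau> u" by (simp add: XI matrix_inv_mult_vec S)
    finally show "inv X (rho Z \<tau> u) = rho (matrix_inv S *v Z) \<tau> (inv X u)" using XI by metis
  qed
  then show ?thesis
    using cov b S by (auto simp: covers_bij_def bij_imp_bij_inv invertible_matrix_inv inv_inv_eq covers_def)
qed

lemma covers_gauss: "covers X S \<Longrightarrow> u \<in> gauss_class \<Longrightarrow> X u \<in> gauss_class"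
  by (simp add: covers_def)

lemma invertible_J: "invertible (J_mat :: complex^('n::finite+'n)^('n+'n))"
proof -
  have "(- J_mat) ** (J_mat :: complex^('n+'n)^('n+'n)) = mat 1"
    unfolding matrix_eq
    by (auto simp: minus_matrix_vector J_mat_parts simp flip: matrix_vector_mul_assoc intro!: parts_eqI)
       (auto simp: pos_part_def freq_part_def J_mat_parts[unfolded pos_part_def freq_part_def vec_eq_iff, simplified] vec_eq_iff)
  then show ?thesis by (auto simp: invertible_left_inverse)
qed

text \<open>For the Fourier transform the inverse is its third power up to a scalar, for the other two kinds it
  is a generator of the same kind up to a scalar. In each case it therefore preserves the class.\<close>

lemma met_gen_covers:
  fixes X :: "(real^'n) L2 \<Rightarrow> (real^'n) L2"
  assumes "met_gen X S"
  shows "covers_bij X S"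
  using assms
proof cases
  case F
  define k where "k = \<i> powr (- of_nat CARD('n) / 2)"
  have k: "k \<noteq> 0" by (simp add: k_def)
  have X: "X = (\<lambda>u. scaleC_L2 k (fourierL2 u))" unfolding F(1) met_F_def k_def by (rule refl)
  have F4: "fourierL2 (fourierL2 (fourierL2 (fourierL2 u))) = u" for u :: "(real^'n) L2"
    by (simp add: fourierL2_twice compL2_uminus_twice)
  show ?thesis
    unfolding X F(2)
  proof (rule covers_bijI[where Y="\<lambda>u. scaleC_L2 (1 / k) (fourierL2 (fourierL2 (fourierL2 u)))"])
    show "covers (\<lambda>u. scaleC_L2 k (fourierL2 u)) J_mat" by (rule covers_scale[OF covers_fourierL2])
  qed (use k in \<open>auto simp: fourierL2_scaleC F4 invertible_J intro!: gauss_class_scale covers_gauss[OF covers_fourierL2]\<close>)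
next
  case (p Q)
  let ?P = "\<lambda>s. cscale (s * \<i>) (cmat Q)"
  have trQ: "transpose (cmat Q) = cmat Q" using p(3) by (simp flip: cmat_transpose)
  then have trP: "transpose (?P s) = ?P s" for s by (simp add: cscale_def transpose_def vec_eq_iff)
  have chP: "chirp_mat (?P (of_real s))" for s
    unfolding chirp_mat_def by (auto simp: trP cscale_vec cdot_simps cmat_cvec cdot_cvec)
  have m: "met_p Q = mulL2 (chirp (?P (- 1)))"
    by (simp add: fun_eq_iff met_p_def mulL2_def chirp_def cscale_vec cmat_cvec cdot_simps cdot_cvec mult_ac)
  have S: "V_mat Q = block_mat (mat 1) 0 (cscale \<i> (?P (-1))) (mat 1)"
    by (simp add: V_mat_def cscale_def cmat_def vec_eq_iff block_mat_def)
  have ch1: "chirp_mat (?P (- 1))" "chirp_mat (?P 1)" using chP[of "-1"] chP[of 1] by simp_all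
  have inv1: "chirp (?P 1) x * (chirp (?P (-1)) x * y) = y" "chirp (?P (-1)) x * (chirp (?P 1) x * y) = y" for x y
    by (simp_all add: chirp_def cscale_vec cdot_simps flip: exp_add mult.assoc)
  have mm: "mulL2 (chirp (?P 1)) (mulL2 (chirp (?P (-1))) u) = u" "mulL2 (chirp (?P (-1))) (mulL2 (chirp (?P 1)) u) = u" for u
  proof -
    obtain f where f: "sqint f" "u = toL2 f" by (metis L2_cases)
    show "mulL2 (chirp (?P 1)) (mulL2 (chirp (?P (-1))) u) = u" "mulL2 (chirp (?P (-1))) (mulL2 (chirp (?P 1)) u) = u"
      unfolding f(2) using f(1) ch1 by (simp_all only: mulL2_toL2 bdd_mult_chirp bdd_mult_sqint inv1)
  qed
  have VV: "V_mat (- Q) ** V_mat Q = mat 1"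
    unfolding V_mat_def
    by (rule matrix_parts_eqI)
      (simp_all add: block_mat_parts cmat_minus minus_matrix_vector flip: matrix_vector_mul_assoc)
  show ?thesis
    unfolding p(1,2)
  proof (rule covers_bijI[where Y="mulL2 (chirp (?P 1))"])
    show "covers (met_p Q) (V_mat Q)" unfolding m S by (rule covers_chirp[OF ch1(1)])
    show "invertible (V_mat Q)" using VV by (auto simp: invertible_left_inverse)
  qed (simp only: m mm, simp only: m mm, erule covers_gauss[OF covers_chirp[OF ch1(2)]])
next
  case (T E m)
  define k where "k = \<i> powi m * of_real (sqrt \<bar>det E\<bar>)"
  have k: "k \<noteq> 0" using T(3) by (simp add: k_def invertible_det_nz)
  let ?E = "matrix_inv E"
  have E': "invertible ?E" by (rule invertible_matrix_inv[OF T(3)])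
  obtain s where s: "scales_lborel (\<lambda>x. E *v x) s" using scales_matrix[OF T(3)] by blast
  obtain s' where s': "scales_lborel (\<lambda>x. ?E *v x) s'" using scales_matrix[OF E'] by blast
  have X: "X = (\<lambda>u. scaleC_L2 k (compL2 (\<lambda>x. E *v x) u))"
  proof
    fix u
    show "X u = scaleC_L2 k (compL2 (\<lambda>x. E *v x) u)"
      unfolding T(1) met_T_def compL2_def k_def
      by (subst toL2_scaleC) (auto intro: scales_sqint(1)[OF s])
  qed
  have cc: "compL2 (\<lambda>x. E *v x) (compL2 (\<lambda>x. ?E *v x) u) = u" "compL2 (\<lambda>x. ?E *v x) (compL2 (\<lambda>x. E *v x) u) = u" for u
  proof -
    obtain f where f: "sqint f" "u = toL2 f" by (metis L2_cases)
    note s = s s'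
    show "compL2 (\<lambda>x. E *v x) (compL2 (\<lambda>x. ?E *v x) u) = u"
      unfolding f(2) compL2_toL2[OF s(2) f(1)] compL2_toL2[OF s(1) scales_sqint(1)[OF s(2) f(1)]]
      by (simp add: matrix_inv_mult_vec T(3))
    show "compL2 (\<lambda>x. ?E *v x) (compL2 (\<lambda>x. E *v x) u) = u"
      unfolding f(2) compL2_toL2[OF s(1) f(1)] compL2_toL2[OF s(2) scales_sqint(1)[OF s(1) f(1)]]
      by (simp add: matrix_inv_mult_vec T(3))
  qed
  have "D_mat ?E ** D_mat E = mat 1"
    unfolding D_mat_def
    by (rule matrix_parts_eqI)
      (simp_all add: block_mat_parts matrix_inv_twice T(3) cmat_inv_vec cmat_transpose
        matrix_inv_props cmat_one flip: matrix_vector_mul_assoc,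
       simp add: matrix_vector_mul_assoc matrix_inv_props T(3) cmat_one flip: matrix_transpose_mul cmat_mult)
  then have DI: "invertible (D_mat E)" by (auto simp: invertible_left_inverse)
  show ?thesis
    unfolding X T(2)
  proof (rule covers_bijI[where Y="\<lambda>u. scaleC_L2 (1 / k) (compL2 (\<lambda>x. ?E *v x) u)"])
    show "covers (\<lambda>u. scaleC_L2 k (compL2 (\<lambda>x. E *v x) u)) (D_mat E)"
      by (rule covers_scale[OF covers_compL2[OF T(3)]])
  qed (use k in \<open>auto simp: compL2_scaleC[OF s] compL2_scaleC[OF s'] cc DI
        intro!: gauss_class_scale covers_gauss[OF covers_compL2[OF E']]\<close>)
qed

lemma Mp_proj_covers: "Mp_proj X S \<Longrightarrow> covers_bij X S"
  by (induction rule: Mp_proj.induct) (blast intro: met_gen_covers covers_bij_comp covers_bij_inv)+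

section \<open>Elementary tensors\<close>

lemma prod_Basis_vec:
  fixes F :: "real^'n \<Rightarrow> 'b::comm_monoid_mult"
  shows "(\<Prod>b\<in>Basis. F b) = (\<Prod>j\<in>UNIV. F (axis j 1))"
proof -
  have B: "Basis = range (\<lambda>j::'n. axis j (1::real))" by (auto simp: Basis_vec_def)
  have "inj (\<lambda>j::'n. axis j (1::real))" by (auto simp: inj_def axis_eq_axis)
  then show ?thesis unfolding B by (simp add: prod.reindex)
qed

text \<open>Translates an index set of basis vectors, as used by the product structure of Lebesgue measure, to
  the index type.\<close>

definition axis_index :: "real^'n \<Rightarrow> 'n" where "axis_index b = (SOME j. b = axis j 1)"

lemma axis_index_axis [simp]: "axis_index (axis j 1) = j"
  unfolding axis_index_def by (rule some_equality) (auto simp: axis_eq_axis)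

lemma integral_prod_vec:
  fixes f :: "'n::finite \<Rightarrow> real \<Rightarrow> complex"
  assumes f: "\<And>j. integrable lborel (f j)"
  shows "integrable lborel (\<lambda>x::real^'n. \<Prod>j\<in>UNIV. f j (x $ j))"
    and "(LINT x|lborel. (\<Prod>j\<in>UNIV. f j ((x::real^'n) $ j))) = (\<Prod>j\<in>UNIV. (LINT t|lborel. f j t))"
proof -
  have e: "(\<Prod>b\<in>Basis. f (axis_index b) (x \<bullet> b)) = (\<Prod>j\<in>UNIV. f j (x $ j))" for x :: "real^'n"
    by (simp add: prod_Basis_vec inner_axis)
  show "integrable lborel (\<lambda>x::real^'n. \<Prod>j\<in>UNIV. f j (x $ j))"
    using lborel_integral_prod(1)[of "\<lambda>b. f (axis_index b)"] f by (simp add: e)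
  show "(LINT x|lborel. (\<Prod>j\<in>UNIV. f j ((x::real^'n) $ j))) = (\<Prod>j\<in>UNIV. (LINT t|lborel. f j t))"
    using lborel_integral_prod(2)[of "\<lambda>b. f (axis_index b)"] f by (simp add: e) (simp add: prod_Basis_vec)
qed

lemma fourier_prod_vec:
  fixes f :: "'n::finite \<Rightarrow> real \<Rightarrow> complex"
  assumes f: "\<And>j. integrable lborel (f j)"
  shows "fourier (\<lambda>x::real^'n. \<Prod>j\<in>UNIV. f j (x $ j)) \<xi> = (\<Prod>j\<in>UNIV. fourier (f j) (\<xi> $ j))"
proof -
  have "exp (- 2 * of_real pi * \<i> * of_real (\<xi> \<bullet> x)) = (\<Prod>j\<in>UNIV. exp (- 2 * of_real pi * \<i> * of_real (\<xi> $ j \<bullet> x $ j)) :: complex)"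
    for x
    by (simp add: inner_vec_def sum_distrib_left flip: exp_sum)
  then have "fourier (\<lambda>x::real^'n. \<Prod>j\<in>UNIV. f j (x $ j)) \<xi>
      = (LINT x|lborel. (\<Prod>j\<in>UNIV. f j (x $ j) * exp (- 2 * of_real pi * \<i> * of_real (\<xi> $ j \<bullet> x $ j))))"
    unfolding fourier_def by (simp add: prod.distrib)
  also have "\<dots> = (\<Prod>j\<in>UNIV. fourier (f j) (\<xi> $ j))"
    unfolding fourier_def by (rule integral_prod_vec(2)) (rule integrable_fourier_kernel[OF f])
  finally show ?thesis .
qed

text \<open>The cylinder over a null set is null, since its measure is a product with a factor zero; the
  other factors are infinite, and zero times infinity is zero.\<close>

lemma AE_component:
  assumes "AE t in lborel. P (t::real)"
  shows "AE x in lborel. P ((x::real^'n) $ j)"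
proof -
  obtain N where N: "{x. \<not> P x} \<subseteq> N" "emeasure lborel N = 0" "N \<in> sets borel"
    using assms by (auto elim!: AE_E)
  let ?M = "{x::real^'n. x $ j \<in> N}"
  have M: "?M \<in> sets borel"
  proof -
    have "(\<lambda>x::real^'n. x $ j) -` N \<in> sets borel"
      by (rule measurable_sets_borel[OF _ N(3)]) (intro borel_measurable_continuous_onI continuous_intros)
    then show ?thesis by (simp add: vimage_def)
  qed
  let ?f = "\<lambda>b::real^'n. if b = axis j 1 then indicator N else (\<lambda>_. 1 :: ennreal)"
  have "emeasure lborel ?M = (\<integral>\<^sup>+x. indicator ?M x \<partial>lborel)" using M by simp
  also have "\<dots> = (\<integral>\<^sup>+x. (\<Prod>b\<in>Basis. ?f b (x \<bullet> b)) \<partial>lborel)"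
  proof (rule nn_integral_cong)
    fix x :: "real^'n"
    have "(\<Prod>b\<in>Basis. ?f b (x \<bullet> b)) = (\<Prod>i\<in>UNIV. if i = j then indicator N (x $ i) else 1)"
      unfolding prod_Basis_vec by (intro prod.cong refl) (auto simp: axis_eq_axis inner_axis)
    also have "\<dots> = indicator ?M x" by (simp add: prod.delta indicator_def)
    finally show "indicator ?M x = (\<Prod>b\<in>Basis. ?f b (x \<bullet> b))" by simp
  qed
  also have "\<dots> = (\<Prod>b\<in>Basis. (\<integral>\<^sup>+t. ?f b t \<partial>lborel))"
    using N(3) by (intro nn_integral_lborel_prod) (auto intro: borel_measurable_indicator)
  also have "\<dots> = 0"
    using N by (intro prod_zero) (auto intro!: bexI[of _ "axis j 1"] simp: axis_in_Basis_iff)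
  finally show ?thesis
    using N(1) M by (intro AE_I'[of ?M]) (auto simp: null_sets_def)
qed

text \<open>A representative of each factor is determined up to a null set of the line only; \<open>AE_component\<close>
  makes the product independent of the choice.\<close>

lemma tensor_L2_toL2:
  fixes f :: "'n::finite \<Rightarrow> real \<Rightarrow> complex"
  assumes f: "\<And>j. sqint (f j)" and p: "sqint (\<lambda>x::real^'n. \<Prod>j\<in>UNIV. f j (x $ j))"
  shows "tensor_L2 (\<lambda>j. toL2 (f j)) = toL2 (\<lambda>x. \<Prod>j\<in>UNIV. f j (x $ j))"
  unfolding tensor_L2_def
proof (rule toL2_cong_AE(2)[OF p])
  have [measurable]: "fromL2 (toL2 (f j)) \<in> borel_measurable borel" for j
    using sqint_measurable[OF sqint_fromL2, of "toL2 (f j)"] by simp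
  have [measurable]: "(\<lambda>x::real^'n. x $ j) \<in> borel_measurable borel" for j
    by (intro borel_measurable_continuous_onI continuous_intros)
  show "(\<lambda>x::real^'n. \<Prod>j\<in>UNIV. fromL2 (toL2 (f j)) (x $ j)) \<in> borel_measurable lborel"
    by (intro borel_measurable_prod) measurable
  have "AE x::real^'n in lborel. fromL2 (toL2 (f j)) (x $ j) = f j (x $ j)" for j
    by (rule AE_component[OF AE_fromL2_toL2[OF f]])
  then have "AE x::real^'n in lborel. \<forall>j\<in>UNIV. fromL2 (toL2 (f j)) (x $ j) = f j (x $ j)"
    by (intro AE_finite_allI) auto
  then show "AE x::real^'n in lborel. (\<Prod>j\<in>UNIV. f j (x $ j)) = (\<Prod>j\<in>UNIV. fromL2 (toL2 (f j)) (x $ j))"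
    by eventually_elim simp
qed

lemma wave_packet_vec: "wave_packet 0 w x = (\<Prod>j\<in>UNIV. wave_packet 0 (w $ j) ((x::real^'n) $ j))"
  by (simp add: wave_packet_def quad_gauss_def inner_vec_def sum_distrib_left flip: exp_sum)
     (simp add: sum_subtractf sum_negf)

section \<open>Atomic contractions\<close>

definition gauss_damp :: "real \<Rightarrow> real \<Rightarrow> complex" where
  "gauss_damp s x = exp (- of_real (pi * s * x\<^sup>2))"

lemma bdd_mult_gauss_damp: "s \<ge> 0 \<Longrightarrow> bdd_mult (gauss_damp s)"
  unfolding bdd_mult_def gauss_damp_def
  by (intro conjI borel_measurable_continuous_onI continuous_intros exI[of _ 1] allI)
     (simp add: norm_exp_eq_Re)

definition damped :: "real \<Rightarrow> real \<Rightarrow> real \<Rightarrow> complex" where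
  "damped s w \<eta> = gauss_damp s \<eta> * fourier (wave_packet 0 w) \<eta>"

text \<open>The common form of both kinds of one-dimensional factors applied to a modulated Gaussian: a Fourier
  transform, damping with parameter \<open>s\<close>, a Fourier transform, a dilation by \<open>- 1 / c\<close> (the sign
  turns the second Fourier transform into an inverse one) and damping with parameter \<open>t\<close>.
  The first kind has \<open>c = cosh \<theta>\<close> and \<open>s = t = tanh \<theta>\<close>, the second one \<open>c = 1\<close>, \<open>s = 0\<close> and \<open>t = \<alpha>\<close>.\<close>

definition factor_image :: "real \<Rightarrow> real \<Rightarrow> real \<Rightarrow> real \<Rightarrow> real \<Rightarrow> complex" where
  "factor_image c s t w x = of_real (c powr (- 1 / 2)) * (gauss_damp t x * fourier (damped s w) (- (1 / c) * x))"

lemma plancherel_core_wave_packet_props: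
  "integrable lborel (fourier (wave_packet s t))" "sqint (fourier (wave_packet s t))"
  using plancherel_core_wave_packet[of s t] by (auto simp: plancherel_core_def)

lemma integrable_bdd_mult:
  assumes m: "bdd_mult m" and f: "integrable lborel f"
  shows "integrable lborel (\<lambda>x. m x * f x)"
proof -
  obtain C where C: "\<And>x. cmod (m x) \<le> C" and [measurable]: "m \<in> borel_measurable borel" using m by (auto simp: bdd_mult_def)
  have C0: "C \<ge> 0" using C by (meson norm_ge_zero order.trans)
  have [measurable]: "f \<in> borel_measurable borel" using borel_measurable_integrable[OF f] by simp
  show ?thesis
    by (rule Bochner_Integration.integrable_bound[OF integrable_mult_right[OF f, of "of_real C"]])
       (use C C0 in \<open>auto simp: norm_mult intro!: mult_right_mono\<close>)
qed

lemma damped_props: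
  assumes "s \<ge> 0" shows "integrable lborel (damped s w)" "sqint (damped s w)"
  unfolding damped_def
  by (intro integrable_bdd_mult bdd_mult_sqint bdd_mult_gauss_damp plancherel_core_wave_packet_props assms)+

lemma sqint_factor_image:
  assumes "c > 0" "s \<ge> 0" "t \<ge> 0"
  shows "sqint (factor_image c s t w)"
  unfolding factor_image_def
  using assms
  by (intro sqint_scale bdd_mult_sqint bdd_mult_gauss_damp scales_sqint(1)[OF scales_real] plancherel(1) damped_props) auto

lemma fourier_twice_wave_packet: "fourier (fourier (wave_packet s t)) x = wave_packet s t (- x)"
proof -
  have "fourier (wave_packet s t) = (\<lambda>\<xi>. wave_packet_const s t * wave_packet t (- s) \<xi>)" by (simp add: fourier_wave_packet fun_eq_iff)
  then show ?thesis
    using wave_packet_const_inverse[of s t]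
    by (simp add: fourier_scale fourier_wave_packet mult.assoc[symmetric]) (simp add: wave_packet_def quad_gauss_def)
qed

lemma contr_p_image:
  assumes "\<alpha> > 0"
  shows "contr_p \<alpha> (toL2 (wave_packet 0 w)) = toL2 (factor_image 1 0 \<alpha> w)"
proof -
  have "factor_image 1 0 \<alpha> w = (\<lambda>x. gauss_damp \<alpha> x * wave_packet 0 w x)"
    by (simp add: factor_image_def damped_def[abs_def] gauss_damp_def[of 0] fourier_twice_wave_packet fun_eq_iff)
  moreover have "contr_p \<alpha> u = mulL2 (gauss_damp \<alpha>) u" for u
    by (simp add: contr_p_def mulL2_def gauss_damp_def exp_of_real[symmetric] del: exp_of_real)
  ultimately show ?thesis
    using assms by (simp add: mulL2_toL2 bdd_mult_gauss_damp sqint_wave_packet)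
qed

text \<open>The kernel splits as \<open>exp (- \<pi> x\<^sup>2 tanh \<theta>) exp (- \<pi> \<eta>\<^sup>2 tanh \<theta>) exp (2 \<pi> i x \<eta> / cosh \<theta>)\<close>, so the truncated
  integrals are images of truncated Fourier integrals under one bounded operator, and the limit may
  be taken inside. This treats \<open>\<theta> = 0\<close>, where the kernel does not decay, on the same footing.\<close>

lemma contr_R_image:
  fixes \<theta> w :: real
  assumes "\<theta> \<ge> 0"
  shows "contr_R \<theta> (toL2 (wave_packet 0 w)) = toL2 (factor_image (cosh \<theta>) (tanh \<theta>) (tanh \<theta>) w)"
proof -
  let ?c = "cosh \<theta>" and ?t = "tanh \<theta>" and ?\<phi> = "\<lambda>x. - (1 / cosh \<theta>) * (x::real)"
  have c: "?c > 0" by simp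
  have t: "?t \<ge> 0" using assms by simp
  have s: "scales_lborel ?\<phi> \<bar>- (1 / ?c)\<bar>" by (rule scales_real) simp
  let ?T = "\<lambda>u. scaleC_L2 (of_real (?c powr (- 1 / 2))) (mulL2 (gauss_damp ?t) (compL2 ?\<phi> u))"
  have T: "bounded_linear ?T"
    by (intro bounded_linear_compose[OF bounded_linear_scaleC] bounded_linear_compose[OF bounded_linear_mulL2]
        bounded_linear_compL2[OF s] bdd_mult_gauss_damp t)
  have T_eq: "?T (toL2 f) = toL2 (\<lambda>x. of_real (?c powr (- 1 / 2)) * (gauss_damp ?t x * f (?\<phi> x)))" if "sqint f" for f
    by (simp only: compL2_toL2[OF s that] mulL2_toL2 bdd_mult_gauss_damp t scales_sqint(1)[OF s that] toL2_scaleC bdd_mult_sqint)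
  note d = damped_props[OF t, of w]
  have ft: "sqint (fourier (ball_cutoff n (damped ?t w)))" for n by (intro plancherel ball_cutoff_props d)
  define F where "F = fromL2 (fourierL2 (toL2 (wave_packet 0 w)))"
  have F: "fourierL2 (toL2 (wave_packet 0 w)) = toL2 (fourier (wave_packet 0 w))" by (rule fourierL2_toL2[OF integrable_wave_packet sqint_wave_packet])
  have [measurable]: "F \<in> borel_measurable borel" unfolding F_def using sqint_measurable[OF sqint_fromL2] by simp
  have [measurable]: "fourier (wave_packet 0 w) \<in> borel_measurable borel" using sqint_measurable[OF plancherel_core_wave_packet_props(2)] by simp
  have ae: "AE \<eta> in lborel. F \<eta> = fourier (wave_packet 0 w) \<eta>" unfolding F_def F by (rule AE_fromL2_toL2[OF plancherel_core_wave_packet_props(2)])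
  have inner: "of_real (?c powr (- 1 / 2)) *
     (LINT \<eta>|lborel. indicator (cball 0 (real n)) \<eta>
        * exp (\<i> * of_real pi * (2 * of_real x * of_real \<eta> + \<i> * of_real ((x\<^sup>2 + \<eta>\<^sup>2) * sinh \<theta>)) / of_real ?c) * F \<eta>)
     = of_real (?c powr (- 1 / 2)) * (gauss_damp ?t x * fourier (ball_cutoff n (damped ?t w)) (?\<phi> x))" for n x
  proof -
    have ex: "exp (\<i> * of_real pi * (2 * of_real x * of_real \<eta> + \<i> * of_real ((x\<^sup>2 + \<eta>\<^sup>2) * sinh \<theta>)) / of_real ?c)
        = gauss_damp ?t x * (gauss_damp ?t \<eta> * exp (- 2 * of_real pi * \<i> * of_real (?\<phi> x \<bullet> \<eta>)))" for \<eta>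
      unfolding gauss_damp_def exp_add[symmetric]
      by (rule arg_cong[where f=exp]) (simp add: tanh_def field_simps)
    have "(LINT \<eta>|lborel. indicator (cball 0 (real n)) \<eta>
        * exp (\<i> * of_real pi * (2 * of_real x * of_real \<eta> + \<i> * of_real ((x\<^sup>2 + \<eta>\<^sup>2) * sinh \<theta>)) / of_real ?c) * F \<eta>)
      = (LINT \<eta>|lborel. indicator (cball 0 (real n)) \<eta>
        * (gauss_damp ?t x * (gauss_damp ?t \<eta> * exp (- 2 * of_real pi * \<i> * of_real (?\<phi> x \<bullet> \<eta>)))) * fourier (wave_packet 0 w) \<eta>)"
      unfolding ex
    proof (rule integral_cong_AE)
      have [measurable]: "gauss_damp ?t \<in> borel_measurable borel" using bdd_mult_gauss_damp[OF t] by (simp add: bdd_mult_def)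
      have [measurable]: "(indicator (cball 0 (real n)) :: real \<Rightarrow> complex) \<in> borel_measurable borel"
        by (rule borel_measurable_indicator) simp
      show "(\<lambda>\<eta>. indicator (cball 0 (real n)) \<eta> * (gauss_damp ?t x * (gauss_damp ?t \<eta> * exp (- 2 * of_real pi * \<i> * of_real (?\<phi> x \<bullet> \<eta>)))) * F \<eta>) \<in> borel_measurable lborel"
        "(\<lambda>\<eta>. indicator (cball 0 (real n)) \<eta> * (gauss_damp ?t x * (gauss_damp ?t \<eta> * exp (- 2 * of_real pi * \<i> * of_real (?\<phi> x \<bullet> \<eta>)))) * fourier (wave_packet 0 w) \<eta>) \<in> borel_measurable lborel"
        by measurable
    qed (use ae in \<open>auto elim: eventually_mono\<close>)
    also have "\<dots> = gauss_damp ?t x * fourier (ball_cutoff n (damped ?t w)) (?\<phi> x)"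
      unfolding fourier_def[of "ball_cutoff n (damped ?t w)"] integral_mult_right_zero[symmetric]
      by (intro Bochner_Integration.integral_cong refl) (simp add: ball_cutoff_def damped_def mult_ac)
    finally show ?thesis by simp
  qed
  have "contr_R \<theta> (toL2 (wave_packet 0 w)) = lim (\<lambda>n. ?T (toL2 (fourier (ball_cutoff n (damped ?t w)))))"
    unfolding contr_R_def F_def[symmetric] inner T_eq[OF ft] by (rule refl)
  also have "\<dots> = ?T (toL2 (fourier (damped ?t w)))"
    by (intro limI bounded_linear.tendsto[OF T] fourier_ball_cutoff_tendsto d)
  also have "\<dots> = toL2 (factor_image ?c ?t ?t w)"
    unfolding T_eq[OF plancherel(1)[OF d]] factor_image_def[abs_def] by (rule refl)
  finally show ?thesis .
qed

text \<open>The matrix entries are those of the product \<open>V\<^bsub>it\<^esub> D J V\<^bsub>is\<^esub> J\<close> of two by two matrices that belongs to the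
  composition in \<open>factor_image\<close>, with \<open>D\<close> the diagonal matrix with entries \<open>- k\<close> and \<open>- 1 / k\<close>.\<close>

lemma atomic_factor_image:
  assumes "atomic_factor A a b c d"
  shows "\<exists>k s t. k > 0 \<and> s \<ge> 0 \<and> t \<ge> 0 \<and> a = of_real k \<and> b = - \<i> * of_real (k * s) \<and> c = \<i> * of_real (t * k)
    \<and> d = of_real (1 / k + t * k * s) \<and> (\<forall>w. A (toL2 (wave_packet 0 w)) = toL2 (factor_image k s t w))"
  using assms
proof cases
  case (R \<theta>)
  have "cosh \<theta> = 1 / cosh \<theta> + tanh \<theta> * cosh \<theta> * tanh \<theta>"
    using cosh_square_eq[of \<theta>] by (simp add: tanh_def field_simps power2_eq_square)
  moreover have "cosh \<theta> * tanh \<theta> = sinh \<theta>" by (simp add: tanh_def)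
  moreover have "tanh \<theta> \<ge> 0" using R by simp
  ultimately show ?thesis
    using R contr_R_image[OF R(6)]
    by (intro exI[of _ "cosh \<theta>"] exI[of _ "tanh \<theta>"]) (simp add: mult.commute)
next
  case (p \<alpha>)
  then show ?thesis
    using contr_p_image[of \<alpha>] by (intro exI[of _ 1] exI[of _ 0] exI[of _ \<alpha>]) simp
qed

lemma diag_mat_vec: "diag_mat a *v x = (\<chi> i. a i * x $ i)"
  by (simp add: diag_mat_def matrix_vector_mult_def vec_eq_iff if_distrib if_distribR cong: if_cong)

definition real_diag :: "('n \<Rightarrow> real) \<Rightarrow> real^'n^'n" where
  "real_diag a = (\<chi> i j. if i = j then a i else 0)"

lemma cmat_real_diag: "cmat (real_diag a) = diag_mat (\<lambda>i. of_real (a i))"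
  by (simp add: cmat_def real_diag_def diag_mat_def vec_eq_iff)

lemma real_diag_vec: "real_diag a *v x = (\<chi> i. a i * x $ i)"
  by (simp add: real_diag_def matrix_vector_mult_def vec_eq_iff if_distrib if_distribR cong: if_cong)

lemma transpose_real_diag: "transpose (real_diag a) = real_diag a"
  by (simp add: real_diag_def transpose_def vec_eq_iff)

lemma real_diag_inv:
  assumes "\<And>i. a i \<noteq> 0"
  shows "invertible (real_diag a)" "matrix_inv (real_diag a) = real_diag (\<lambda>i. 1 / a i)"
proof -
  have 1: "real_diag a ** real_diag (\<lambda>i. 1 / a i) = mat 1" "real_diag (\<lambda>i. 1 / a i) ** real_diag a = mat 1"
    unfolding matrix_eq using assms by (simp_all add: real_diag_vec vec_eq_iff flip: matrix_vector_mul_assoc)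
  then show "invertible (real_diag a)" by (auto simp: invertible_def)
  show "matrix_inv (real_diag a) = real_diag (\<lambda>i. 1 / a i)" by (rule matrix_inv_unique) (rule 1)+
qed

lemma chirp_mat_diag:
  "(\<And>j. s j \<ge> 0) \<Longrightarrow> chirp_mat (diag_mat (\<lambda>j. of_real (s j)) :: complex^'n^'n)"
proof -
  assume s: "\<And>j. s j \<ge> 0"
  have "Re (cdot (diag_mat (\<lambda>j. of_real (s j)) *v cvec x) (cvec x)) = (\<Sum>j\<in>UNIV. s j * (x $ j)\<^sup>2)" for x
    by (simp add: diag_mat_vec cdot_def cvec_def power2_eq_square mult.assoc)
  moreover have "(\<Sum>j\<in>UNIV. s j * (x $ j)\<^sup>2) \<ge> 0" for x :: "real^'n"
    by (intro sum_nonneg mult_nonneg_nonneg s) simp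
  ultimately show ?thesis
    by (simp add: chirp_mat_def diag_mat_def transpose_def vec_eq_iff)
qed

lemma chirp_diag: "chirp (diag_mat (\<lambda>j. of_real (s j))) x = (\<Prod>j\<in>UNIV. gauss_damp (s j) (x $ j))"
  by (simp add: chirp_def gauss_damp_def diag_mat_vec cdot_def cvec_def sum_distrib_left sum_negf[symmetric]
      power2_eq_square mult_ac flip: exp_sum)

text \<open>\<open>B0\<close> is the composition described at \<open>factor_image\<close>, carried out in dimension \<open>d\<close> with diagonal
  matrices. On a modulated standard Gaussian every step factorizes over the coordinates, so up to
  the scalar \<open>K\<close> it agrees with the tensor product there.\<close>

lemma atomic_contr_covers:
  fixes B :: "(real^'n) L2 \<Rightarrow> (real^'n) L2"
  assumes "atomic_contr B \<Xi>"
  shows "covers B \<Xi>"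
proof -
  obtain A a b c d where fac: "\<And>j. atomic_factor (A j) (a j) (b j) (c j) (d j)" and B: "is_tensor_op A B"
    and \<Xi>: "\<Xi> = block_mat (diag_mat a) (diag_mat b) (diag_mat c) (diag_mat d)"
    using assms unfolding atomic_contr_def by blast
  from atomic_factor_image[OF fac] obtain k s t where k: "\<And>j. k j > 0" and s: "\<And>j. s j \<ge> 0" and t: "\<And>j. t j \<ge> 0"
    and abcd: "\<And>j. a j = of_real (k j)" "\<And>j. b j = - \<i> * of_real (k j * s j)"
      "\<And>j. c j = \<i> * of_real (t j * k j)" "\<And>j. d j = of_real (1 / k j + t j * k j * s j)"
    and img: "\<And>j w. A j (toL2 (wave_packet 0 w)) = toL2 (factor_image (k j) (s j) (t j) w)"
    by metis
  let ?E = "real_diag (\<lambda>j. - (1 / k j))"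
  have E: "invertible ?E" and Ei: "matrix_inv ?E = real_diag (\<lambda>j. - k j)"
    using k real_diag_inv[of "\<lambda>j. - (1 / k j)"] by (auto simp: less_imp_neq[symmetric])
  obtain e where e: "scales_lborel (\<lambda>x. ?E *v x) e" using scales_matrix[OF E] by blast
  let ?s = "diag_mat (\<lambda>j. complex_of_real (s j))" and ?t = "diag_mat (\<lambda>j. complex_of_real (t j))"
  have cs: "chirp_mat ?s" and ct: "chirp_mat ?t" by (intro chirp_mat_diag s t)+
  define K where "K = (\<Prod>j\<in>UNIV. complex_of_real (k j powr (- 1 / 2)))"
  define B0 where "B0 = (mulL2 (chirp ?t) \<circ> (compL2 (\<lambda>x. ?E *v x) \<circ> (fourierL2 \<circ> (mulL2 (chirp ?s) \<circ> fourierL2))) :: (real^'n) L2 \<Rightarrow> _)"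
  define B' where "B' = (\<lambda>u. scaleC_L2 K (B0 u))"
  have cov: "covers B' (block_mat (mat 1) 0 (cscale \<i> ?t) (mat 1) ** (D_mat ?E ** (J_mat ** (block_mat (mat 1) 0 (cscale \<i> ?s) (mat 1) ** J_mat))))"
    unfolding B'_def B0_def
    by (intro covers_scale covers_comp covers_chirp covers_compL2 covers_fourierL2 cs ct E)
  have mat: "block_mat (mat 1) 0 (cscale \<i> ?t) (mat 1) ** (D_mat ?E ** (J_mat ** (block_mat (mat 1) 0 (cscale \<i> ?s) (mat 1) ** J_mat))) = \<Xi>"
    unfolding \<Xi> D_mat_def Ei transpose_real_diag cmat_real_diag
    using k by (intro matrix_parts_eqI)
      (simp_all add: block_mat_parts J_mat_parts cscale_vec diag_mat_vec abcd vec_eq_iff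
        less_imp_neq[symmetric] field_simps flip: matrix_vector_mul_assoc)
  have "B u = B' u" for u
  proof (rule L2_map_ext[where g="wave_packet 0 0" and A=B and B=B'])
    show "bounded_linear B" using B by (simp add: is_tensor_op_def)
    show "bounded_linear B'"
      unfolding B'_def B0_def comp_def
      by (intro bounded_linear_compose[OF bounded_linear_scaleC] bounded_linear_compose[OF bounded_linear_mulL2]
          bounded_linear_compose[OF bounded_linear_compL2[OF e]] bounded_linear_compose[OF bounded_linear_fourierL2]
          bounded_linear_fourierL2 bdd_mult_chirp cs ct)
    fix q :: complex and w :: "real^'n"
    have scB: "B (scaleC_L2 q u) = scaleC_L2 q (B u)" for u using B by (simp add: is_tensor_op_def)
    have scB': "B' (scaleC_L2 q u) = scaleC_L2 q (B' u)" for u using cov by (simp add: covers_def)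
    have Fw: "fourier (wave_packet 0 w) \<eta> = (\<Prod>j\<in>UNIV. fourier (wave_packet 0 (w $ j)) (\<eta> $ j))" for \<eta>
      using fourier_prod_vec[where f="\<lambda>j. wave_packet 0 (w $ j)", OF integrable_wave_packet] by (simp flip: wave_packet_vec)
    define h where "h \<eta> = chirp ?s \<eta> * fourier (wave_packet 0 w) \<eta>" for \<eta>
    have h: "sqint h" "integrable lborel h"
      unfolding h_def by (intro bdd_mult_sqint integrable_bdd_mult bdd_mult_chirp cs plancherel_core_wave_packet_props)+
    have h_prod: "h = (\<lambda>\<eta>. \<Prod>j\<in>UNIV. damped (s j) (w $ j) (\<eta> $ j))"
      by (simp add: h_def fun_eq_iff Fw chirp_diag damped_def prod.distrib)
    have Fh: "fourier h \<xi> = (\<Prod>j\<in>UNIV. fourier (damped (s j) (w $ j)) (\<xi> $ j))" for \<xi>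
      unfolding h_prod by (rule fourier_prod_vec) (rule damped_props[OF s])
    have sh: "sqint (\<lambda>x. fourier h (?E *v x))" by (intro scales_sqint(1)[OF e] plancherel(1) h)
    have img_prod: "K * (chirp ?t x * fourier h (?E *v x)) = (\<Prod>j\<in>UNIV. factor_image (k j) (s j) (t j) (w $ j) (x $ j))" for x
      by (simp add: K_def chirp_diag Fh real_diag_vec factor_image_def prod.distrib)
    have si: "sqint (\<lambda>x. K * (chirp ?t x * fourier h (?E *v x)))"
      by (intro sqint_scale bdd_mult_sqint bdd_mult_chirp ct sh)
    have "B' (toL2 (wave_packet 0 w)) = toL2 (\<lambda>x. K * (chirp ?t x * fourier h (?E *v x)))"
    proof -
      have "mulL2 (chirp ?s) (fourierL2 (toL2 (wave_packet 0 w))) = toL2 h"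
        unfolding h_def by (simp add: fourierL2_toL2 integrable_wave_packet sqint_wave_packet mulL2_toL2 bdd_mult_chirp cs plancherel_core_wave_packet_props)
      then have "B' (toL2 (wave_packet 0 w)) = scaleC_L2 K (mulL2 (chirp ?t) (compL2 (\<lambda>x. ?E *v x) (fourierL2 (toL2 h))))"
        by (simp add: B'_def B0_def)
      also have "\<dots> = toL2 (\<lambda>x. K * (chirp ?t x * fourier h (?E *v x)))"
        by (simp only: fourierL2_toL2 h compL2_toL2[OF e] plancherel(1) mulL2_toL2 bdd_mult_chirp ct sh toL2_scaleC bdd_mult_sqint)
      finally show ?thesis .
    qed
    also have "\<dots> = tensor_L2 (\<lambda>j. A j (toL2 (wave_packet 0 (w $ j))))"
      using tensor_L2_toL2[of "\<lambda>j. factor_image (k j) (s j) (t j) (w $ j)"] si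
      by (simp add: img img_prod sqint_factor_image k s t)
    also have "\<dots> = B (tensor_L2 (\<lambda>j. toL2 (wave_packet 0 (w $ j))))" using B by (simp add: is_tensor_op_def)
    also have "tensor_L2 (\<lambda>j. toL2 (wave_packet 0 (w $ j))) = toL2 (wave_packet 0 w)"
      using tensor_L2_toL2[of "\<lambda>j. wave_packet 0 (w $ j)"] sqint_wave_packet[of 0 w] by (simp add: sqint_wave_packet flip: wave_packet_vec)
    finally show "B (scaleC_L2 q (toL2 (\<lambda>x. modul w x * wave_packet 0 0 x))) = B' (scaleC_L2 q (toL2 (\<lambda>x. modul w x * wave_packet 0 0 x)))"
      by (simp add: modul_gauss_eq_wave_packet scB scB')
  qed (auto simp: sqint_wave_packet wave_packet_nonzero)
  then have "B = B'" by auto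
  then show ?thesis using cov mat by simp
qed

lemma Mp_plus_proj_covers: "Mp_plus_proj X S \<Longrightarrow> covers X S"
proof (induction rule: Mp_plus_proj.induct)
  case (Mp A S) then show ?case using Mp_proj_covers by (auto simp: covers_bij_def)
next
  case (atomic A S) then show ?case by (rule atomic_contr_covers)
next
  case (comp A S B T) then show ?case by (intro covers_comp)
qed

section \<open>The span of phase space shifted Gaussians\<close>

lemma gaussian_eq_cgauss: "gaussian M = cgauss (cmat M) 0"
  by (simp add: fun_eq_iff gaussian_def cgauss_def quad_gauss_def cmat_cvec cdot_cvec)

lemma gauss_mat_cmat: "pos_def M \<Longrightarrow> gauss_mat (cmat M)"
  by (auto simp: pos_def_def gauss_mat_def cmat_cvec cdot_cvec simp flip: cmat_transpose)

lemma pos_def_one: "pos_def (mat 1)"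
  by (simp add: pos_def_def)

lemma gaussian_span_generators:
  assumes "pos_def M"
  shows "rho (cvec z) \<tau> (toL2 (gaussian M)) \<in> gauss_class"
proof (rule gauss_class_rho(2))
  have "toL2 (cgauss (cmat M) 0) = scaleC_L2 1 (toL2 (cgauss (cmat M) 0))" by simp
  then show "toL2 (gaussian M) \<in> gauss_class"
    unfolding gauss_class_def gaussian_eq_cgauss using gauss_mat_cmat[OF assms] by blast
qed

text \<open>Frequency shifts of the standard Gaussian alone already span a dense subspace.\<close>

lemma gaussian_span_dense: "closure (gaussian_span :: (real^'n) L2 set) = UNIV"
proof -
  interpret modulation_span "wave_packet (0::real^'n) 0" by unfold_locales (auto simp: sqint_wave_packet wave_packet_nonzero)
  let ?S = "{rho (cvec z) \<tau> (toL2 (gaussian M)) | z \<tau> M. pos_def M} :: (real^'n) L2 set"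
  have "toL2 (\<lambda>x. modul w x * wave_packet 0 0 x) \<in> ?S" for w :: "real^'n"
  proof -
    define z :: "real^('n+'n)" where "z = (\<chi> i. case i of Inl _ \<Rightarrow> 0 | Inr j \<Rightarrow> w $ j)"
    have z: "pos_part (cvec z) = 0" "freq_part (cvec z) = cvec w"
      by (simp_all add: z_def pos_part_def freq_part_def cvec_def vec_eq_iff)
    have "cgauss (mat 1) (\<i> *s cvec w) = wave_packet 0 w"
      by (simp add: fun_eq_iff cgauss_def wave_packet_def quad_gauss_def cdot_simps cdot_cvec)
    moreover have "gauss_mat (mat 1 :: complex^'n^'n)"
      using gauss_mat_cmat[OF pos_def_one] by (simp add: cmat_one)
    ultimately have "rho (cvec z) 0 (toL2 (gaussian (mat 1))) = toL2 (wave_packet 0 w)"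
      by (simp add: gaussian_eq_cgauss rho_cgauss rho_coeff_def rho_lin_def z phase_def cmat_one)
    then have "toL2 (wave_packet 0 w) \<in> ?S" using pos_def_one by (metis (mono_tags, lifting) mem_Collect_eq)
    then show ?thesis by (simp add: modul_gauss_eq_wave_packet)
  qed
  then have "cL2.span (range (\<lambda>w. toL2 (\<lambda>x. modul w x * wave_packet (0::real^'n) 0 x))) \<subseteq> gaussian_span"
    unfolding gaussian_span_def by (intro cL2.span_mono) blast
  then have "mod_closure \<subseteq> closure gaussian_span" unfolding mod_closure_def by (rule closure_mono)
  then show ?thesis using modulations_dense by auto
qed

lemma covers_intertwines_span:
  fixes X :: "(real^'n) L2 \<Rightarrow> (real^'n) L2"
  assumes X: "covers X S" and f: "f \<in> gaussian_span"
  shows "f \<in> rho_dom Z \<tau> \<and> X f \<in> rho_dom (S *v Z) \<tau> \<and> X (rho Z \<tau> f) = rho (S *v Z) \<tau> (X f)"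
  using f unfolding gaussian_span_def
proof (induction rule: cL2.span_induct_alt)
  case base
  have "X (scaleC_L2 0 0) = scaleC_L2 0 (X 0)" using X unfolding covers_def by blast
  then have "X 0 = 0" by simp
  then show ?case by (simp add: rho_zero)
next
  case (step c u v)
  have add: "X (u + v) = X u + X v" and scale: "X (scaleC_L2 c u) = scaleC_L2 c (X u)" for u v c
    using X by (auto simp: covers_def)
  have u: "u \<in> gauss_class" using step(1) gaussian_span_generators by auto
  then have Xu: "X u \<in> gauss_class" "X (rho Z \<tau> u) = rho (S *v Z) \<tau> (X u)" using X by (auto simp: covers_def)
  note dom = gauss_class_rho(1)[OF u] gauss_class_rho(1)[OF Xu(1)]
  show ?case
    using step(2) dom Xu(2) by (simp add: add scale rho_add rho_scaleC)
qed

theorem theorem1p5: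
  fixes Shat :: "(real^'n) L2 \<Rightarrow> (real^'n) L2"
    and S :: "complex^('n+'n)^('n+'n)"
  assumes "Shat \<in> Mp_plus"
    and "S \<in> Sp_plus"
    and "Mp_plus_proj Shat S"
  shows "closure (gaussian_span :: (real^'n) L2 set) = UNIV
    \<and> (\<forall>f\<in>gaussian_span. \<forall>(z::real^('n+'n)) (\<tau>::real).
         f \<in> rho_dom (cvec z) \<tau>
         \<and> Shat f \<in> rho_dom (S *v cvec z) \<tau>
         \<and> Shat (rho (cvec z) \<tau> f) = rho (S *v cvec z) \<tau> (Shat f))"
  using gaussian_span_dense covers_intertwines_span[OF Mp_plus_proj_covers[OF assms(3)]] by blast

end
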